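(* Let $\mathcal F=(F,<,+,\cdot,0,1,\ldots)$ be a definably complete expansion of an ordered field which enjoys the definable choice property, admits a good $(0+)$-pseudo-filter $\mathfrak D$, and has a good extended rank function $\operatorname{eRank}$. Let $X$ be a nonempty definable set and let $E$ be a definable equivalence relation on $X$ which is definably proper over $X$. Then there exists a definable proper quotient $\pi:X\to X/E$.
   Context: Let $\mathcal F=(F,<,\ldots)$ be an expansion of a dense linear order without endpoints. "Definable" means definable in $\mathcal F$ with parameters; a definable map is a map between definable sets whose graph is definable. $F$ carries the order topology, $F^n$ the product topology, and subsets of $F^n$ the relative topology. $\mathcal F$ is definably complete if every definable subset of $F$ has both a supremum and an infimum in $F\cup\{\pm\infty\}$. A definable subset of $F^n$ is definably compact if it is closed and bounded in $F^n$. Definable choice property: (1) for every coordinate projection $\pi:F^{m+n}\to F^m$ and definable sets $X\subseteq F^m$, $Y\subseteq F^{m+n}$ with $\pi(Y)=X$, there is a definable map $\varphi:X\to Y$ with $\pi(\varphi(x))=x$ for all $x\in X$; (2) for every definable equivalence relation $E$ on a definable set $X$ (i.e. $E\subseteq X\times X$ is definable and is an equivalence relation) there is a definable subset $S\subseteq X$ meeting each equivalence class of $E$ in exactly one point. Good $(0+)$-pseudo-filter: let $\mathfrak D$ be a nonempty family of definable subsets of $(0,\infty)$ whose closure in $F$ contains $0$. For a definable set $D\subseteq(0,\infty)$ with $0$ in its closure and a definable map $f:D\to F^n$, the limit set $\operatorname{Lim}(f)$ is the set of $p\in F^n$ such that $f^{-1}(B)\cap I\neq\emptyset$ for every open box $B\subseteq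 F^n$ containing $p$ and every open interval $I$ containing $0$. $\mathfrak D$ is a good $(0+)$-pseudo-filter if: (a) each $D\in\mathfrak D$ is bounded in $F$ and $\operatorname{cl}_F(D)=D\cup\{0\}$; (b) for each $D\in\mathfrak D$ and definable $D_1,D_2$ with $D=D_1\cup D_2$, either $D_1$ or $D_2$ contains an element of $\mathfrak D$; (c) for $D\in\mathfrak D$ and a definable map $\gamma:D\to F^n$, there is $D'\in\mathfrak D$ with $D'\subseteq D$ such that $\gamma|_{D'}$ is continuous; furthermore, if $\operatorname{Lim}(\gamma)\ne\emptyset$, $D'$ can be taken so that $\operatorname{Lim}(\gamma|_{D'})$ is a singleton. Good extended rank function: for each $n\ge 0$, let $\operatorname{Def}(F^n)$ be the set of definable subsets of $F^n$. $\mathcal F$ has a good extended rank function if for each $n$ there is a map $\operatorname{eRank}_n:\operatorname{Def}(F^n)\to\mathcal E_n\cup\{-\infty\}$ such that: (a) $\mathcal E_n$ is a linearly ordered set with a smallest element and $-\infty$ is smaller than any element of $\mathcal E_n$; (b) $\operatorname{eRank}_n(X)=-\infty$ iff $X=\emptyset$; (c) there is no infinite strictly decreasing sequence in $\mathcal E_n$; (d) $\operatorname{eRank}_n(A\cup B)=\max\{\operatorname{eRank}_n(A),\operatorname{eRank}_n(B)\}$; (e) if $X\subseteq Y$ are in $\operatorname{Def}(F^n)$ and $\operatorname{eRank}_n(X)=\operatorname{eRank}_n(Y)$, there is a definable subset $U$ of $X$ that is open in $Y$ with $\operatorname{eRank}_n(X\setminus U)<\operatorname{eRank}_n(Y)$;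 (f) a nonempty $X\in\operatorname{Def}(F^n)$ is discrete whenever $\operatorname{eRank}_n(X)$ is the smallest element of $\mathcal E_n$. A definable continuous map $f:X\to Y$ is definably proper if $f^{-1}(K)$ is definably compact for every definably compact subset $K$ of $Y$. A definable equivalence relation $E\subseteq X\times X$ is definably proper over $X$ if the restriction $p_1:E\to X$ to $E$ of the projection of $X\times X$ onto the first factor (equivalently, the second factor) is definably proper. A definable proper quotient of $X$ by $E$ is a surjective definably proper map $f:X\to Y$ onto a definable set $Y$ (denoted $X/E$) such that $f(x)=f(x')$ if and only if $(x,x')\in E$. *)

theory Defs
  imports
    "HOL-Analysis.Analysis"
    "HOL-Library.Extended"
    "HOL-Library.Option_ord"
    "HOL-Library.Lub_Glb"
begin

section \<open>First-order structures and definability with parameters\<close>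

datatype 'f trm = Var nat | App 'f "'f trm list"

datatype ('f, 'r) fml =
    Eq "'f trm" "'f trm"
  | Rel 'r "'f trm list"
  | Neg "('f, 'r) fml"
  | Conj "('f, 'r) fml" "('f, 'r) fml"
  | Exi nat "('f, 'r) fml"

text \<open>The universe of a structure is the whole type \<open>'a\<close>. The interpretation of a symbol matters
  only on argument lists of the length prescribed by its arity; constants are nullary functions.\<close>

record ('a, 'f, 'r) fo_struct =
  fun_arity :: "'f \<Rightarrow> nat"
  rel_arity :: "'r \<Rightarrow> nat"
  fun_interp :: "'f \<Rightarrow> 'a list \<Rightarrow> 'a"
  rel_interp :: "'r \<Rightarrow> 'a list \<Rightarrow> bool"

primrec wf_trm :: "('a, 'f, 'r) fo_struct \<Rightarrow> 'f trm \<Rightarrow> bool" where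
  "wf_trm M (Var i) \<longleftrightarrow> True"
| "wf_trm M (App f ts) \<longleftrightarrow> length ts = fun_arity M f \<and> list_all (wf_trm M) ts"

primrec wf_fml :: "('a, 'f, 'r) fo_struct \<Rightarrow> ('f, 'r) fml \<Rightarrow> bool" where
  "wf_fml M (Eq s t) \<longleftrightarrow> wf_trm M s \<and> wf_trm M t"
| "wf_fml M (Rel r ts) \<longleftrightarrow> length ts = rel_arity M r \<and> list_all (wf_trm M) ts"
| "wf_fml M (Neg p) \<longleftrightarrow> wf_fml M p"
| "wf_fml M (Conj p q) \<longleftrightarrow> wf_fml M p \<and> wf_fml M q"
| "wf_fml M (Exi k p) \<longleftrightarrow> wf_fml M p"

primrec eval_trm :: "('a, 'f, 'r) fo_struct \<Rightarrow> (nat \<Rightarrow> 'a) \<Rightarrow> 'f trm \<Rightarrow> 'a" where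
  "eval_trm M e (Var i) = e i"
| "eval_trm M e (App f ts) = fun_interp M f (map (eval_trm M e) ts)"

primrec sat :: "('a, 'f, 'r) fo_struct \<Rightarrow> (nat \<Rightarrow> 'a) \<Rightarrow> ('f, 'r) fml \<Rightarrow> bool" where
  "sat M e (Eq s t) \<longleftrightarrow> eval_trm M e s = eval_trm M e t"
| "sat M e (Rel r ts) \<longleftrightarrow> rel_interp M r (map (eval_trm M e) ts)"
| "sat M e (Neg p) \<longleftrightarrow> \<not> sat M e p"
| "sat M e (Conj p q) \<longleftrightarrow> sat M e p \<and> sat M e q"
| "sat M e (Exi k p) \<longleftrightarrow> (\<exists>a. sat M (e(k := a)) p)"

text \<open>The set \<open>F\<^sup>n\<close> consists of the extensional functions on \<open>{..<n}\<close>, so that it is the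
  carrier of the library's product topology.\<close>

definition cart :: "nat \<Rightarrow> (nat \<Rightarrow> 'a) set" where
  "cart n = PiE {..<n} (\<lambda>_. UNIV)"

definition cart_top :: "nat \<Rightarrow> (nat \<Rightarrow> 'a::topological_space) topology" where
  "cart_top n = product_topology (\<lambda>_. euclidean) {..<n}"

text \<open>For \<open>x \<in> F\<^sup>m\<close> and \<open>y \<in> F\<^sup>n\<close>, \<open>join m x y\<close> is the element \<open>(x, y)\<close> of \<open>F\<^sup>m\<^sup>+\<^sup>n\<close>.\<close>

definition join :: "nat \<Rightarrow> (nat \<Rightarrow> 'a) \<Rightarrow> (nat \<Rightarrow> 'a) \<Rightarrow> nat \<Rightarrow> 'a" where
  "join m x y = (\<lambda>i. if i < m then x i else y (i - m))"

text \<open>The identification of \<open>F\<close> with \<open>F\<^sup>1\<close>.\<close>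

definition tuple1 :: "'a \<Rightarrow> nat \<Rightarrow> 'a" where
  "tuple1 t = (\<lambda>i\<in>{..<1}. t)"

text \<open>The variables below \<open>n\<close> of the formula range over the tuple; all other variables are
  assigned the parameters \<open>e\<close>.\<close>

definition definable :: "('a, 'f, 'r) fo_struct \<Rightarrow> nat \<Rightarrow> (nat \<Rightarrow> 'a) set \<Rightarrow> bool" where
  "definable M n S \<longleftrightarrow>
     (\<exists>p e. wf_fml M p \<and> S = {x \<in> cart n. sat M (join n x e) p})"

definition definable1 :: "('a, 'f, 'r) fo_struct \<Rightarrow> 'a set \<Rightarrow> bool" where
  "definable1 M D \<longleftrightarrow> definable M 1 (tuple1 ` D)"

definition definable_map ::
  "('a, 'f, 'r) fo_struct \<Rightarrow> nat \<Rightarrow> (nat \<Rightarrow> 'a) set \<Rightarrow> nat \<Rightarrow> (nat \<Rightarrow> 'a) set \<Rightarrow>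
   ((nat \<Rightarrow> 'a) \<Rightarrow> (nat \<Rightarrow> 'a)) \<Rightarrow> bool" where
  "definable_map M m X n Y f \<longleftrightarrow>
     definable M m X \<and> definable M n Y \<and> f ` X \<subseteq> Y \<and>
     definable M (m + n) ((\<lambda>x. join m x (f x)) ` X)"

definition definable_curve ::
  "('a, 'f, 'r) fo_struct \<Rightarrow> 'a set \<Rightarrow> nat \<Rightarrow> ('a \<Rightarrow> (nat \<Rightarrow> 'a)) \<Rightarrow> bool" where
  "definable_curve M D n \<gamma> \<longleftrightarrow> definable_map M 1 (tuple1 ` D) n (cart n) (\<lambda>x. \<gamma> (x 0))"

definition pair_set :: "nat \<Rightarrow> ((nat \<Rightarrow> 'a) \<times> (nat \<Rightarrow> 'a)) set \<Rightarrow> (nat \<Rightarrow> 'a) set" where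
  "pair_set m E = (\<lambda>(x, y). join m x y) ` E"

definition definable_equiv ::
  "('a, 'f, 'r) fo_struct \<Rightarrow> nat \<Rightarrow> (nat \<Rightarrow> 'a) set \<Rightarrow>
   ((nat \<Rightarrow> 'a) \<times> (nat \<Rightarrow> 'a)) set \<Rightarrow> bool" where
  "definable_equiv M m X E \<longleftrightarrow>
     definable M m X \<and> equiv X E \<and> definable M (m + m) (pair_set m E)"


section \<open>Assumptions on the structure\<close>

definition expands_ordered_field :: "('a::linordered_field, 'f, 'r) fo_struct \<Rightarrow> bool" where
  "expands_ordered_field M \<longleftrightarrow>
     (\<exists>r. rel_arity M r = 2 \<and> (\<forall>x y. rel_interp M r [x, y] \<longleftrightarrow> x < y)) \<and>
     (\<exists>f. fun_arity M f = 2 \<and> (\<forall>x y. fun_interp M f [x, y] = x + y)) \<and>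
     (\<exists>f. fun_arity M f = 2 \<and> (\<forall>x y. fun_interp M f [x, y] = x * y)) \<and>
     (\<exists>c. fun_arity M c = 0 \<and> fun_interp M c [] = 0) \<and>
     (\<exists>c. fun_arity M c = 0 \<and> fun_interp M c [] = 1)"

text \<open>The type \<open>'a extended\<close> is \<open>F \<union> {\<plusminus>\<infinity>}\<close>.\<close>

definition definably_complete :: "('a::linorder, 'f, 'r) fo_struct \<Rightarrow> bool" where
  "definably_complete M \<longleftrightarrow>
     (\<forall>D. definable1 M D \<longrightarrow>
        (\<exists>s. isLub UNIV (Fin ` D) s) \<and> (\<exists>s. isGlb UNIV (Fin ` D) s))"

definition definable_choice :: "('a, 'f, 'r) fo_struct \<Rightarrow> bool" where
  "definable_choice M \<longleftrightarrow>
     (\<forall>m n X Y. definable M m X \<and> definable M (m + n) Y \<and> (\<lambda>z. restrict z {..<m}) ` Y = X \<longrightarrow>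
        (\<exists>\<phi>. definable_map M m X (m + n) Y \<phi> \<and> (\<forall>x\<in>X. restrict (\<phi> x) {..<m} = x))) \<and>
     (\<forall>m X E. definable_equiv M m X E \<longrightarrow>
        (\<exists>S. definable M m S \<and> S \<subseteq> X \<and> (\<forall>C\<in>X // E. \<exists>!s. s \<in> S \<inter> C)))"

definition open_interval :: "'a::linorder set \<Rightarrow> bool" where
  "open_interval I \<longleftrightarrow> (\<exists>a b. I = {x. a < Fin x \<and> Fin x < b})"

definition open_box :: "nat \<Rightarrow> (nat \<Rightarrow> 'a::linorder) set \<Rightarrow> bool" where
  "open_box n B \<longleftrightarrow> (\<exists>J. (\<forall>i<n. open_interval (J i)) \<and> B = PiE {..<n} J)"

definition Lim_set ::
  "'a::linordered_field set \<Rightarrow> nat \<Rightarrow> ('a \<Rightarrow> (nat \<Rightarrow> 'a)) \<Rightarrow> (nat \<Rightarrow> 'a) set" where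
  "Lim_set D n \<gamma> =
     {p \<in> cart n. \<forall>B I. open_box n B \<and> p \<in> B \<and> open_interval I \<and> 0 \<in> I \<longrightarrow>
        {t \<in> D. \<gamma> t \<in> B} \<inter> I \<noteq> {}}"

definition good_pseudo_filter ::
  "('a::{linordered_field, linorder_topology}, 'f, 'r) fo_struct \<Rightarrow> 'a set set \<Rightarrow> bool" where
  "good_pseudo_filter M \<DD> \<longleftrightarrow>
     \<DD> \<noteq> {} \<and>
     (\<forall>D\<in>\<DD>. definable1 M D \<and> D \<subseteq> {0<..} \<and> 0 \<in> closure D) \<and>
     (\<forall>D\<in>\<DD>. bdd_below D \<and> bdd_above D \<and> closure D = D \<union> {0}) \<and>
     (\<forall>D\<in>\<DD>. \<forall>D1 D2. definable1 M D1 \<and> definable1 M D2 \<and> D = D1 \<union> D2 \<longrightarrow>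
        (\<exists>D'\<in>\<DD>. D' \<subseteq> D1) \<or> (\<exists>D'\<in>\<DD>. D' \<subseteq> D2)) \<and>
     (\<forall>D\<in>\<DD>. \<forall>n \<gamma>. definable_curve M D n \<gamma> \<longrightarrow>
        (\<exists>D'\<in>\<DD>. D' \<subseteq> D \<and> continuous_map (top_of_set D') (cart_top n) \<gamma>) \<and>
        (Lim_set D n \<gamma> \<noteq> {} \<longrightarrow>
           (\<exists>D'\<in>\<DD>. D' \<subseteq> D \<and> continuous_map (top_of_set D') (cart_top n) \<gamma> \<and>
              (\<exists>p. Lim_set D' n \<gamma> = {p}))))"

text \<open>The linearly ordered sets \<open>\<E>\<^sub>n\<close> are subsets \<open>Ec n\<close> of one linearly ordered type \<open>'e\<close>; this
  is no restriction, since countably many linear orders embed into their ordered sum. The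
  element \<open>-\<infinity>\<close> is \<open>None\<close>, the least element of \<open>'e option\<close>. In the conjunct providing \<open>U\<close>, the set \<open>X\<close> must be
  nonempty: for \<open>X = Y = {}\<close> no set has rank below \<open>-\<infinity>\<close>, so no rank function
  would satisfy the condition.\<close>

definition good_eRank ::
  "('a::topological_space, 'f, 'r) fo_struct \<Rightarrow> (nat \<Rightarrow> 'e::linorder set) \<Rightarrow>
   (nat \<Rightarrow> (nat \<Rightarrow> 'a) set \<Rightarrow> 'e option) \<Rightarrow> bool" where
  "good_eRank M Ec eRank \<longleftrightarrow> (\<forall>n.
     (\<forall>X. definable M n X \<longrightarrow> eRank n X \<in> Some ` Ec n \<union> {None}) \<and>
     (\<exists>l\<in>Ec n. \<forall>e\<in>Ec n. l \<le> e) \<and>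
     (\<forall>X. definable M n X \<longrightarrow> (eRank n X = None \<longleftrightarrow> X = {})) \<and>
     \<not> (\<exists>s::nat \<Rightarrow> 'e. \<forall>i. s i \<in> Ec n \<and> s (Suc i) < s i) \<and>
     (\<forall>A B. definable M n A \<and> definable M n B \<longrightarrow>
        eRank n (A \<union> B) = max (eRank n A) (eRank n B)) \<and>
     (\<forall>X Y. definable M n X \<and> definable M n Y \<and> X \<noteq> {} \<and> X \<subseteq> Y \<and> eRank n X = eRank n Y \<longrightarrow>
        (\<exists>U. definable M n U \<and> U \<subseteq> X \<and> openin (subtopology (cart_top n) Y) U \<and>
           eRank n (X - U) < eRank n Y)) \<and>
     (\<forall>X l. definable M n X \<and> X \<noteq> {} \<and> l \<in> Ec n \<and> (\<forall>e\<in>Ec n. l \<le> e) \<and> eRank n X = Some l \<longrightarrow>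
        subtopology (cart_top n) X = discrete_topology X))"


section \<open>Definably proper maps and quotients\<close>

definition bounded_cart :: "nat \<Rightarrow> (nat \<Rightarrow> 'a::linorder) set \<Rightarrow> bool" where
  "bounded_cart n X \<longleftrightarrow> (\<exists>a b. \<forall>x\<in>X. \<forall>i<n. a i \<le> x i \<and> x i \<le> b i)"

definition definably_compact ::
  "('a::linorder_topology, 'f, 'r) fo_struct \<Rightarrow> nat \<Rightarrow> (nat \<Rightarrow> 'a) set \<Rightarrow> bool" where
  "definably_compact M n K \<longleftrightarrow> definable M n K \<and> closedin (cart_top n) K \<and> bounded_cart n K"

definition definably_proper ::
  "('a::linorder_topology, 'f, 'r) fo_struct \<Rightarrow> nat \<Rightarrow> (nat \<Rightarrow> 'a) set \<Rightarrow> nat \<Rightarrow>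
   (nat \<Rightarrow> 'a) set \<Rightarrow> ((nat \<Rightarrow> 'a) \<Rightarrow> (nat \<Rightarrow> 'a)) \<Rightarrow> bool" where
  "definably_proper M m X n Y f \<longleftrightarrow>
     definable_map M m X n Y f \<and>
     continuous_map (subtopology (cart_top m) X) (subtopology (cart_top n) Y) f \<and>
     (\<forall>K. K \<subseteq> Y \<and> definably_compact M n K \<longrightarrow> definably_compact M m {x \<in> X. f x \<in> K})"

definition equiv_definably_proper_over ::
  "('a::linorder_topology, 'f, 'r) fo_struct \<Rightarrow> nat \<Rightarrow> (nat \<Rightarrow> 'a) set \<Rightarrow>
   ((nat \<Rightarrow> 'a) \<times> (nat \<Rightarrow> 'a)) set \<Rightarrow> bool" where
  "equiv_definably_proper_over M m X E \<longleftrightarrow>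
     definably_proper M (m + m) (pair_set m E) m X (\<lambda>z. restrict z {..<m})"

definition definable_proper_quotient ::
  "('a::linorder_topology, 'f, 'r) fo_struct \<Rightarrow> nat \<Rightarrow> (nat \<Rightarrow> 'a) set \<Rightarrow>
   ((nat \<Rightarrow> 'a) \<times> (nat \<Rightarrow> 'a)) set \<Rightarrow> nat \<Rightarrow> (nat \<Rightarrow> 'a) set \<Rightarrow>
   ((nat \<Rightarrow> 'a) \<Rightarrow> (nat \<Rightarrow> 'a)) \<Rightarrow> bool" where
  "definable_proper_quotient M m X E n Y f \<longleftrightarrow>
     definably_proper M m X n Y f \<and> f ` X = Y \<and>
     (\<forall>x\<in>X. \<forall>x'\<in>X. f x = f x' \<longleftrightarrow> (x, x') \<in> E)"

end

theory Submission
  imports Defs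
begin

text \<open>Let \<open>C\<close> be relatively closed in \<open>X\<close>. Definable choice gives a set \<open>S\<close> of representatives of the
  classes meeting \<open>C\<close>; let \<open>Y\<close> be its closure in \<open>X\<close>. The rank axioms give \<open>U \<subseteq> S\<close>, open in \<open>Y\<close>,
  such that \<open>Y - U\<close> has smaller rank than \<open>Y\<close>, so by induction the saturation \<open>A\<close> of \<open>Y - U\<close>
  has a quotient \<open>f\<close>. Points of \<open>Y - A\<close> are alone in their class within \<open>Y\<close>, hence the quotient
  of \<open>Y\<close> arises by attaching \<open>Y - A\<close> to \<open>f\<close>, which an explicit Tietze extension of \<open>f\<close> realises
  in affine space. Since \<open>E\<close> is definably proper, the resulting map on \<open>Y\<close> transports to the
  saturation of \<open>Y\<close>, which is that of \<open>C\<close>.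

  Compactness arguments use cluster points of monotone definable families, which exist by definable
  completeness; the pseudo-filter is needed only to turn properness of \<open>E\<close> into a statement
  about cluster points.\<close>

section \<open>Substitution in formulas\<close>

text \<open>The set \<open>S\<close> of representatives is in general not closed, and new
  identifications appear on its closure; were \<open>S\<close> closed in \<open>X\<close>, the
  identity would already be a quotient map of \<open>S\<close>. The rank measures the defect. As
  \<open>S\<close> is dense in \<open>Y\<close>, no nonempty subset of \<open>Y - S\<close> is open
  in \<open>Y\<close>, so \<open>Y - S\<close> has smaller rank than \<open>Y\<close>; hence
  \<open>S\<close> has the rank of \<open>Y\<close>, and removing a suitable open \<open>U\<close>
  lowers it again. Points of \<open>Y\<close> outside \<open>Y - U\<close> may still be equivalent
  to points of \<open>Y - U\<close>. Therefore the quotients handed through the induction are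
  quotients of saturations, which properness keeps closed. The field need not be the reals: bounded
  sets may lack suprema, and neither convergent subsequences nor finite subcovers can be relied on.
  Only definable sets are sure to have the infima and suprema that their bounds call for. This is
  why distances take values in the field itself, why maps are extended by formulas with infima, and
  why a calculus that certifies definability precedes all topology.\<close>

primrec rn_trm :: "(nat \<Rightarrow> nat) \<Rightarrow> 'f trm \<Rightarrow> 'f trm" where
  "rn_trm r (Var i) = Var (r i)"
| "rn_trm r (App f ts) = App f (map (rn_trm r) ts)"

primrec rn_fml :: "(nat \<Rightarrow> nat) \<Rightarrow> ('f, 'r) fml \<Rightarrow> ('f, 'r) fml" where
  "rn_fml r (Eq s t) = Eq (rn_trm r s) (rn_trm r t)"
| "rn_fml r (Rel q ts) = Rel q (map (rn_trm r) ts)"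
| "rn_fml r (Neg p) = Neg (rn_fml r p)"
| "rn_fml r (Conj p q) = Conj (rn_fml r p) (rn_fml r q)"
| "rn_fml r (Exi k p) = Exi (r k) (rn_fml r p)"

lemma wf_rn_trm [simp]: "wf_trm M (rn_trm r t) = wf_trm M t"
  by (induction t) (auto simp: list_all_iff)

lemma wf_rn_fml [simp]: "wf_fml M (rn_fml r p) = wf_fml M p"
  by (induction p) (auto simp: list_all_iff)

lemma eval_rn_trm [simp]: "eval_trm M e (rn_trm r t) = eval_trm M (e \<circ> r) t"
  by (induction t) (auto simp: comp_def cong: map_cong)

lemma sat_rn_fml:
  assumes "inj r"
  shows "sat M e (rn_fml r p) = sat M (e \<circ> r) p"
proof (induction p arbitrary: e)
  case (Exi k p)
  have "e(r k := a) \<circ> r = (e \<circ> r)(k := a)" for a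
    using assms by (auto simp: fun_eq_iff inj_eq)
  then show ?case by (simp only: rn_fml.simps sat.simps Exi)
qed (auto simp: comp_def cong: map_cong)

lemma eval_trm_finite_support:
  "\<exists>N::nat. \<forall>e e'. (\<forall>i<N. e i = e' i) \<longrightarrow> eval_trm M e t = eval_trm M e' t"
proof (induction t)
  case (Var i)
  then show ?case by (intro exI[of _ "Suc i"]) auto
next
  case (App f ts)
  then obtain N where N: "\<And>t. t \<in> set ts \<Longrightarrow>
      \<forall>e e'. (\<forall>i<(N t::nat). e i = e' i) \<longrightarrow> eval_trm M e t = eval_trm M e' t"
    by metis
  have "map (eval_trm M e) ts = map (eval_trm M e') ts"
    if "\<forall>i<Max (N ` set ts). e i = e' i" for e e'
  proof (rule map_cong[OF refl])
    fix t assume t: "t \<in> set ts"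
    then have "N t \<le> Max (N ` set ts)" by simp
    then show "eval_trm M e t = eval_trm M e' t" using N[OF t] that by force
  qed
  then show ?case by (intro exI[of _ "Max (N ` set ts)"]) (metis eval_trm.simps(2))
qed

lemma eval_trms_finite_support:
  "\<exists>N::nat. \<forall>e e'. (\<forall>i<N. e i = e' i) \<longrightarrow> map (eval_trm M e) ts = map (eval_trm M e') ts"
proof (induction ts)
  case (Cons t ts)
  obtain N1 :: nat where 1: "\<And>e e'. (\<forall>i<N1. e i = e' i) \<Longrightarrow> eval_trm M e t = eval_trm M e' t"
    using eval_trm_finite_support[of M t] by auto
  obtain N2 :: nat where 2: "\<And>e e'. (\<forall>i<N2. e i = e' i) \<Longrightarrow> map (eval_trm M e) ts = map (eval_trm M e') ts"
    using Cons by metis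
  have "map (eval_trm M e) (t # ts) = map (eval_trm M e') (t # ts)"
    if "\<forall>i<max N1 N2. e i = e' i" for e e'
    using 1[of e e'] 2[of e e'] that by simp
  then show ?case by metis
qed simp

text \<open>Only the finitely many variables written in the formula matter, and the bound leaves
  fresh variables above it. A quantifier keeps the bound of its body, since overriding one variable
  in both assignments preserves agreement.\<close>

lemma sat_finite_support:
  "\<exists>N::nat. \<forall>e e'. (\<forall>i<N. e i = e' i) \<longrightarrow> sat M e p = sat M e' p"
proof (induction p)
  case (Eq s t)
  obtain N1 :: nat where 1: "\<And>e e'. (\<forall>i<N1. e i = e' i) \<Longrightarrow> eval_trm M e s = eval_trm M e' s"
    using eval_trm_finite_support[of M s] by metis
  obtain N2 :: nat where 2: "\<And>e e'. (\<forall>i<N2. e i = e' i) \<Longrightarrow> eval_trm M e t = eval_trm M e' t"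
    using eval_trm_finite_support[of M t] by metis
  have "sat M e (Eq s t) = sat M e' (Eq s t)" if "\<forall>i<max N1 N2. e i = e' i" for e e'
    using 1[of e e'] 2[of e e'] that by simp
  then show ?case by metis
next
  case (Rel r ts)
  then show ?case using eval_trms_finite_support[of M ts] by (metis sat.simps(2))
next
  case (Neg p)
  then show ?case by auto
next
  case (Conj p q)
  obtain N1 :: nat where 1: "\<And>e e'. (\<forall>i<N1. e i = e' i) \<Longrightarrow> sat M e p = sat M e' p"
    using Conj by metis
  obtain N2 :: nat where 2: "\<And>e e'. (\<forall>i<N2. e i = e' i) \<Longrightarrow> sat M e q = sat M e' q"
    using Conj by metis
  have "sat M e (Conj p q) = sat M e' (Conj p q)" if "\<forall>i<max N1 N2. e i = e' i" for e e'
    using 1[of e e'] 2[of e e'] that by simp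
  then show ?case by metis
next
  case (Exi k p)
  then obtain N :: nat where N: "\<forall>e e'. (\<forall>i<N. e i = e' i) \<longrightarrow> sat M e p = sat M e' p" by blast
  have "sat M (e(k := a)) p = sat M (e'(k := a)) p" if "\<forall>i<N. e i = e' i" for e e' a
    by (rule N[rule_format]) (use that in simp)
  then show ?case by (intro exI[of _ N]) auto
qed

text \<open>Substitution of variables by variables that need not be injective: the formula is renamed
  to fresh variables, which are then bound to the intended values one after the other.\<close>

lemma ex_subst_fml:
  assumes "wf_fml M p"
  shows "\<exists>p'. wf_fml M p' \<and> (\<forall>e. sat M e p' = sat M (e \<circ> r) p)"
proof -
  obtain N where N: "\<And>e e'. (\<forall>i<N. e i = e' i) \<Longrightarrow> sat M e p = sat M e' p"
    using sat_finite_support by metis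
  \<comment> \<open>\<open>K\<close> exceeds every variable that \<open>r\<close> reaches from below
    \<open>N\<close>, so the sources of the substitution lie below the block of fresh variables
    starting at \<open>K\<close>. The closed range \<open>{..N}\<close> keeps the set under
    \<open>Max\<close> nonempty.\<close>
  define K where "K = Suc (Max (r ` {..N}))"
  have K: "r i < K" if "i < N" for i
    using that unfolding K_def by (simp add: le_imp_less_Suc)
  define q0 where "q0 = rn_fml (\<lambda>i. K + i) p"
  have q0: "wf_fml M q0" using assms by (simp add: q0_def)
  \<comment> \<open>After \<open>l\<close> steps the fresh variables from \<open>K\<close> to
    \<open>K + l - 1\<close> carry the values prescribed by \<open>r\<close>. Each new quantifier
    goes outside; it cannot disturb the earlier bindings, whose sources lie below
    \<open>K\<close>.\<close>
  have "\<exists>q. wf_fml M q \<and>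
      (\<forall>e. sat M e q = sat M (\<lambda>i. if K \<le> i \<and> i < K + l then e (r (i - K)) else e i) q0)"
    if "l \<le> N" for l
    using that
  proof (induction l)
    case 0
    have "(\<lambda>i. if K \<le> i \<and> i < K + 0 then e (r (i - K)) else e i) = e" for e :: "nat \<Rightarrow> 'a"
      by (rule ext) auto
    then show ?case using q0 by (intro exI[of _ q0]) (simp only: simp_thms)
  next
    case (Suc l)
    then obtain q where q: "wf_fml M q"
      "\<And>e. sat M e q = sat M (\<lambda>i. if K \<le> i \<and> i < K + l then e (r (i - K)) else e i) q0"
      by auto
    have *: "(\<lambda>i. if K \<le> i \<and> i < K + l then (e(K + l := e (r l))) (r (i - K)) else (e(K + l := e (r l))) i)
        = (\<lambda>i. if K \<le> i \<and> i < K + Suc l then e (r (i - K)) else e i)" for e :: "nat \<Rightarrow> 'a"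
    proof
      fix i
      have "r (i - K) \<noteq> K + l" if "K \<le> i" "i < K + l"
        using K[of "i - K"] that Suc.prems by (metis less_diff_conv2 add.commute less_le_trans less_irrefl Suc_le_eq less_trans)
      then show "(if K \<le> i \<and> i < K + l then (e(K + l := e (r l))) (r (i - K)) else (e(K + l := e (r l))) i)
          = (if K \<le> i \<and> i < K + Suc l then e (r (i - K)) else e i)" by auto
    qed
    have "r l \<noteq> K + l" using K[of l] Suc.prems by auto
    then have "sat M e (Exi (K + l) (Conj (Eq (Var (K + l)) (Var (r l))) q))
      = sat M (\<lambda>i. if K \<le> i \<and> i < K + Suc l then e (r (i - K)) else e i) q0" for e
      by (simp only: *[symmetric]) (simp add: q(2))
    then show ?case
      using q(1) by (intro exI[of _ "Exi (K + l) (Conj (Eq (Var (K + l)) (Var (r l))) q)"]) auto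
  qed
  from this[of N] obtain q where q: "wf_fml M q"
    "\<And>e. sat M e q = sat M (\<lambda>i. if K \<le> i \<and> i < K + N then e (r (i - K)) else e i) q0" by auto
  have "sat M e q = sat M (e \<circ> r) p" for e
    unfolding q(2) q0_def by (subst sat_rn_fml) (auto intro!: N simp: inj_def)
  then show ?thesis using q(1) by blast
qed

section \<open>A calculus of definable predicates and terms\<close>

text \<open>An environment is a sequence of tuples, so that a tuple of variables of any length can be
  quantified at once. A source describes the value of a variable of a formula: either a coordinate
  of a tuple of the environment or a parameter.\<close>

primrec src :: "(nat \<times> nat) + 'a \<Rightarrow> (nat \<Rightarrow> nat \<Rightarrow> 'a) \<Rightarrow> 'a" where
  "src (Inl bj) E = E (fst bj) (snd bj)"
| "src (Inr a) E = a"

definition dpred :: "('a, 'f, 'r) fo_struct \<Rightarrow> ((nat \<Rightarrow> nat \<Rightarrow> 'a) \<Rightarrow> bool) \<Rightarrow> bool" where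
  "dpred M P \<longleftrightarrow> (\<exists>p s. wf_fml M p \<and> (\<forall>E. P E = sat M (\<lambda>i. src (s i) E) p))"

text \<open>Quantifiers follow de Bruijn's convention: the bound tuple becomes tuple 0, the others are
  shifted.\<close>

definition dterm :: "('a, 'f, 'r) fo_struct \<Rightarrow> ((nat \<Rightarrow> nat \<Rightarrow> 'a) \<Rightarrow> 'a) \<Rightarrow> bool" where
  "dterm M t \<longleftrightarrow> dpred M (\<lambda>E. E 0 0 = t (\<lambda>b. E (Suc b)))"

lemma dpred_src: "dpred M P \<Longrightarrow> dpred M (\<lambda>E. P (\<lambda>b j. src (\<sigma> b j) E))"
proof -
  assume "dpred M P"
  then obtain p s where p: "wf_fml M p" "\<And>E. P E = sat M (\<lambda>i. src (s i) E) p"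
    by (auto simp: dpred_def)
  define s' where "s' i = (case s i of Inl bj \<Rightarrow> \<sigma> (fst bj) (snd bj) | Inr a \<Rightarrow> Inr a)" for i
  have "src (s i) (\<lambda>b j. src (\<sigma> b j) E) = src (s' i) E" for i E
    by (simp add: s'_def split: sum.split)
  then show ?thesis unfolding dpred_def using p by (intro exI[of _ p] exI[of _ s']) auto
qed

lemma dpred_reindex: "dpred M P \<Longrightarrow> dpred M (\<lambda>E. P (\<lambda>b j. E (u b j) (v b j)))"
  using dpred_src[of M P "\<lambda>b j. Inl (u b j, v b j)"] by simp

lemma dpred_not: "dpred M P \<Longrightarrow> dpred M (\<lambda>E. \<not> P E)"
  unfolding dpred_def by (metis sat.simps(3) wf_fml.simps(3))

text \<open>The two formulas may feed the same variable from different sources. Moving one to the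
  even and the other to the odd variables makes a common source assignment possible.\<close>

lemma dpred_conj: 
  assumes "dpred M P" "dpred M Q"
  shows "dpred M (\<lambda>E. P E \<and> Q E)"
proof -
  obtain p s where p: "wf_fml M p" "\<And>E. P E = sat M (\<lambda>i. src (s i) E) p"
    using assms by (auto simp: dpred_def)
  obtain q u where q: "wf_fml M q" "\<And>E. Q E = sat M (\<lambda>i. src (u i) E) q"
    using assms by (auto simp: dpred_def)
  define w where "w i = (if even i then s (i div 2) else u (i div 2))" for i
  have "P E = sat M (\<lambda>i. src (w i) E) (rn_fml (\<lambda>i. 2 * i) p)" for E
    by (subst sat_rn_fml) (auto simp: p w_def inj_def comp_def)
  moreover have "Q E = sat M (\<lambda>i. src (w i) E) (rn_fml (\<lambda>i. Suc (2 * i)) q)" for E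
    by (subst sat_rn_fml) (auto simp: q w_def inj_def comp_def)
  ultimately show ?thesis unfolding dpred_def using p(1) q(1)
    by (intro exI[of _ "Conj (rn_fml (\<lambda>i. 2 * i) p) (rn_fml (\<lambda>i. Suc (2 * i)) q)"] exI[of _ w]) auto
qed

lemma dpred_disj: "dpred M P \<Longrightarrow> dpred M Q \<Longrightarrow> dpred M (\<lambda>E. P E \<or> Q E)"
  using dpred_not[OF dpred_conj[OF dpred_not dpred_not], of M P Q] by simp

lemma dpred_imp: "dpred M P \<Longrightarrow> dpred M Q \<Longrightarrow> dpred M (\<lambda>E. P E \<longrightarrow> Q E)"
  using dpred_not[OF dpred_conj[OF _ dpred_not], of M P Q] by simp

lemma dpred_iff: "dpred M P \<Longrightarrow> dpred M Q \<Longrightarrow> dpred M (\<lambda>E. P E \<longleftrightarrow> Q E)"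
  using dpred_conj[OF dpred_imp[of M P Q] dpred_imp[of M Q P]] by (simp add: iff_conv_conj_imp)

lemma dpred_var_eq: "dpred M (\<lambda>E. E b j = E c k)"
  unfolding dpred_def
  by (intro exI[of _ "Eq (Var 0) (Var 1)"] exI[of _ "\<lambda>i. if i = 0 then Inl (b, j) else Inl (c, k)"]) auto

lemma dpred_const: "dpred M (\<lambda>E. c)"
proof (cases c)
  case True
  then show ?thesis using dpred_var_eq[of M 0 0 0 0] by simp
next
  case False
  then show ?thesis using dpred_not[OF dpred_var_eq[of M 0 0 0 0]] by simp
qed

text \<open>Several variables of the formula may draw on the coordinate to be quantified. All of
  them are merged into the bound variable 0, a renaming that is not injective and therefore relies
  on \<open>ex_subst_fml\<close>.\<close>

lemma dpred_ex_var:
  assumes "dpred M P"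
  shows "dpred M (\<lambda>E. \<exists>a. P (E(b := (E b)(j := a))))"
proof -
  obtain p s where p: "wf_fml M p" "\<And>E. P E = sat M (\<lambda>i. src (s i) E) p"
    using assms by (auto simp: dpred_def)
  define r where "r i = (if s i = Inl (b, j) then 0 else Suc i)" for i
  obtain p' where p': "wf_fml M p'" "\<And>e. sat M e p' = sat M (e \<circ> r) p"
    using ex_subst_fml[OF p(1)] by metis
  define s' where "s' i = s (i - 1)" for i
  have "P (E(b := (E b)(j := a))) = sat M ((\<lambda>i. src (s' i) E)(0 := a)) p'" for E a
  proof -
    have "(\<lambda>i. src (s i) (E(b := (E b)(j := a)))) = ((\<lambda>i. src (s' i) E)(0 := a)) \<circ> r"
    proof
      show "src (s i) (E(b := (E b)(j := a))) = (((\<lambda>i. src (s' i) E)(0 := a)) \<circ> r) i" for i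
        by (cases "s i") (auto simp: r_def s'_def)
    qed
    then show ?thesis by (simp only: p(2) p'(2))
  qed
  then show ?thesis unfolding dpred_def
    using p'(1) by (intro exI[of _ "Exi 0 p'"] exI[of _ s']) auto
qed

lemma dpred_ex:
  assumes "dpred M (\<lambda>E. Q (E 0 0) (\<lambda>b. E (Suc b)))"
  shows "dpred M (\<lambda>E. \<exists>a. Q a E)"
  \<comment> \<open>Once its coordinate is bound, tuple 0 is no longer looked at; truncated
    subtraction moves the other tuples back by one.\<close>
  using dpred_reindex[OF dpred_ex_var[OF assms, of 0 0], of "\<lambda>b j. b - 1" "\<lambda>b j. j"] by simp

lemma dpred_all:
  assumes "dpred M (\<lambda>E. Q (E 0 0) (\<lambda>b. E (Suc b)))"
  shows "dpred M (\<lambda>E. \<forall>a. Q a E)"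
  using dpred_not[OF dpred_ex[OF dpred_not[OF assms]]] by simp

lemma dpred_ex_cart:
  assumes "dpred M (\<lambda>E. Q (restrict (E 0) {..<k}) (\<lambda>b. E (Suc b)))"
  shows "dpred M (\<lambda>E. \<exists>y\<in>cart k. Q y E)"
proof -
  \<comment> \<open>Overwriting only the first \<open>k\<close> coordinates of tuple 0, instead of
    replacing the tuple, lets the induction quantify coordinate \<open>k\<close> by
    \<open>dpred_ex_var\<close>.\<close>
  have *: "dpred M (\<lambda>E. \<exists>y\<in>cart k. P (E(0 := (\<lambda>i. if i < k then y i else E 0 i))))"
    if "dpred M P" for P :: "(nat \<Rightarrow> nat \<Rightarrow> 'a) \<Rightarrow> bool" and k
    using that
  proof (induction k arbitrary: P)
    case 0
    then show ?case by (simp add: cart_def)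
  next
    case (Suc k)
    let ?P = "\<lambda>E. \<exists>a. P (E(0 := (E 0)(k := a)))"
    have eq: "(\<exists>y\<in>cart k. ?P (E(0 := (\<lambda>i. if i < k then y i else E 0 i))))
      = (\<exists>y\<in>cart (Suc k). P (E(0 := (\<lambda>i. if i < Suc k then y i else E 0 i))))" (is "?l = ?r") for E
    proof
      assume ?l
      then obtain y a where y: "y \<in> cart k"
        "P (E(0 := (\<lambda>i. if i < k then y i else E 0 i)(k := a)))" by auto
      have "(\<lambda>i. if i < k then y i else E 0 i)(k := a) = (\<lambda>i. if i < Suc k then (y(k := a)) i else E 0 i)"
        by (auto simp: fun_eq_iff less_Suc_eq)
      moreover have "y(k := a) \<in> cart (Suc k)"
        using y(1) by (auto simp: cart_def PiE_def extensional_def)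
      ultimately show ?r using y(2) by metis
    next
      assume ?r
      then obtain y where y: "y \<in> cart (Suc k)" "P (E(0 := (\<lambda>i. if i < Suc k then y i else E 0 i)))" by auto
      have "(\<lambda>i. if i < k then restrict y {..<k} i else E 0 i)(k := y k)
         = (\<lambda>i. if i < Suc k then y i else E 0 i)"
        by (auto simp: fun_eq_iff less_Suc_eq)
      then have "P (E(0 := (\<lambda>i. if i < k then restrict y {..<k} i else E 0 i)(k := y k)))"
        using y(2) by simp
      moreover have "restrict y {..<k} \<in> cart k" by (auto simp: cart_def)
      ultimately show ?l by (intro bexI[of _ "restrict y {..<k}"] exI[of _ "y k"]) auto
    qed
    show ?case
      by (rule back_subst[of "dpred M", OF Suc.IH[OF dpred_ex_var[OF Suc.prems, of 0 k]]])
        (rule ext, rule eq)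
  qed
  have "restrict (\<lambda>i. if i < k then y i else z i) {..<k} = y" if "y \<in> cart k" for y z :: "nat \<Rightarrow> 'a"
    using that by (auto simp: cart_def PiE_def extensional_def fun_eq_iff)
  then show ?thesis
    using dpred_reindex[OF *[OF assms, of k], of "\<lambda>b j. b - 1" "\<lambda>b j. j"] by (simp cong: bex_cong)
qed

lemma dpred_all_less:
  fixes n :: nat
  assumes "\<And>i. i < n \<Longrightarrow> dpred M (Q i)"
  shows "dpred M (\<lambda>E. \<forall>i<n. Q i E)"
  using assms
proof (induction n)
  case 0
  then show ?case by (simp add: dpred_const)
next
  case (Suc n)
  then show ?case using dpred_conj[of M "\<lambda>E. \<forall>i<n. Q i E" "Q n"] by (simp add: All_less_Suc conj_commute)
qed

text \<open>The bridge from formulas to the calculus. Membership depends on the first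
  \<open>n\<close> coordinates of tuple 0 alone, so all other sources can be frozen: parameters move
  to the variables from \<open>n\<close> on, and foreign coordinates are evaluated where they equal
  \<open>undefined\<close>.\<close>

lemma definable_iff_dpred:
  "definable M n S \<longleftrightarrow> S \<subseteq> cart n \<and> dpred M (\<lambda>E. restrict (E 0) {..<n} \<in> S)"
proof
  assume "definable M n S"
  then obtain p e where p: "wf_fml M p" "S = {x \<in> cart n. sat M (join n x e) p}"
    by (auto simp: definable_def)
  define s where "s i = (if i < n then Inl (0::nat, i) else Inr (e (i - n)))" for i :: nat
  have "(\<lambda>i. src (s i) E) = join n (restrict (E 0) {..<n}) e" for E
    by (auto simp: s_def join_def)
  moreover have "restrict (E 0) {..<n} \<in> cart n" for E :: "nat \<Rightarrow> nat \<Rightarrow> 'a"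
    by (auto simp: cart_def)
  ultimately show "S \<subseteq> cart n \<and> dpred M (\<lambda>E. restrict (E 0) {..<n} \<in> S)"
    using p by (auto simp: dpred_def intro!: exI[of _ p] exI[of _ s])
next
  assume *: "S \<subseteq> cart n \<and> dpred M (\<lambda>E. restrict (E 0) {..<n} \<in> S)"
  then obtain p s where p: "wf_fml M p" "\<And>E. (restrict (E 0) {..<n} \<in> S) = sat M (\<lambda>i. src (s i) E) p"
    by (auto simp: dpred_def)
  define r where "r i = (case s i of Inl bj \<Rightarrow> if fst bj = 0 \<and> snd bj < n then snd bj else n + i
    | Inr a \<Rightarrow> n + i)" for i
  define e where "e i = (case s i of Inl bj \<Rightarrow> undefined | Inr a \<Rightarrow> a)" for i
  obtain p' where p': "wf_fml M p'" "\<And>e. sat M e p' = sat M (e \<circ> r) p"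
    using ex_subst_fml[OF p(1)] by metis
  have "(x \<in> S) = sat M (join n x e) p'" if x: "x \<in> cart n" for x
  proof -
    have xr: "restrict x {..<n} = x"
      using x by (auto simp: cart_def PiE_def extensional_def fun_eq_iff)
    let ?E = "\<lambda>b::nat. if b = 0 then x else (\<lambda>_. undefined)"
    have "(\<lambda>i. src (s i) ?E) = join n x e \<circ> r"
    proof
      show "src (s i) ?E = (join n x e \<circ> r) i" for i
        using x by (cases "s i") (auto simp: join_def r_def e_def cart_def PiE_def extensional_def)
    qed
    then show ?thesis
      using p(2)[of ?E] xr by (simp only: p'(2) if_True refl)
  qed
  then show "definable M n S"
    unfolding definable_def using * p'(1) by blast
qed

lemma dpred_mem: "definable M n S \<Longrightarrow> dpred M (\<lambda>E. restrict (E b) {..<n} \<in> S)"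
  using dpred_reindex[of M "\<lambda>E. restrict (E 0) {..<n} \<in> S" "\<lambda>_ _. b" "\<lambda>_ j. j"]
  by (simp add: definable_iff_dpred)

lemma definable1_iff_dpred: "definable1 M D \<longleftrightarrow> dpred M (\<lambda>E. E 0 0 \<in> D)"
proof -
  have "restrict x {..<1} \<in> tuple1 ` D \<longleftrightarrow> x 0 \<in> D" for x :: "nat \<Rightarrow> 'a"
    by (auto simp: tuple1_def fun_eq_iff image_iff)
  then show ?thesis unfolding definable1_def definable_iff_dpred
    by (auto simp: cart_def tuple1_def PiE_def extensional_def split: if_splits)
qed

lemma dterm_reindex: "dterm M t \<Longrightarrow> dterm M (\<lambda>E. t (\<lambda>b j. E (u b j) (v b j)))"
  unfolding dterm_def
  using dpred_reindex[of M "\<lambda>E. E 0 0 = t (\<lambda>b. E (Suc b))"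
    "\<lambda>b j. case b of 0 \<Rightarrow> 0 | Suc b \<Rightarrow> Suc (u b j)" "\<lambda>b j. case b of 0 \<Rightarrow> j | Suc b \<Rightarrow> v b j"]
  by simp

lemma dterm_shift: "dterm M t \<Longrightarrow> dterm M (\<lambda>E. t (\<lambda>b. E (Suc b)))"
  using dterm_reindex[of M t "\<lambda>b _. Suc b" "\<lambda>_ j. j"] by simp

lemma dpred_subst:
  assumes "dpred M (\<lambda>E. Q (E 0 0) (\<lambda>b. E (Suc b)))" "dterm M t"
  shows "dpred M (\<lambda>E. Q (t E) E)"
  using dpred_ex[of M "\<lambda>a E. a = t E \<and> Q a E"] dpred_conj[OF assms(2)[unfolded dterm_def] assms(1)]
  by simp

lemma dterm_var: "dterm M (\<lambda>E. E b j)"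
  unfolding dterm_def by (rule dpred_var_eq)

lemma dterm_const: "dterm M (\<lambda>E. c)"
  unfolding dterm_def dpred_def
  by (intro exI[of _ "Eq (Var 0) (Var 1)"] exI[of _ "\<lambda>i. if i = 0 then Inl (0, 0) else Inr c"]) auto

lemma dpred_eq: "dterm M t \<Longrightarrow> dterm M u \<Longrightarrow> dpred M (\<lambda>E. t E = u E)"
  using dpred_subst[of M "\<lambda>a E. a = u E" t] by (simp add: dterm_def)

lemma dpred_rel2:
  assumes "dpred M (\<lambda>E. R (E 0 0) (E 1 0))" "dterm M t" "dterm M u"
  shows "dpred M (\<lambda>E. R (t E) (u E))"
proof -
  have "dpred M (\<lambda>E. R (E 1 0) (E 0 0))"
    using dpred_reindex[OF assms(1), of "\<lambda>b _. 1 - b" "\<lambda>_ j. j"] by simp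
  then have "dpred M (\<lambda>E. R (E 0 0) (u (\<lambda>b. E (Suc b))))"
    using dpred_subst[of M "\<lambda>a E. R (E 0 0) a", OF _ dterm_shift[OF assms(3)]] by simp
  then show ?thesis
    using dpred_subst[of M "\<lambda>a E. R a (u E)" t] assms(2) by simp
qed

lemma dterm_op1:
  assumes "dpred M (\<lambda>E. E 0 0 = op (E 1 0))" "dterm M t"
  shows "dterm M (\<lambda>E. op (t E))"
  unfolding dterm_def by (rule dpred_rel2[OF assms(1) dterm_var dterm_shift[OF assms(2)]])

lemma dterm_op2:
  assumes "dpred M (\<lambda>E. E 0 0 = op (E 1 0) (E 2 0))" "dterm M t" "dterm M u"
  shows "dterm M (\<lambda>E. op (t E) (u E))"
proof -
  have "dpred M (\<lambda>E. E (Suc 0) 0 = op (E (Suc (Suc 0)) 0) (E 0 0))"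
    using dpred_reindex[OF assms(1), of "\<lambda>b _. if b = 0 then 1 else if b = 1 then 2 else 0" "\<lambda>_ j. j"]
    by (simp add: numeral_2_eq_2)
  then have "dpred M (\<lambda>E. E 0 0 = op (E 1 0) (u (\<lambda>b. E (Suc (Suc b)))))"
    using dpred_subst[of M "\<lambda>a E. E 0 0 = op (E (Suc 0) 0) a", OF _ dterm_shift[OF dterm_shift[OF assms(3)]]]
    by simp
  then have "dpred M (\<lambda>E. E (Suc 0) 0 = op (E 0 0) (u (\<lambda>b. E (Suc (Suc b)))))"
    using dpred_reindex[of M "\<lambda>E. E 0 0 = op (E 1 0) (u (\<lambda>b. E (Suc (Suc b))))"
       "\<lambda>b _. if b = 0 then 1 else if b = 1 then 0 else b" "\<lambda>_ j. j"]
    by simp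
  then show ?thesis unfolding dterm_def
    using dpred_subst[of M "\<lambda>a E. E 0 0 = op a (u (\<lambda>b. E (Suc b)))", OF _ dterm_shift[OF assms(2)]] by simp
qed

lemma dterm_if:
  assumes "dpred M P" "dterm M t" "dterm M u"
  shows "dterm M (\<lambda>E. if P E then t E else u E)"
proof -
  have *: "dpred M (\<lambda>E. P (\<lambda>b. E (Suc b)))"
    using dpred_reindex[OF assms(1), of "\<lambda>b _. Suc b" "\<lambda>_ j. j"] by simp
  have "dpred M (\<lambda>E. (P (\<lambda>b. E (Suc b)) \<longrightarrow> E 0 0 = t (\<lambda>b. E (Suc b)))
     \<and> (\<not> P (\<lambda>b. E (Suc b)) \<longrightarrow> E 0 0 = u (\<lambda>b. E (Suc b))))"
    using assms(2,3) unfolding dterm_def by (intro dpred_conj dpred_imp dpred_not *)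
  then show ?thesis unfolding dterm_def
    by (rule back_subst[of "dpred M"]) (auto simp: fun_eq_iff)
qed

section \<open>The sum metric on tuples\<close>

text \<open>A metric with values in the field. Sums of absolute values are definable without square
  roots and split along \<open>join\<close>.\<close>

definition l1 :: "nat \<Rightarrow> (nat \<Rightarrow> 'a::linordered_field) \<Rightarrow> (nat \<Rightarrow> 'a) \<Rightarrow> 'a" where
  "l1 k x y = (\<Sum>i<k. \<bar>x i - y i\<bar>)"

lemma l1_nonneg [simp]: "0 \<le> l1 k x y"
  by (simp add: l1_def sum_nonneg)

lemma l1_refl [simp]: "l1 k x x = 0"
  by (simp add: l1_def)

lemma l1_commute: "l1 k x y = l1 k y x"
  by (simp add: l1_def abs_minus_commute)

lemma l1_triangle: "l1 k x z \<le> l1 k x y + l1 k y z"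
  unfolding l1_def sum.distrib[symmetric] by (intro sum_mono) linarith

lemma l1_restrict: "l1 m (restrict x {..<m}) (restrict y {..<m}) = l1 m x y"
  by (simp add: l1_def)

lemma abs_le_l1: "i < k \<Longrightarrow> \<bar>x i - y i\<bar> \<le> l1 k x y"
  unfolding l1_def by (rule member_le_sum) auto

text \<open>The summand 1 in the denominator covers \<open>k = 0\<close> and makes the resulting
  bound strict.\<close>

lemma l1_less:
  assumes "\<And>i. i < k \<Longrightarrow> \<bar>x i - y i\<bar> < \<epsilon> / (of_nat k + 1)" "0 < \<epsilon>"
  shows "l1 k x y < \<epsilon>"
proof -
  have "l1 k x y \<le> of_nat (card {..<k}) * (\<epsilon> / (of_nat k + 1))"
    unfolding l1_def using assms(1) by (intro sum_bounded_above) (auto intro: less_imp_le)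
  also have "\<dots> < \<epsilon>"
    using assms(2) by (simp add: field_simps add_pos_nonneg)
  finally show ?thesis .
qed

lemma restrict_in_cart [simp]: "restrict x {..<n} \<in> cart n"
  by (simp add: cart_def)

lemma restrict_cart [simp]: "x \<in> cart n \<Longrightarrow> restrict x {..<n} = x"
  by (auto simp: cart_def PiE_def extensional_def fun_eq_iff)

lemma cart_eqI: "x \<in> cart n \<Longrightarrow> y \<in> cart n \<Longrightarrow> (\<And>i. i < n \<Longrightarrow> x i = y i) \<Longrightarrow> x = y"
  unfolding cart_def by (rule PiE_ext) auto

lemma l1_eq_0_iff: "x \<in> cart n \<Longrightarrow> y \<in> cart n \<Longrightarrow> l1 n x y = 0 \<longleftrightarrow> x = y"
  by (auto simp: l1_def sum_nonneg_eq_0_iff intro!: cart_eqI)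

lemma eq_if_l1_small:
  assumes "x \<in> cart n" "y \<in> cart n" "\<And>\<epsilon>. 0 < \<epsilon> \<Longrightarrow> l1 n x y < \<epsilon>"
  shows "x = y"
  using assms l1_eq_0_iff[OF assms(1,2)] l1_nonneg[of n x y] by (metis less_irrefl order_le_less)

lemma open_imp_interval:
  fixes x :: "'a::{linordered_field, linorder_topology}"
  assumes "open S" "x \<in> S"
  shows "\<exists>\<epsilon>>0. \<forall>y. \<bar>x - y\<bar> < \<epsilon> \<longrightarrow> y \<in> S"
proof -
  obtain b where b: "b > x" "{x..<b} \<subseteq> S"
    using open_right[OF assms, of "x + 1"] by auto
  obtain c where c: "c < x" "{c<..x} \<subseteq> S"
    using open_left[OF assms, of "x - 1"] by auto
  have "y \<in> S" if "\<bar>x - y\<bar> < min (b - x) (x - c)" for y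
    using that b(2) c(2) by (cases "x \<le> y") auto
  then show ?thesis using b(1) c(1) by (intro exI[of _ "min (b - x) (x - c)"]) auto
qed

lemma open_interval_abs: "open {y. \<bar>x - y\<bar> < (\<epsilon>::'a::{linordered_field, linorder_topology})}"
proof -
  have "{y. \<bar>x - y\<bar> < \<epsilon>} = {x - \<epsilon><..<x + \<epsilon>}" by (auto simp: abs_less_iff)
  then show ?thesis by simp
qed

lemma topspace_cart_top [simp]: "topspace (cart_top n) = cart n"
  by (simp add: cart_top_def cart_def)

text \<open>There are finitely many factors: the least coordinate radius puts a ball inside a box,
  and dividing a radius by \<open>of_nat k + 1\<close> puts a box inside a ball.\<close>

lemma openin_cart_top:
  fixes U :: "(nat \<Rightarrow> 'a::{linordered_field, linorder_topology}) set"
  shows "openin (cart_top k) U \<longleftrightarrow>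
    U \<subseteq> cart k \<and> (\<forall>x\<in>U. \<exists>\<epsilon>>0. \<forall>y\<in>cart k. l1 k x y < \<epsilon> \<longrightarrow> y \<in> U)" (is "?l \<longleftrightarrow> ?r")
proof
  assume l: ?l
  have "\<exists>\<epsilon>>0. \<forall>y\<in>cart k. l1 k x y < \<epsilon> \<longrightarrow> y \<in> U" if "x \<in> U" for x
  proof -
    obtain V where V: "\<And>i. i < k \<Longrightarrow> open (V i)" "x \<in> Pi\<^sub>E {..<k} V" "Pi\<^sub>E {..<k} V \<subseteq> U"
    proof -
      have "\<exists>V. finite {i \<in> {..<k}. V i \<noteq> topspace euclidean} \<and>
          (\<forall>i\<in>{..<k}. openin euclidean (V i)) \<and> x \<in> Pi\<^sub>E {..<k} V \<and> Pi\<^sub>E {..<k} V \<subseteq> U"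
        using l \<open>x \<in> U\<close> unfolding cart_top_def openin_product_topology_alt by (rule bspec)
      then show ?thesis using that by (metis lessThan_iff open_openin)
    qed
    have "\<forall>i<k. \<exists>\<epsilon>>0. \<forall>y. \<bar>x i - y\<bar> < \<epsilon> \<longrightarrow> y \<in> V i"
      using V(1,2) by (auto intro!: open_imp_interval)
    then obtain e where e: "\<And>i. i < k \<Longrightarrow> 0 < e i" "\<And>i y. i < k \<Longrightarrow> \<bar>x i - y\<bar> < e i \<Longrightarrow> y \<in> V i"
      by metis
    define \<epsilon> where "\<epsilon> = Min (insert 1 (e ` {..<k}))"
    have "0 < \<epsilon>" using e(1) by (auto simp: \<epsilon>_def)
    moreover have "y \<in> U" if "y \<in> cart k" "l1 k x y < \<epsilon>" for y
    proof -
      have "y i \<in> V i" if "i < k" for i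
      proof -
        have "\<bar>x i - y i\<bar> < \<epsilon>" using abs_le_l1[OF that, of x y] \<open>l1 k x y < \<epsilon>\<close> by simp
        also have "\<epsilon> \<le> e i" using that by (simp add: \<epsilon>_def)
        finally show ?thesis using e(2) that by blast
      qed
      then have "y \<in> Pi\<^sub>E {..<k} V" using \<open>y \<in> cart k\<close> by (auto simp: cart_def)
      then show ?thesis using V(3) by blast
    qed
    ultimately show ?thesis by blast
  qed
  moreover have "U \<subseteq> cart k" using openin_subset[OF l] by simp
  ultimately show ?r by blast
next
  assume r: ?r
  show ?l unfolding cart_top_def openin_product_topology_alt
  proof
    fix x assume "x \<in> U"
    then obtain \<epsilon> where \<epsilon>: "\<epsilon> > 0" "\<And>y. y \<in> cart k \<Longrightarrow> l1 k x y < \<epsilon> \<Longrightarrow> y \<in> U" using r by blast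
    define V where "V i = {y. \<bar>x i - y\<bar> < \<epsilon> / (of_nat k + 1)}" for i
    have "0 < \<epsilon> / (of_nat k + 1)" using \<epsilon>(1) by (simp add: add_nonneg_pos)
    then have "x i \<in> V i" for i by (simp only: V_def mem_Collect_eq diff_self abs_zero)
    moreover have "x \<in> cart k" using r \<open>x \<in> U\<close> by blast
    ultimately have "x \<in> Pi\<^sub>E {..<k} V" by (auto simp: cart_def PiE_iff)
    moreover have "Pi\<^sub>E {..<k} V \<subseteq> U"
    proof
      fix y assume y: "y \<in> Pi\<^sub>E {..<k} V"
      show "y \<in> U"
      proof (rule \<epsilon>(2))
        show "y \<in> cart k" using y by (auto simp: cart_def)
        show "l1 k x y < \<epsilon>" by (rule l1_less) (use y \<epsilon>(1) in \<open>force simp: V_def PiE_iff\<close>)+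
      qed
    qed
    moreover have "open (V i)" for i unfolding V_def by (rule open_interval_abs)
    ultimately show "\<exists>V. finite {i \<in> {..<k}. V i \<noteq> topspace euclidean} \<and>
        (\<forall>i\<in>{..<k}. openin euclidean (V i)) \<and> x \<in> Pi\<^sub>E {..<k} V \<and> Pi\<^sub>E {..<k} V \<subseteq> U"
      by (intro exI[of _ V]) auto
  qed
qed

lemma openin_l1_ball: "openin (cart_top k) {y \<in> cart k. l1 k x y < (\<epsilon>::'a::{linordered_field, linorder_topology})}"
  unfolding openin_cart_top
proof (intro conjI ballI)
  fix y assume y: "y \<in> {y \<in> cart k. l1 k x y < \<epsilon>}"
  have "l1 k x z < \<epsilon>" if "l1 k y z < \<epsilon> - l1 k x y" for z
    using l1_triangle[of k x z y] that by simp
  then show "\<exists>e>0. \<forall>z\<in>cart k. l1 k y z < e \<longrightarrow> z \<in> {y \<in> cart k. l1 k x y < \<epsilon>}"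
    using y by (intro exI[of _ "\<epsilon> - l1 k x y"]) auto
qed auto

lemma closedin_cart_top:
  fixes K :: "(nat \<Rightarrow> 'a::{linordered_field, linorder_topology}) set"
  shows "closedin (cart_top k) K \<longleftrightarrow>
    K \<subseteq> cart k \<and> (\<forall>x\<in>cart k. (\<forall>\<epsilon>>0. \<exists>y\<in>K. l1 k x y < \<epsilon>) \<longrightarrow> x \<in> K)"
proof -
  have "(\<exists>\<epsilon>>0. \<forall>y\<in>cart k. l1 k x y < \<epsilon> \<longrightarrow> y \<in> cart k - K) \<longleftrightarrow>
     \<not> (\<forall>\<epsilon>>0. \<exists>y\<in>K. l1 k x y < \<epsilon>)" if "K \<subseteq> cart k" for x
    using that by blast
  then show ?thesis unfolding closedin_def openin_cart_top topspace_cart_top by blast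
qed

lemma openin_subtopology_cart_top:
  fixes U :: "(nat \<Rightarrow> 'a::{linordered_field, linorder_topology}) set"
  assumes "openin (subtopology (cart_top k) Y) U" "x \<in> U"
  shows "\<exists>\<epsilon>>0. \<forall>y\<in>Y. y \<in> cart k \<longrightarrow> l1 k x y < \<epsilon> \<longrightarrow> y \<in> U"
proof -
  obtain T where T: "openin (cart_top k) T" "U = T \<inter> Y"
    using assms(1) by (auto simp: openin_subtopology)
  then obtain \<epsilon> where "\<epsilon> > 0" "\<forall>y\<in>cart k. l1 k x y < \<epsilon> \<longrightarrow> y \<in> T"
    using assms(2) by (auto simp: openin_cart_top)
  then show ?thesis using T(2) by blast
qed

definition l1_cont :: "nat \<Rightarrow> nat \<Rightarrow> (nat \<Rightarrow> 'a::linordered_field) set \<Rightarrow> ((nat \<Rightarrow> 'a) \<Rightarrow> nat \<Rightarrow> 'a) \<Rightarrow> bool"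
  where "l1_cont m n X f \<longleftrightarrow>
    (\<forall>x\<in>X. \<forall>\<epsilon>>0. \<exists>\<delta>>0. \<forall>y\<in>X. l1 m x y < \<delta> \<longrightarrow> l1 n (f x) (f y) < \<epsilon>)"

lemma l1_contD:
  assumes "l1_cont m n X f" "x \<in> X" "0 < \<epsilon>"
  obtains \<delta> where "0 < \<delta>" "\<And>y. y \<in> X \<Longrightarrow> l1 m x y < \<delta> \<Longrightarrow> l1 n (f x) (f y) < \<epsilon>"
  using assms unfolding l1_cont_def by meson

lemma continuous_map_cart_top:
  fixes f :: "(nat \<Rightarrow> 'a::{linordered_field, linorder_topology}) \<Rightarrow> nat \<Rightarrow> 'a"
  assumes f: "l1_cont m n X f" and X: "X \<subseteq> cart m" "f ` X \<subseteq> Y" "Y \<subseteq> cart n"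
  shows "continuous_map (subtopology (cart_top m) X) (subtopology (cart_top n) Y) f"
proof -
  have "openin (subtopology (cart_top m) X) {x \<in> X. f x \<in> U}" if U: "openin (cart_top n) U" for U
  proof -
    \<comment> \<open>All balls around points of the preimage whose trace on \<open>X\<close> is
      mapped into \<open>U\<close> are taken at once, so no radius has to be chosen for each
      point.\<close>
    define T where "T = {y\<in>cart m. \<exists>x\<in>X. f x \<in> U \<and> (\<exists>\<delta>>0. (\<forall>z\<in>X. l1 m x z < \<delta> \<longrightarrow> f z \<in> U) \<and> l1 m x y < \<delta>)}"
    have "T = \<Union> {{y\<in>cart m. l1 m x y < \<delta>} | x \<delta>. x \<in> X \<and> f x \<in> U \<and> \<delta> > 0 \<and> (\<forall>z\<in>X. l1 m x z < \<delta> \<longrightarrow> f z \<in> U)}"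
      unfolding T_def by blast
    then have "openin (cart_top m) T" by (auto intro!: openin_Union openin_l1_ball)
    moreover have "{x \<in> X. f x \<in> U} = T \<inter> X"
    proof (intro equalityI subsetI)
      fix x assume x: "x \<in> {x \<in> X. f x \<in> U}"
      then obtain \<epsilon> where \<epsilon>: "\<epsilon> > 0" "\<forall>y\<in>cart n. l1 n (f x) y < \<epsilon> \<longrightarrow> y \<in> U"
        using U by (auto simp: openin_cart_top)
      obtain \<delta> where \<delta>: "0 < \<delta>" "\<And>y. y \<in> X \<Longrightarrow> l1 m x y < \<delta> \<Longrightarrow> l1 n (f x) (f y) < \<epsilon>"
        using l1_contD[OF f _ \<epsilon>(1), of x] x by blast
      have "\<forall>z\<in>X. l1 m x z < \<delta> \<longrightarrow> f z \<in> U" using \<delta>(2) \<epsilon>(2) X by blast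
      then show "x \<in> T \<inter> X" using \<delta>(1) x X(1) unfolding T_def by force
    qed (auto simp: T_def)
    ultimately show ?thesis by (auto simp: openin_subtopology)
  qed
  moreover have "topspace (subtopology (cart_top m) X) = X" using X(1) by auto
  moreover have "f x \<in> cart n" if "x \<in> X" for x using that X by blast
  ultimately have "continuous_map (subtopology (cart_top m) X) (cart_top n) f"
    by (auto simp: continuous_map_def)
  then show ?thesis using X by (auto simp: continuous_map_in_subtopology)
qed

lemma continuous_curveD:
  fixes \<gamma> :: "'a::{linordered_field, linorder_topology} \<Rightarrow> nat \<Rightarrow> 'a"
  assumes "continuous_map (top_of_set D) (cart_top n) \<gamma>" "t \<in> D" "0 < \<epsilon>"
  obtains \<delta> where "0 < \<delta>" "\<And>u. u \<in> D \<Longrightarrow> \<bar>t - u\<bar> < \<delta> \<Longrightarrow> l1 n (\<gamma> t) (\<gamma> u) < \<epsilon>"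
proof -
  have \<gamma>: "\<gamma> u \<in> cart n" if "u \<in> D" for u
    using assms(1) that by (auto simp: continuous_map_def Pi_iff)
  have "openin (top_of_set D) {u \<in> D. \<gamma> u \<in> {y \<in> cart n. l1 n (\<gamma> t) y < \<epsilon>}}"
    using openin_continuous_map_preimage[OF assms(1) openin_l1_ball] by simp
  then obtain T where T: "open T" "{u \<in> D. \<gamma> u \<in> {y \<in> cart n. l1 n (\<gamma> t) y < \<epsilon>}} = D \<inter> T"
    by (auto simp: openin_open)
  moreover have "t \<in> T" using T(2) assms(2,3) \<gamma> by auto
  ultimately obtain \<delta> where "\<delta> > 0" "\<forall>u. \<bar>t - u\<bar> < \<delta> \<longrightarrow> u \<in> T"
    using open_imp_interval by blast
  then show ?thesis using T(2) that[of \<delta>] by blast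
qed

section \<open>Definability in definably complete ordered fields\<close>

text \<open>Rules that decompose a predicate, term or tuple at its outermost symbol; repeated
  resolution with them follows the syntax of an expression down to its variables and proves it
  definable.\<close>

named_theorems dfb

lemmas [dfb] = dpred_not dpred_conj dpred_disj dpred_imp dpred_iff dpred_const dpred_ex dpred_all
  dpred_eq dterm_if dterm_var dterm_const

lemma dpred_bex [dfb]:
  assumes "definable M n A" "dpred M (\<lambda>E. Q (restrict (E 0) {..<n}) (\<lambda>b. E (Suc b)))"
  shows "dpred M (\<lambda>E. \<exists>y\<in>A. Q y E)"
proof -
  have "A \<subseteq> cart n" using assms(1) by (simp add: definable_iff_dpred)
  then have "(\<exists>y\<in>A. Q y E) \<longleftrightarrow> (\<exists>y\<in>cart n. y \<in> A \<and> Q y E)" for E by blast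
  then show ?thesis
    using dpred_ex_cart[of M "\<lambda>y E. y \<in> A \<and> Q y E" n] dpred_conj[OF dpred_mem[OF assms(1)] assms(2)]
    by simp
qed

lemma dpred_ball [dfb]:
  assumes "definable M n A" "dpred M (\<lambda>E. Q (restrict (E 0) {..<n}) (\<lambda>b. E (Suc b)))"
  shows "dpred M (\<lambda>E. \<forall>y\<in>A. Q y E)"
  using dpred_not[OF dpred_bex[OF assms(1) dpred_not[OF assms(2)]]] by simp

lemma definable_Collect:
  "dpred M (\<lambda>E. P (restrict (E 0) {..<n})) \<Longrightarrow> definable M n {x \<in> cart n. P x}"
  unfolding definable_iff_dpred by (simp cong: conj_cong)

lemma definable_Collect_sub:
  assumes "definable M n A" "dpred M (\<lambda>E. P (restrict (E 0) {..<n}))"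
  shows "definable M n {x \<in> A. P x}"
  using assms dpred_conj[OF dpred_mem[OF assms(1), of 0] assms(2)] unfolding definable_iff_dpred
  by auto

lemma definable_subset_cart: "definable M n A \<Longrightarrow> A \<subseteq> cart n"
  by (simp add: definable_iff_dpred)

definition dtup :: "('a, 'f, 'r) fo_struct \<Rightarrow> nat \<Rightarrow> ((nat \<Rightarrow> nat \<Rightarrow> 'a) \<Rightarrow> nat \<Rightarrow> 'a) \<Rightarrow> bool" where
  "dtup M n u \<longleftrightarrow> (\<forall>i<n. dterm M (\<lambda>E. u E i))"

text \<open>The function is definable on all of \<open>cart m\<close>, so no domain has to be
  carried through the calculus; the sets on which it is continuous or a quotient map are recorded
  separately.\<close>

definition dfun :: "('a, 'f, 'r) fo_struct \<Rightarrow> nat \<Rightarrow> nat \<Rightarrow> ((nat \<Rightarrow> 'a) \<Rightarrow> nat \<Rightarrow> 'a) \<Rightarrow> bool" where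
  "dfun M m n f \<longleftrightarrow> dtup M n (\<lambda>E. f (restrict (E 0) {..<m}))"

lemma dtupD: "dtup M n u \<Longrightarrow> i < n \<Longrightarrow> dterm M (\<lambda>E. u E i)"
  by (simp add: dtup_def)

lemma dterm_restrict [dfb]: "dterm M (\<lambda>E. restrict (E b) {..<m} i)"
  by (cases "i < m") (auto intro: dterm_var dterm_const)

lemma dtup_restrict [dfb]: "dtup M n (\<lambda>E. restrict (E b) {..<m})"
  unfolding dtup_def by (intro allI impI dterm_restrict)

lemma dtup_const [dfb]: "dtup M n (\<lambda>E. c)"
  by (simp add: dtup_def dterm_const)

lemma dtup_dfun: "dfun M m n f \<Longrightarrow> dtup M n (\<lambda>E. f (restrict (E b) {..<m}))"
  unfolding dfun_def dtup_def
  using dterm_reindex[of M "\<lambda>E. f (restrict (E 0) {..<m}) i" for i, of _ "\<lambda>_ _. b" "\<lambda>_ j. j"] by simp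

lemma dterm_dfun: "dfun M m n f \<Longrightarrow> i < n \<Longrightarrow> dterm M (\<lambda>E. f (restrict (E b) {..<m}) i)"
  using dtup_dfun[of M m n f b] by (simp add: dtup_def)

lemma dpred_mem_dtup:
  assumes "definable M n S" "dtup M n u" "\<And>E. u E \<in> cart n"
  shows "dpred M (\<lambda>E. u E \<in> S)"
proof -
  have "u E \<in> S \<longleftrightarrow> (\<exists>y\<in>cart n. (\<forall>i<n. y i = u E i) \<and> y \<in> S)" for E
    using assms(3)[of E] cart_eqI[of _ n "u E"] by auto
  moreover have "dpred M (\<lambda>E. \<exists>y\<in>cart n. (\<forall>i<n. y i = u E i) \<and> y \<in> S)"
    using assms(2) unfolding dtup_def
    by (intro dpred_ex_cart dpred_conj dpred_all_less dpred_mem[OF assms(1)] dpred_eq dterm_restrict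
        dterm_shift[of M "\<lambda>E. u E i" for i]) auto
  ultimately show ?thesis by simp
qed

lemma dpred_mem_restrict [dfb]:
  "definable M n S \<Longrightarrow> dpred M (\<lambda>E. restrict (E b) {..<n} \<in> S)"
  by (rule dpred_mem)

lemma definable_empty: "definable M n {}"
  by (simp add: definable_iff_dpred dpred_const)

lemma definable_cart [dfb]: "definable M n (cart n)"
  by (simp add: definable_iff_dpred dpred_const)

lemma definable_diff: "definable M n A \<Longrightarrow> definable M n B \<Longrightarrow> definable M n (A - B)"
  unfolding definable_iff_dpred by (auto intro: dpred_conj dpred_not)

lemma definable_inter: "definable M n A \<Longrightarrow> definable M n B \<Longrightarrow> definable M n (A \<inter> B)"
  unfolding definable_iff_dpred by (auto intro: dpred_conj)

lemma join_in_cart: "x \<in> cart m \<Longrightarrow> y \<in> cart n \<Longrightarrow> join m x y \<in> cart (m + n)"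
  by (auto simp: cart_def join_def PiE_def extensional_def)

lemma join_inj:
  assumes "join m x y = join m x' y'" "x \<in> cart m" "x' \<in> cart m"
  shows "x = x'" "y = y'"
proof -
  have *: "join m x y i = join m x' y' i" for i using assms(1) by simp
  show "x = x'" using *  assms(2,3) by (intro cart_eqI) (auto simp: join_def, metis)
  show "y = y'"
  proof
    show "y i = y' i" for i using *[of "m + i"] by (simp add: join_def)
  qed
qed

lemma dtup_join [dfb]:
  assumes "dtup M m u" "dtup M n v"
  shows "dtup M (m + n) (\<lambda>E. join m (u E) (v E))"
  unfolding dtup_def
proof (intro allI impI)
  fix i assume "i < m + n"
  then show "dterm M (\<lambda>E. join m (u E) (v E) i)"
    using assms by (cases "i < m") (auto simp: dtup_def join_def)
qed

lemma dpred_pair: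
  assumes "definable M (m + m) (pair_set m R)" "R \<subseteq> cart m \<times> cart m"
  shows "dpred M (\<lambda>E. (restrict (E b) {..<m}, restrict (E c) {..<m}) \<in> R)"
proof -
  have "(x, y) \<in> R \<longleftrightarrow> join m x y \<in> pair_set m R" if "x \<in> cart m" "y \<in> cart m" for x y
    using that assms(2) join_inj[of m x y] unfolding pair_set_def by fastforce
  then show ?thesis
    using dpred_mem_dtup[OF assms(1) dtup_join[OF dtup_restrict dtup_restrict], of b m c m] 
    by (simp add: join_in_cart)
qed

locale definably_complete_field =
  fixes M :: "('a::{linordered_field, linorder_topology}, 'f, 'r) fo_struct"
  assumes field: "expands_ordered_field M" and complete: "definably_complete M"
begin

lemma dpred_less [dfb]: "dterm M t \<Longrightarrow> dterm M u \<Longrightarrow> dpred M (\<lambda>E. t E < u E)"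
proof (rule dpred_rel2)
  obtain r where "rel_arity M r = 2" "\<And>x y. rel_interp M r [x, y] \<longleftrightarrow> x < y"
    using field unfolding expands_ordered_field_def by metis
  then show "dpred M (\<lambda>E. E 0 0 < E 1 0)"
    unfolding dpred_def
    by (intro exI[of _ "Rel r [Var 0, Var 1]"] exI[of _ "\<lambda>i. Inl (i, 0)"]) auto
qed

lemma dpred_le [dfb]: "dterm M t \<Longrightarrow> dterm M u \<Longrightarrow> dpred M (\<lambda>E. t E \<le> u E)"
  using dpred_not[OF dpred_less[of u t]] by (simp add: not_less)

lemma dterm_add [dfb]: "dterm M t \<Longrightarrow> dterm M u \<Longrightarrow> dterm M (\<lambda>E. t E + u E)"
proof (rule dterm_op2[where op = plus])
  obtain f where "fun_arity M f = 2" "\<And>x y. fun_interp M f [x, y] = x + y"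
    using field unfolding expands_ordered_field_def by metis
  then show "dpred M (\<lambda>E. E 0 0 = E 1 0 + E 2 0)"
    unfolding dpred_def
    by (intro exI[of _ "Eq (Var 0) (App f [Var 1, Var 2])"] exI[of _ "\<lambda>i. Inl (i, 0)"]) auto
qed

lemma dterm_mult [dfb]: "dterm M t \<Longrightarrow> dterm M u \<Longrightarrow> dterm M (\<lambda>E. t E * u E)"
proof (rule dterm_op2[where op = times])
  obtain f where "fun_arity M f = 2" "\<And>x y. fun_interp M f [x, y] = x * y"
    using field unfolding expands_ordered_field_def by metis
  then show "dpred M (\<lambda>E. E 0 0 = E 1 0 * E 2 0)"
    unfolding dpred_def
    by (intro exI[of _ "Eq (Var 0) (App f [Var 1, Var 2])"] exI[of _ "\<lambda>i. Inl (i, 0)"]) auto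
qed

lemma dterm_diff [dfb]: "dterm M t \<Longrightarrow> dterm M u \<Longrightarrow> dterm M (\<lambda>E. t E - u E)"
  using dterm_add[of t "\<lambda>E. -1 * u E"] dterm_mult[of "\<lambda>E. -1" u] dterm_const[of M "-1"] by simp

lemma dterm_inverse [dfb]: "dterm M t \<Longrightarrow> dterm M (\<lambda>E. inverse (t E))"
proof (rule dterm_op1[where op = inverse])
  \<comment> \<open>The first disjunct accounts for the convention that the inverse of 0 is
    0.\<close>
  have "dpred M (\<lambda>E. (E 1 0 = 0 \<and> E 0 0 = 0) \<or> E 0 0 * E 1 0 = 1)"
    by (rule dfb)+
  then show "dpred M (\<lambda>E. E 0 0 = inverse (E 1 0))"
  proof (rule back_subst[of "dpred M"])
    have "((a = 0 \<and> r = 0) \<or> r * a = 1) = (r = inverse a)" for a r :: 'a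
      by (cases "a = 0") (auto simp: field_simps)
    then show "(\<lambda>E. (E 1 0 = 0 \<and> E 0 0 = 0) \<or> E 0 0 * E 1 0 = 1) =
      (\<lambda>E :: nat \<Rightarrow> nat \<Rightarrow> 'a. E 0 0 = inverse (E 1 0))"
      by simp
  qed
qed

lemma dterm_divide [dfb]: "dterm M t \<Longrightarrow> dterm M u \<Longrightarrow> dterm M (\<lambda>E. t E / u E)"
  unfolding divide_inverse by (intro dterm_mult dterm_inverse)

lemma dterm_uminus [dfb]: "dterm M t \<Longrightarrow> dterm M (\<lambda>E. - t E)"
  using dterm_diff[of "\<lambda>E. 0" t] dterm_const[of M 0] by simp

lemma dterm_abs [dfb]: "dterm M t \<Longrightarrow> dterm M (\<lambda>E. \<bar>t E\<bar>)"
  unfolding abs_if by (intro dterm_if dpred_less dterm_uminus dterm_const)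

lemma dterm_sum:
  fixes n :: nat
  assumes "\<And>i. i < n \<Longrightarrow> dterm M (\<lambda>E. t i E)"
  shows "dterm M (\<lambda>E. \<Sum>i<n. t i E)"
  using assms
proof (induction n)
  case 0
  then show ?case by (simp add: dterm_const)
next
  case (Suc n)
  then show ?case by (simp add: dterm_add)
qed

lemma dterm_l1 [dfb]: "dtup M n u \<Longrightarrow> dtup M n v \<Longrightarrow> dterm M (\<lambda>E. l1 n (u E) (v E))"
  unfolding l1_def dtup_def by (intro dterm_sum dterm_abs dterm_diff) auto

definition is_glb :: "'a set \<Rightarrow> 'a \<Rightarrow> bool" where
  "is_glb S r \<longleftrightarrow> (\<forall>x. x \<in> S \<longrightarrow> r \<le> x) \<and> (\<forall>l. (\<forall>x. x \<in> S \<longrightarrow> l \<le> x) \<longrightarrow> l \<le> r)"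

text \<open>The value 0 is a junk value for sets without an infimum in the field.\<close>

definition glb :: "'a set \<Rightarrow> 'a" where
  "glb S = (if \<exists>r. is_glb S r then THE r. is_glb S r else 0)"

lemma is_glb_unique: "is_glb S r \<Longrightarrow> is_glb S s \<Longrightarrow> r = s"
  unfolding is_glb_def by (blast intro: antisym)

lemma glb_eq: "is_glb S r \<Longrightarrow> glb S = r"
  unfolding glb_def using is_glb_unique by (auto intro!: the_equality)

lemma dterm_glb [dfb]:
  assumes "dpred M (\<lambda>E. E 0 0 \<in> S (\<lambda>b. E (Suc b)))"
  shows "dterm M (\<lambda>E. glb (S E))"
proof -
  have mem: "dpred M (\<lambda>E. E c 0 \<in> S (\<lambda>b. E (d b)))" for c d
    using dpred_reindex[OF assms, of "\<lambda>b _. if b = 0 then c else d (b - 1)" "\<lambda>_ j. j"] by simp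
  have "dpred M (\<lambda>E. is_glb (S (\<lambda>b. E (Suc b))) (E 0 0) \<or>
     \<not> (\<exists>r. is_glb (S (\<lambda>b. E (Suc b))) r) \<and> E 0 0 = 0)"
    unfolding is_glb_def by (rule dfb mem)+
  moreover have "(is_glb A r \<or> \<not> (\<exists>r. is_glb A r) \<and> r = 0) = (r = glb A)" for A r
    by (cases "\<exists>r. is_glb A r") (auto simp: glb_eq intro: is_glb_unique, simp_all add: glb_def)
  ultimately show ?thesis unfolding dterm_def by simp
qed

text \<open>Definable completeness provides an infimum among the extended values; a member and a
  lower bound force it to be finite.\<close>

lemma ex_glb:
  assumes "dpred M (\<lambda>E. E 0 0 \<in> S)" "x \<in> S" "\<And>y. y \<in> S \<Longrightarrow> l \<le> y"
  shows "is_glb S (glb S)"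
proof -
  obtain s where s: "isGlb UNIV (Fin ` S) s"
    using complete assms(1) unfolding definably_complete_def definable1_iff_dpred by blast
  have lb: "s \<le> Fin y" if "y \<in> S" for y
    using s that by (auto simp: isGlb_def isLb_def greatestP_def setge_def)
  have gr: "Fin l' \<le> s" if "\<And>y. y \<in> S \<Longrightarrow> l' \<le> y" for l'
    using s that by (auto simp: isGlb_def isLb_def greatestP_def setge_def setle_def)
  obtain r where r: "s = Fin r"
    using lb[OF assms(2)] gr[OF assms(3)] by (cases s) auto
  have "is_glb S r"
    using lb gr unfolding is_glb_def r by auto
  then show ?thesis by (simp add: glb_eq)
qed

lemma ex_lub:
  assumes "dpred M (\<lambda>E. E 0 0 \<in> S)" "x \<in> S" "\<And>y. y \<in> S \<Longrightarrow> y \<le> u"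
  obtains r where "\<And>y. y \<in> S \<Longrightarrow> y \<le> r" "\<And>v. v < r \<Longrightarrow> \<exists>y\<in>S. v < y"
proof -
  obtain s where s: "isLub UNIV (Fin ` S) s"
    using complete assms(1) unfolding definably_complete_def definable1_iff_dpred by blast
  have ub: "Fin y \<le> s" if "y \<in> S" for y
    using s that by (auto simp: isLub_def isUb_def leastP_def setle_def)
  have le: "s \<le> Fin l'" if "\<And>y. y \<in> S \<Longrightarrow> y \<le> l'" for l'
    using s that by (auto simp: isLub_def isUb_def leastP_def setge_def setle_def)
  obtain r where r: "s = Fin r"
    using ub[OF assms(2)] le[OF assms(3)] by (cases s) auto
  show ?thesis
  proof (rule that[of r])
    show "\<And>y. y \<in> S \<Longrightarrow> y \<le> r" using ub r by auto
    show "\<And>v. v < r \<Longrightarrow> \<exists>y\<in>S. v < y" using le r by (metis less_eq_extended.simps(1) not_le)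
  qed
qed

end

section \<open>Cluster points of definable families\<close>

text \<open>A family \<open>Z\<close> indexed by \<open>t > 0\<close> and increasing in \<open>t\<close> plays the role of a filter base;
  \<open>p\<close> is a cluster point if it lies in the closure of every \<open>Z t\<close>.\<close>

definition clus :: "nat \<Rightarrow> ('a::linordered_field \<Rightarrow> (nat \<Rightarrow> 'a) set) \<Rightarrow> (nat \<Rightarrow> 'a) \<Rightarrow> bool" where
  "clus k Z p \<longleftrightarrow> (\<forall>\<epsilon>>0. \<forall>t>0. \<exists>y\<in>Z t. l1 k p y < \<epsilon>)"

text \<open>The index is read from coordinate 0 of tuple 1, and only positive indices are
  constrained. Nonemptiness is left out; it is supplied wherever a cluster point has to be
  produced.\<close>

definition dfam ::
  "('a::linordered_field, 'f, 'r) fo_struct \<Rightarrow> nat \<Rightarrow> (nat \<Rightarrow> 'a) set \<Rightarrow> ('a \<Rightarrow> (nat \<Rightarrow> 'a) set) \<Rightarrow> bool"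
  where
  "dfam M m A Z \<longleftrightarrow> dpred M (\<lambda>E. restrict (E 0) {..<m} \<in> Z (E 1 0)) \<and>
     (\<forall>t>0. Z t \<subseteq> A) \<and> (\<forall>s t. 0 < s \<longrightarrow> s \<le> t \<longrightarrow> Z s \<subseteq> Z t)"

lemma clusD: "clus k Z p \<Longrightarrow> 0 < \<epsilon> \<Longrightarrow> 0 < t \<Longrightarrow> \<exists>y\<in>Z t. l1 k p y < \<epsilon>"
  by (simp add: clus_def)

lemma dfam_subset: "dfam M m A Z \<Longrightarrow> 0 < t \<Longrightarrow> Z t \<subseteq> A"
  by (simp add: dfam_def)

lemma dfam_mono: "dfam M m A Z \<Longrightarrow> 0 < s \<Longrightarrow> s \<le> t \<Longrightarrow> Z s \<subseteq> Z t"
  by (simp add: dfam_def)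

lemma dfam_mem:
  assumes "dfam M m A Z" "dterm M t"
  shows "dpred M (\<lambda>E. restrict (E b) {..<m} \<in> Z (t E))"
proof -
  have "dpred M (\<lambda>E. restrict (E (Suc b)) {..<m} \<in> Z (E 0 0))"
    using assms(1) dpred_reindex[of M "\<lambda>E. restrict (E 0) {..<m} \<in> Z (E 1 0)"
      "\<lambda>b' _. if b' = 0 then Suc b else 0" "\<lambda>_ j. j"]
    by (simp add: dfam_def)
  then show ?thesis
    using dpred_subst[of M "\<lambda>a E. restrict (E b) {..<m} \<in> Z a" t] assms(2) by simp
qed

lemma dfamI:
  assumes "dpred M (\<lambda>E. restrict (E 0) {..<m} \<in> Z (E 1 0))" "\<And>t. 0 < t \<Longrightarrow> Z t \<subseteq> A"
    "\<And>s t. 0 < s \<Longrightarrow> s \<le> t \<Longrightarrow> Z s \<subseteq> Z t"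
  shows "dfam M m A Z"
  using assms unfolding dfam_def by blast

lemma dfam_const: "definable M m A \<Longrightarrow> dfam M m A (\<lambda>t. A)"
  by (rule dfamI) (auto intro: dpred_mem)

lemma l1_join: "l1 (m + n) (join m x y) (join m x' y') = l1 m x x' + l1 n y y'"
proof (induction n)
  case 0
  show ?case unfolding l1_def by (auto simp: join_def intro: sum.cong)
next
  case (Suc n)
  then show ?case by (simp add: l1_def join_def)
qed

context definably_complete_field
begin

text \<open>Bolzano-Weierstrass without sequences: the coordinates of the cluster point are found
  one at a time, each as a limit inferior along those points of the family that approach the
  coordinates already found.\<close>

lemma ex_clus:
  assumes Z: "dfam M k (cart k) Z" and ne: "\<And>t. 0 < t \<Longrightarrow> Z t \<noteq> {}"
    and bdd: "\<And>y i. y \<in> Z 1 \<Longrightarrow> i < k \<Longrightarrow> \<bar>y i\<bar> \<le> R"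
  shows "\<exists>p\<in>cart k. clus k Z p"
proof -
  have "\<exists>p. \<forall>\<epsilon>>0. \<forall>t>0. \<exists>y\<in>Z t. l1 j p y < \<epsilon>" if "j \<le> k" for j
    using that
  proof (induction j)
    case 0
    then show ?case using ne by (auto simp: l1_def)
  next
    case (Suc j)
    then obtain p where p: "\<And>\<epsilon> t. 0 < \<epsilon> \<Longrightarrow> 0 < t \<Longrightarrow> \<exists>y\<in>Z t. l1 j p y < \<epsilon>" by auto
    \<comment> \<open>The eventual lower bounds of coordinate \<open>j\<close>; their supremum is
      the limit inferior. A single \<open>s\<close> limits both the index and the distance to
      \<open>p\<close>.\<close>
    define S where "S = {r. \<exists>s. 0 < s \<and> (\<forall>y\<in>cart k. y \<in> Z s \<and> l1 j p y < s \<longrightarrow> r \<le> y j)}"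
    have "dpred M (\<lambda>E. E 0 0 \<in> S)"
      unfolding S_def mem_Collect_eq by (rule dfb dfam_mem[OF Z])+
    moreover have "- R \<in> S"
      unfolding S_def using bdd[of _ j] Suc.prems by (auto intro!: exI[of _ 1] simp: abs_le_iff minus_le_iff)
    moreover have "r \<le> R" if rS: "r \<in> S" for r
    proof -
      obtain s where s: "0 < s" "\<forall>y\<in>cart k. y \<in> Z s \<and> l1 j p y < s \<longrightarrow> r \<le> y j"
        using rS by (auto simp: S_def)
      obtain y where y: "y \<in> Z (min s 1)" "l1 j p y < s" using p[of s "min s 1"] s(1) by auto
      have "y \<in> Z s" "y \<in> Z 1" "y \<in> cart k"
        using y(1) dfam_mono[OF Z, of "min s 1" s] dfam_mono[OF Z, of "min s 1" 1]
          dfam_subset[OF Z, of "min s 1"] s(1) by auto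
      then show ?thesis using s(2) y(2) bdd[of y j] Suc.prems by force
    qed
    ultimately obtain r where r: "\<And>y. y \<in> S \<Longrightarrow> y \<le> r" "\<And>v. v < r \<Longrightarrow> \<exists>y\<in>S. v < y"
      using ex_lub[of S "- R" R] by blast
    have "\<exists>y\<in>Z t. l1 (Suc j) (p(j := r)) y < \<epsilon>" if "0 < \<epsilon>" "0 < t" for \<epsilon> t
    proof -
      obtain r' where r': "r' \<in> S" "r - \<epsilon> / 2 < r'" using r(2)[of "r - \<epsilon> / 2"] \<open>0 < \<epsilon>\<close> by auto
      then obtain s0 where s0: "0 < s0" "\<forall>y\<in>cart k. y \<in> Z s0 \<and> l1 j p y < s0 \<longrightarrow> r' \<le> y j"
        by (auto simp: S_def)
      define s where "s = min s0 (min t (\<epsilon> / 2))"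
      have s: "0 < s" "s \<le> s0" "s \<le> t" "s \<le> \<epsilon> / 2" using s0(1) that by (auto simp: s_def)
      \<comment> \<open>A number above the supremum is not an eventual lower bound, so some late
        \<open>y\<close> falls below it, while \<open>r'\<close> bounds that same \<open>y\<close>
        from below.\<close>
      have "r + \<epsilon> / 2 \<notin> S" using r(1)[of "r + \<epsilon> / 2"] \<open>0 < \<epsilon>\<close> by auto
      then obtain y where y: "y \<in> cart k" "y \<in> Z s" "l1 j p y < s" "y j < r + \<epsilon> / 2"
        using s(1) by (auto simp: S_def not_le)
      have "r' \<le> y j" using s0(2) y s dfam_mono[OF Z s(1,2)] by (meson le_less_trans less_le_trans subsetD)
      then have "\<bar>r - y j\<bar> < \<epsilon> / 2" using r'(2) y(4) by linarith
      moreover have "l1 (Suc j) (p(j := r)) y = l1 j p y + \<bar>r - y j\<bar>" by (simp add: l1_def)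
      ultimately have "l1 (Suc j) (p(j := r)) y < \<epsilon>" using y(3) s(4) by linarith
      then show ?thesis using y(2) dfam_mono[OF Z s(1,3)] by blast
    qed
    then show ?case by blast
  qed
  from this[of k] obtain p where "\<forall>\<epsilon>>0. \<forall>t>0. \<exists>y\<in>Z t. l1 k p y < \<epsilon>" by auto
  then have "clus k Z (restrict p {..<k})"
    by (simp add: clus_def l1_def)
  then show ?thesis using restrict_in_cart by blast
qed

end

section \<open>Equivalence relations that are definably proper\<close>

lemma pair_set_memD:
  assumes "z \<in> pair_set m R"
  obtains x y where "z = join m x y" "(x, y) \<in> R"
  using assms by (auto simp: pair_set_def)

lemma in_closure_iff:
  fixes D :: "'a::{linordered_field, linorder_topology} set"
  shows "t \<in> closure D \<longleftrightarrow> (\<forall>\<epsilon>>0. \<exists>u\<in>D. \<bar>t - u\<bar> < \<epsilon>)"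
proof
  assume t: "t \<in> closure D"
  show "\<forall>\<epsilon>>0. \<exists>u\<in>D. \<bar>t - u\<bar> < \<epsilon>"
  proof (intro allI impI)
    fix \<epsilon> :: 'a assume "0 < \<epsilon>"
    then have "t \<in> {u. \<bar>t - u\<bar> < \<epsilon>} \<inter> closure D" using t by simp
    then have "{u. \<bar>t - u\<bar> < \<epsilon>} \<inter> D \<noteq> {}"
      using open_Int_closure_eq_empty[OF open_interval_abs] by blast
    then show "\<exists>u\<in>D. \<bar>t - u\<bar> < \<epsilon>" by blast
  qed
next
  assume *: "\<forall>\<epsilon>>0. \<exists>u\<in>D. \<bar>t - u\<bar> < \<epsilon>"
  show "t \<in> closure D"
  proof (rule ccontr)
    assume "t \<notin> closure D"
    then have "\<exists>\<epsilon>>0. \<forall>u. \<bar>t - u\<bar> < \<epsilon> \<longrightarrow> u \<in> - closure D"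
      by (intro open_imp_interval) auto
    then show False using * closure_subset by blast
  qed
qed

locale proper_equiv = definably_complete_field M
  for M :: "('a::{linordered_field, linorder_topology}, 'f, 'r) fo_struct" +
  fixes \<DD> :: "'a set set" and m :: nat and X :: "(nat \<Rightarrow> 'a) set"
    and R :: "((nat \<Rightarrow> 'a) \<times> (nat \<Rightarrow> 'a)) set"
  assumes choice: "definable_choice M" and pf: "good_pseudo_filter M \<DD>"
    and eqv: "definable_equiv M m X R"
    and proper: "equiv_definably_proper_over M m X R"
begin

lemma X_def: "definable M m X" and R_equiv: "equiv X R" and R_def: "definable M (m + m) (pair_set m R)"
  using eqv by (auto simp: definable_equiv_def)

lemma X_cart: "X \<subseteq> cart m"
  using X_def by (rule definable_subset_cart)

lemma R_X: "(x, y) \<in> R \<Longrightarrow> x \<in> X" "(x, y) \<in> R \<Longrightarrow> y \<in> X"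
  using R_equiv by (auto simp: equiv_def refl_on_def)

lemma R_refl: "x \<in> X \<Longrightarrow> (x, x) \<in> R"
  using R_equiv by (simp add: equiv_def refl_on_def)

lemma R_sym: "(x, y) \<in> R \<Longrightarrow> (y, x) \<in> R"
  using R_equiv by (auto simp: equiv_def dest: symD)

lemma R_trans: "(x, y) \<in> R \<Longrightarrow> (y, z) \<in> R \<Longrightarrow> (x, z) \<in> R"
  using R_equiv by (auto simp: equiv_def dest: transD)

lemma dpred_R [dfb]: "dpred M (\<lambda>E. (restrict (E b) {..<m}, restrict (E c) {..<m}) \<in> R)"
  using R_X X_cart by (intro dpred_pair[OF R_def]) auto

lemma pf_pos: "\<forall>D\<in>\<DD>. definable1 M D \<and> D \<subseteq> {0<..} \<and> 0 \<in> closure D"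
  and pf_closure: "\<forall>D\<in>\<DD>. bdd_below D \<and> bdd_above D \<and> closure D = D \<union> {0}"
  and pf_ne: "\<DD> \<noteq> {}"
  using pf unfolding good_pseudo_filter_def by - (elim conjE; assumption)+

lemma pf_continuous:
  assumes "D \<in> \<DD>" "definable_curve M D n \<gamma>"
  shows "\<exists>D'\<in>\<DD>. D' \<subseteq> D \<and> continuous_map (top_of_set D') (cart_top n) \<gamma>"
proof -
  have "\<forall>D\<in>\<DD>. \<forall>n \<gamma>. definable_curve M D n \<gamma> \<longrightarrow>
        (\<exists>D'\<in>\<DD>. D' \<subseteq> D \<and> continuous_map (top_of_set D') (cart_top n) \<gamma>) \<and>
        (Lim_set D n \<gamma> \<noteq> {} \<longrightarrow>
           (\<exists>D'\<in>\<DD>. D' \<subseteq> D \<and> continuous_map (top_of_set D') (cart_top n) \<gamma> \<and>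
              (\<exists>p. Lim_set D' n \<gamma> = {p})))"
    using pf unfolding good_pseudo_filter_def by (elim conjE) assumption
  then show ?thesis using assms by simp
qed

text \<open>Continuity along a member \<open>D\<close> of the pseudo-filter makes the curve \<open>\<gamma>\<close> together with its limit
  \<open>x\<^sub>0\<close> a definably compact set.\<close>

lemma compact_curve:
  assumes D: "D \<in> \<DD>" and G: "dpred M (\<lambda>E. E 0 0 \<in> D \<and> (\<forall>i<m. E 1 i = \<gamma> (E 0 0) i))"
    and \<gamma>: "\<gamma> ` D \<subseteq> cart m"
    and cont: "continuous_map (top_of_set D) (cart_top m) \<gamma>"
    and lim: "\<And>t. t \<in> D \<Longrightarrow> l1 m x0 (\<gamma> t) < t" and x0: "x0 \<in> cart m"
  shows "definably_compact M m (insert x0 (\<gamma> ` D))"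
proof -
  have Dpos: "D \<subseteq> {0<..}" and "bdd_above D" and clD: "closure D = D \<union> {0}"
    using pf_pos pf_closure D by auto
  then obtain B where B: "\<And>t. t \<in> D \<Longrightarrow> t \<le> B" by (auto simp: bdd_above_def)
  have G': "dpred M (\<lambda>E. E b 0 \<in> D \<and> (\<forall>i<m. E c i = \<gamma> (E b 0) i))" for b c
    using dpred_reindex[OF G, of "\<lambda>b' _. if b' = 0 then b else c" "\<lambda>_ j. j"] by simp
  have gr: "(t \<in> D \<and> (\<forall>i<m. x i = \<gamma> t i)) \<longleftrightarrow> t \<in> D \<and> x = \<gamma> t" if "x \<in> cart m" for t x
    using that \<gamma> cart_eqI[of x m "\<gamma> t"] by auto
  \<comment> \<open>Cluster points of parameters: conditions \<open>P s\<close> on the curve that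
    tighten as \<open>s\<close> decreases accumulate at some \<open>t\<close>, and
    \<open>closure D = D \<union> {0}\<close> leaves only parameters of the curve and 0.\<close>
  have *: "\<exists>t\<in>D \<union> {0}. \<forall>\<epsilon>>0. \<forall>s>0. \<exists>u\<in>D. P s (\<gamma> u) \<and> \<bar>t - u\<bar> < \<epsilon>"
    if P: "dpred M (\<lambda>E. P (E 1 0) (restrict (E 0) {..<m}))" "\<And>s. 0 < s \<Longrightarrow> \<exists>u\<in>D. P s (\<gamma> u)"
      "\<And>s t x. 0 < s \<Longrightarrow> s \<le> t \<Longrightarrow> P s x \<Longrightarrow> P t x" for P
  proof -
    define V where "V s = {\<tau>\<in>cart 1. \<tau> 0 \<in> D \<and> P s (\<gamma> (\<tau> 0))}" for s
    have P': "dpred M (\<lambda>E. P (E b 0) (restrict (E c) {..<m}))" for b c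
      using dpred_reindex[OF P(1), of "\<lambda>b' _. if b' = 0 then c else b" "\<lambda>_ j. j"] by simp
    have V: "dfam M 1 (cart 1) V"
    proof (rule dfamI)
      have "dpred M (\<lambda>E. \<exists>x\<in>cart m. (E 0 0 \<in> D \<and> (\<forall>i<m. x i = \<gamma> (E 0 0) i)) \<and> P (E 1 0) x)"
        by (rule dpred_ex_cart, rule dpred_conj)
          (use G'[of 1 0] P'[of 2 0] in \<open>simp_all add: numeral_2_eq_2\<close>)
      moreover have "(\<exists>x\<in>cart m. (t \<in> D \<and> (\<forall>i<m. x i = \<gamma> t i)) \<and> P s x) \<longleftrightarrow> t \<in> D \<and> P s (\<gamma> t)" for t s
        using gr[of _ t] \<gamma> by (auto; blast)
      ultimately show "dpred M (\<lambda>E. restrict (E 0) {..<1} \<in> V (E 1 0))" by (simp add: V_def)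
    qed (use P(3) in \<open>auto simp: V_def\<close>)
    have "V s \<noteq> {}" if s: "0 < s" for s
    proof -
      obtain u where "u \<in> D" "P s (\<gamma> u)" using P(2)[OF s] by blast
      then have "tuple1 u \<in> V s" by (auto simp: V_def tuple1_def cart_def)
      then show ?thesis by blast
    qed
    moreover have "\<bar>\<tau> i\<bar> \<le> B" if "\<tau> \<in> V 1" "i < 1" for \<tau> i
      using that B[of "\<tau> 0"] Dpos by (auto simp: V_def)
    ultimately obtain p where "clus 1 V p"
      using ex_clus[OF V, of B] by blast
    then have p: "\<exists>u\<in>D. P s (\<gamma> u) \<and> \<bar>p 0 - u\<bar> < \<epsilon>" if "0 < \<epsilon>" "0 < s" for \<epsilon> s
      using that by (fastforce simp: clus_def V_def l1_def)
    then have "p 0 \<in> closure D" unfolding in_closure_iff using zero_less_one by blast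
    then show ?thesis unfolding clD using p by blast
  qed
  have "definable M m (insert x0 (\<gamma> ` D))"
    unfolding definable_iff_dpred
  proof
    show "insert x0 (\<gamma> ` D) \<subseteq> cart m" using x0 \<gamma> by auto
    have "x \<in> insert x0 (\<gamma> ` D) \<longleftrightarrow> (\<forall>i<m. x i = x0 i) \<or> (\<exists>t. t \<in> D \<and> (\<forall>i<m. x i = \<gamma> t i))"
      if "x \<in> cart m" for x
      using gr[OF that] cart_eqI[OF that x0] by auto
    moreover have "dpred M (\<lambda>E. (\<forall>i<m. E 0 i = x0 i) \<or> (\<exists>t. t \<in> D \<and> (\<forall>i<m. E 0 i = \<gamma> t i)))"
      by (intro dpred_disj dpred_all_less dpred_eq dterm_var dterm_const dpred_ex G')
    ultimately show "dpred M (\<lambda>E. restrict (E 0) {..<m} \<in> insert x0 (\<gamma> ` D))"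
      by simp
  qed
  moreover have "closedin (cart_top m) (insert x0 (\<gamma> ` D))"
    unfolding closedin_cart_top
  proof (intro conjI ballI impI)
    fix p assume p: "p \<in> cart m" and near: "\<forall>\<epsilon>>0. \<exists>y\<in>insert x0 (\<gamma> ` D). l1 m p y < \<epsilon>"
    show "p \<in> insert x0 (\<gamma> ` D)"
    proof (cases "\<forall>s>0. \<exists>u\<in>D. l1 m p (\<gamma> u) < s")
      case False
      then obtain s where s: "0 < s" "\<And>u. u \<in> D \<Longrightarrow> \<not> l1 m p (\<gamma> u) < s" by blast
      have "l1 m p x0 < \<epsilon>" if "0 < \<epsilon>" for \<epsilon>
        using near[rule_format, of "min s \<epsilon>"] that s by auto
      then show ?thesis using eq_if_l1_small[OF p x0] by blast
    next
      case True
      \<comment> \<open>Parameters with \<open>\<gamma> u\<close> ever closer to \<open>p\<close>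
        accumulate at \<open>t\<close>. Continuity gives \<open>p = \<gamma> t\<close> if
        \<open>t \<in> D\<close>; the bound \<open>lim\<close> gives \<open>p = x0\<close> if
        \<open>t = 0\<close>.\<close>
      have "\<exists>t\<in>D \<union> {0}. \<forall>\<epsilon>>0. \<forall>s>0. \<exists>u\<in>D. l1 m p (\<gamma> u) < s \<and> \<bar>t - u\<bar> < \<epsilon>"
      proof (rule *[of "\<lambda>s x. l1 m p x < s"])
        show "dpred M (\<lambda>E. l1 m p (restrict (E 0) {..<m}) < E 1 0)" by (rule dfb)+
      qed (use True in auto)
      then obtain t where t: "t \<in> D \<union> {0}"
        "\<And>\<epsilon> s. 0 < \<epsilon> \<Longrightarrow> 0 < s \<Longrightarrow> \<exists>u\<in>D. l1 m p (\<gamma> u) < s \<and> \<bar>t - u\<bar> < \<epsilon>"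
        by blast
      show ?thesis
      proof (cases "t \<in> D")
        case True
        have "l1 m p (\<gamma> t) < \<epsilon>" if \<epsilon>: "0 < \<epsilon>" for \<epsilon>
        proof -
          obtain \<delta> where \<delta>: "0 < \<delta>" "\<And>u. u \<in> D \<Longrightarrow> \<bar>t - u\<bar> < \<delta> \<Longrightarrow> l1 m (\<gamma> t) (\<gamma> u) < \<epsilon> / 2"
            using continuous_curveD[OF cont True half_gt_zero[OF \<epsilon>]] by blast
          obtain u where "u \<in> D" "l1 m p (\<gamma> u) < \<epsilon> / 2" "\<bar>t - u\<bar> < \<delta>"
            using t(2)[OF \<delta>(1), of "\<epsilon> / 2"] \<epsilon> by auto
          then show ?thesis
            using \<delta>(2)[of u] l1_triangle[of m p "\<gamma> t" "\<gamma> u"] l1_commute[of m "\<gamma> u" "\<gamma> t"]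
            by linarith
        qed
        then have "p = \<gamma> t" using eq_if_l1_small[OF p] \<gamma> True by blast
        then show ?thesis using True by blast
      next
        case False
        then have t0: "t = 0" using t(1) by auto
        have "l1 m p x0 < \<epsilon>" if \<epsilon>: "0 < \<epsilon>" for \<epsilon>
        proof -
          obtain u where "u \<in> D" "l1 m p (\<gamma> u) < \<epsilon> / 2" "\<bar>u\<bar> < \<epsilon> / 2"
            using t(2)[of "\<epsilon> / 2" "\<epsilon> / 2"] \<epsilon> t0 by auto
          moreover from this have "l1 m x0 (\<gamma> u) < \<epsilon> / 2" using lim[of u] by simp
          ultimately have "l1 m p (\<gamma> u) + l1 m (\<gamma> u) x0 < \<epsilon> / 2 + \<epsilon> / 2"
            using l1_commute[of m "\<gamma> u" x0] by (intro add_strict_mono) auto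
          then show ?thesis using l1_triangle[of m p x0 "\<gamma> u"] by simp
        qed
        then show ?thesis using eq_if_l1_small[OF p x0] by blast
      qed
    qed
  qed (use x0 \<gamma> in auto)
  moreover have "bounded_cart m (insert x0 (\<gamma> ` D))"
  proof -
    have "\<exists>C. \<forall>u\<in>D. l1 m x0 (\<gamma> u) \<le> C"
    proof (rule ccontr)
      assume "\<not> ?thesis"
      then have unb: "\<exists>u\<in>D. inverse s < l1 m x0 (\<gamma> u)" for s by (meson not_le)
      \<comment> \<open>As \<open>inverse s\<close> grows when \<open>s\<close> shrinks,
        unboundedness becomes a tightening condition. Accumulation at \<open>t \<in> D\<close>
        contradicts continuity, and accumulation at 0 contradicts \<open>lim\<close>.\<close>
      have "\<exists>t\<in>D \<union> {0}. \<forall>\<epsilon>>0. \<forall>s>0. \<exists>u\<in>D. inverse s < l1 m x0 (\<gamma> u) \<and> \<bar>t - u\<bar> < \<epsilon>"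
      proof (rule *[of "\<lambda>s x. inverse s < l1 m x0 x"])
        show "dpred M (\<lambda>E. inverse (E 1 0) < l1 m x0 (restrict (E 0) {..<m}))" by (rule dfb)+
        show "inverse t' < l1 m x0 x" if "0 < s" "s \<le> t'" "inverse s < l1 m x0 x" for s t' x
          using that by (meson le_imp_inverse_le le_less_trans)
      qed (rule unb)
      then obtain t where t: "t \<in> D \<union> {0}"
        "\<And>\<epsilon> s. 0 < \<epsilon> \<Longrightarrow> 0 < s \<Longrightarrow> \<exists>u\<in>D. inverse s < l1 m x0 (\<gamma> u) \<and> \<bar>t - u\<bar> < \<epsilon>"
        by blast
      show False
      proof (cases "t \<in> D")
        case True
        obtain \<delta> where \<delta>: "0 < \<delta>" "\<And>u. u \<in> D \<Longrightarrow> \<bar>t - u\<bar> < \<delta> \<Longrightarrow> l1 m (\<gamma> t) (\<gamma> u) < 1"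
          using continuous_curveD[OF cont True zero_less_one] by blast
        define C where "C = l1 m x0 (\<gamma> t) + 1"
        have "0 < C" by (simp add: C_def add_nonneg_pos)
        then obtain u where "u \<in> D" "C < l1 m x0 (\<gamma> u)" "\<bar>t - u\<bar> < \<delta>"
          using t(2)[OF \<delta>(1), of "inverse C"] by auto
        then show False using \<delta>(2)[of u] l1_triangle[of m x0 "\<gamma> u" "\<gamma> t"] by (simp add: C_def)
      next
        case False
        then obtain u where "u \<in> D" "1 < l1 m x0 (\<gamma> u)" "\<bar>u\<bar> < 1"
          using t(1) t(2)[of 1 1] by auto
        then show False using lim[of u] by simp
      qed
    qed
    then obtain C where "\<And>u. u \<in> D \<Longrightarrow> l1 m x0 (\<gamma> u) \<le> C" by blast
    then have C: "l1 m x0 x \<le> max C 0" if "x \<in> insert x0 (\<gamma> ` D)" for x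
      using that by (auto simp: le_max_iff_disj)
    have "x0 i - max C 0 \<le> x i \<and> x i \<le> x0 i + max C 0" if "x \<in> insert x0 (\<gamma> ` D)" "i < m" for x i
      using C[OF that(1)] abs_le_l1[OF that(2), of x0 x] by linarith
    then show ?thesis unfolding bounded_cart_def
      by (intro exI[of _ "\<lambda>i. x0 i - max C 0"] exI[of _ "\<lambda>i. x0 i + max C 0"] ballI allI impI)
  qed
  ultimately show ?thesis by (simp add: definably_compact_def)
qed

text \<open>In the quotient topology this says that classes are definably compact and that the canonical
  map is definably closed.\<close>

lemma clus_R:
  assumes Z: "dfam M m X Z" and x0: "x0 \<in> X"
    and near: "\<And>\<epsilon> t. 0 < \<epsilon> \<Longrightarrow> 0 < t \<Longrightarrow> \<exists>y\<in>Z t. \<exists>x. (x, y) \<in> R \<and> l1 m x0 x < \<epsilon>"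
  shows "\<exists>y0. clus m Z y0 \<and> (x0, y0) \<in> R"
proof -
  have x0c: "x0 \<in> cart m" using x0 X_cart by blast
  \<comment> \<open>One parameter controls the index of the family and the distance to
    \<open>x0\<close>, so a definable choice of pairs yields a curve tending to \<open>x0\<close>
    together with equivalent partners in \<open>Z\<close>.\<close>
  define ok where "ok \<tau> x y \<longleftrightarrow> 0 < \<tau> (0::nat) \<and> y \<in> Z (\<tau> 0) \<and> (x, y) \<in> R \<and> l1 m x0 x < \<tau> 0" for \<tau> x y
  define N where "N = 1 + (m + m)"
  define T where "T = {\<tau> \<in> cart 1. 0 < (\<tau> 0 :: 'a)}" 
  define W where "W = {w \<in> cart N. \<exists>\<tau>\<in>cart 1. \<exists>x\<in>cart m. \<exists>y\<in>cart m.
      (\<forall>i<N. w i = join 1 \<tau> (join m x y) i) \<and> ok \<tau> x y}"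
  note One_nat_def [simp del]
  have jN: "join 1 \<tau> (join m x y) \<in> cart N" if "\<tau> \<in> cart 1" "x \<in> cart m" "y \<in> cart m" for \<tau> x y :: "nat \<Rightarrow> 'a"
    unfolding N_def by (intro join_in_cart that)
  have T: "definable M 1 T"
    unfolding T_def by (rule definable_Collect) (rule dfb)+
  have dj: "dterm M (\<lambda>E. join 1 (restrict (E a) {..<1}) (join m (restrict (E b) {..<m}) (restrict (E c) {..<m})) i)"
    if "i < N" for i a b c
    by (rule dtupD[OF dtup_join[OF dtup_restrict dtup_join[OF dtup_restrict dtup_restrict]]])
      (use that in \<open>simp add: N_def\<close>)
  have W: "definable M N W"
    unfolding W_def ok_def
    by (rule definable_Collect) (rule dfb dpred_all_less dj dfam_mem[OF Z] | assumption)+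
  have Wj: "join 1 \<tau> (join m x y) \<in> W" if "\<tau> \<in> cart 1" "ok \<tau> x y" for \<tau> x y
  proof -
    have "x \<in> cart m" "y \<in> cart m" using that(2) R_X X_cart by (auto simp: ok_def)
    then show ?thesis using that jN unfolding W_def by blast
  qed
  have Wd: "\<exists>x y. w = join 1 \<tau> (join m x y) \<and> ok \<tau> x y" if "w \<in> W" "restrict w {..<1} = \<tau>" for w \<tau>
  proof -
    obtain \<tau>' x y where w: "\<tau>' \<in> cart 1" "x \<in> cart m" "y \<in> cart m"
      "\<forall>i<N. w i = join 1 \<tau>' (join m x y) i" "ok \<tau>' x y" "w \<in> cart N"
      using \<open>w \<in> W\<close> unfolding W_def by blast
    then have "w = join 1 \<tau>' (join m x y)"
      using jN by (intro cart_eqI[of _ N]) auto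
    moreover from this have "\<tau>' = \<tau>"
      using \<open>restrict w {..<1} = \<tau>\<close> w(1) by (intro cart_eqI[of _ 1]) (auto simp: join_def)
    ultimately show ?thesis using w(5) by blast
  qed
  have "(\<lambda>z. restrict z {..<1}) ` W = T"
  proof (intro equalityI subsetI)
    fix \<tau> assume "\<tau> \<in> (\<lambda>z. restrict z {..<1}) ` W"
    then obtain w where w: "w \<in> W" "restrict w {..<1} = \<tau>" by blast
    then show "\<tau> \<in> T" using Wd[OF w] w(2)[symmetric] by (auto simp: T_def ok_def simp del: restrict_apply)
  next
    fix \<tau> assume \<tau>: "\<tau> \<in> T"
    then have \<tau>c: "\<tau> \<in> cart 1" "0 < \<tau> 0" by (auto simp: T_def)
    then obtain x y where "ok \<tau> x y" using near[of "\<tau> 0" "\<tau> 0"] by (auto simp: ok_def)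
    moreover have "restrict (join 1 \<tau> (join m x y)) {..<1} = \<tau>"
      using \<tau>c(1) by (intro cart_eqI[of _ 1]) (auto simp: join_def)
    ultimately show "\<tau> \<in> (\<lambda>z. restrict z {..<1}) ` W" using Wj[OF \<tau>c(1)] by (metis imageI)
  qed
  moreover have "\<And>m n X Y. definable M m X \<Longrightarrow> definable M (m + n) Y \<Longrightarrow> (\<lambda>z. restrict z {..<m}) ` Y = X \<Longrightarrow>
      (\<exists>\<phi>. definable_map M m X (m + n) Y \<phi> \<and> (\<forall>x\<in>X. restrict (\<phi> x) {..<m} = x))"
    using choice unfolding definable_choice_def by blast
  ultimately obtain \<phi> where \<phi>: "definable_map M 1 T N W \<phi>" "\<And>\<tau>. \<tau> \<in> T \<Longrightarrow> restrict (\<phi> \<tau>) {..<1} = \<tau>"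
    using T W unfolding N_def by metis
  have "\<exists>x y. \<phi> \<tau> = join 1 \<tau> (join m x y) \<and> ok \<tau> x y" if "\<tau> \<in> T" for \<tau>
    using Wd[OF _ \<phi>(2)[OF that]] \<phi>(1) that by (auto simp: definable_map_def)
  then obtain xx yy where xy: "\<And>\<tau>. \<tau> \<in> T \<Longrightarrow> \<phi> \<tau> = join 1 \<tau> (join m (xx \<tau>) (yy \<tau>))"
    "\<And>\<tau>. \<tau> \<in> T \<Longrightarrow> ok \<tau> (xx \<tau>) (yy \<tau>)" by metis
  have xyc: "xx \<tau> \<in> cart m" "yy \<tau> \<in> cart m" if "\<tau> \<in> T" for \<tau>
    using xy(2)[OF that] R_X X_cart by (auto simp: ok_def)
  define graph where "graph = (\<lambda>\<tau>. join 1 \<tau> (\<phi> \<tau>)) ` T"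
  have graph: "definable M (1 + N) graph" using \<phi>(1) by (simp add: definable_map_def graph_def)
  \<comment> \<open>The chosen \<phi> is a section, so its value begins with its argument, which
    thus occurs twice in a point of the graph. \<open>G\<close> makes both components of the choice
    available to the calculus.\<close>
  define G where "G \<tau> x y \<longleftrightarrow> join 1 \<tau> (join 1 \<tau> (join m x y)) \<in> graph" for \<tau> x y
  have G_iff: "G \<tau> x y \<longleftrightarrow> \<tau> \<in> T \<and> x = xx \<tau> \<and> y = yy \<tau>"
    if c: "\<tau> \<in> cart 1" "x \<in> cart m" "y \<in> cart m" for \<tau> x y
  proof
    assume "G \<tau> x y"
    then obtain \<sigma> where \<sigma>: "\<sigma> \<in> T" "join 1 \<tau> (join 1 \<tau> (join m x y)) = join 1 \<sigma> (\<phi> \<sigma>)"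
      by (auto simp: G_def graph_def)
    have "\<sigma> \<in> cart 1" using \<sigma>(1) by (simp add: T_def)
    note eq = join_inj[OF \<sigma>(2) c(1) this]
    have "join 1 \<tau> (join m x y) = join 1 \<tau> (join m (xx \<tau>) (yy \<tau>))"
      using eq xy(1)[OF \<sigma>(1)] by simp
    from join_inj(2)[OF this c(1) c(1)] have "join m x y = join m (xx \<tau>) (yy \<tau>)" .
    from join_inj[OF this c(2)] show "\<tau> \<in> T \<and> x = xx \<tau> \<and> y = yy \<tau>"
      using xyc(1)[OF \<sigma>(1)] eq \<sigma>(1) by auto
  next
    assume "\<tau> \<in> T \<and> x = xx \<tau> \<and> y = yy \<tau>"
    then show "G \<tau> x y" using xy(1)[of \<tau>] by (auto simp: G_def graph_def intro!: image_eqI[of _ _ \<tau>])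
  qed
  have dG: "dpred M (\<lambda>E. G (restrict (E a) {..<1}) (restrict (E b) {..<m}) (restrict (E c) {..<m}))" for a b c
    unfolding G_def
  proof (rule dpred_mem_dtup[OF graph])
    show "dtup M (1 + N) (\<lambda>E. join 1 (restrict (E a) {..<1}) (join 1 (restrict (E a) {..<1})
       (join m (restrict (E b) {..<m}) (restrict (E c) {..<m}))))"
      unfolding N_def by (intro dtup_join dtup_restrict)
  qed (auto simp: N_def intro!: join_in_cart)
  have t1: "tuple1 t \<in> cart 1" "tuple1 t 0 = t" for t :: 'a by (auto simp: tuple1_def cart_def)
  have t1': "\<tau> = tuple1 (\<tau> 0)" if "\<tau> \<in> cart 1" for \<tau> :: "nat \<Rightarrow> 'a"
    using that by (intro cart_eqI[of _ 1]) (auto simp: t1)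
  define \<gamma> where "\<gamma> t = xx (tuple1 t)" for t
  define curve_graph where "curve_graph D = (\<lambda>\<tau>. join 1 \<tau> (\<gamma> (\<tau> 0))) ` tuple1 ` D" for D
  have TD: "tuple1 ` D \<subseteq> T" if "D \<in> \<DD>" for D
    using pf_pos that by (force simp: T_def t1)
  obtain D0 where D0: "D0 \<in> \<DD>" using pf_ne by blast
  have dT: "definable M 1 (tuple1 ` D)" if "D \<in> \<DD>" for D
    using pf_pos that by (auto simp: definable1_def)
  have "definable_curve M D0 m \<gamma>"
    unfolding definable_curve_def definable_map_def
  proof (intro conjI)
    show "definable M 1 (tuple1 ` D0)" by (rule dT[OF D0])
    show "(\<lambda>x. \<gamma> (x 0)) ` tuple1 ` D0 \<subseteq> cart m"
      using xyc(1) TD[OF D0] by (auto simp: \<gamma>_def t1)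
    have mem: "w \<in> (\<lambda>x. join 1 x (\<gamma> (x 0))) ` tuple1 ` D0 \<longleftrightarrow>
      (\<exists>\<tau>\<in>tuple1 ` D0. \<exists>x\<in>cart m. \<exists>y\<in>cart m. (\<forall>i<1 + m. w i = join 1 \<tau> x i) \<and> G \<tau> x y)"
      (is "?l \<longleftrightarrow> ?r") if "w \<in> cart (1 + m)" for w
    proof
      assume ?l
      then obtain t where t: "t \<in> D0" "w = join 1 (tuple1 t) (\<gamma> t)" by (auto simp: t1)
      then have "tuple1 t \<in> T" using TD[OF D0] by blast
      then have "G (tuple1 t) (xx (tuple1 t)) (yy (tuple1 t))" "xx (tuple1 t) \<in> cart m" "yy (tuple1 t) \<in> cart m"
        using G_iff[OF t1(1)] xyc by blast+
      then show ?r using t unfolding \<gamma>_def by blast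
    next
      assume ?r
      then obtain t x y where r: "t \<in> D0" "x \<in> cart m" "y \<in> cart m"
        "\<forall>i<1 + m. w i = join 1 (tuple1 t) x i" "G (tuple1 t) x y" by blast
      have "w = join 1 (tuple1 t) x"
        by (rule cart_eqI[OF that join_in_cart[OF t1(1) r(2)]]) (use r(4) in blast)
      moreover have "x = \<gamma> (tuple1 t 0)" using G_iff[OF t1(1) r(2,3)] r(5) by (simp add: \<gamma>_def t1)
      ultimately show ?l using r(1) by blast
    qed
    have "dterm M (\<lambda>E. join 1 (restrict (E a) {..<1}) (restrict (E b) {..<m}) i)" if "i < 1 + m" for a b i
      by (rule dtupD[OF dtup_join[OF dtup_restrict dtup_restrict] that])
    note dd = this
    have "dpred M (\<lambda>E. \<exists>\<tau>\<in>tuple1 ` D0. \<exists>x\<in>cart m. \<exists>y\<in>cart m.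
        (\<forall>i<1 + m. restrict (E 0) {..<1 + m} i = join 1 \<tau> x i) \<and> G \<tau> x y)"
      by (rule dfb dT[OF D0] dG dpred_all_less dd | assumption)+
    then show "definable M (1 + m) ((\<lambda>x. join 1 x (\<gamma> (x 0))) ` tuple1 ` D0)"
      unfolding definable_iff_dpred using mem[OF restrict_in_cart] 
      by (auto intro!: join_in_cart simp: t1 \<gamma>_def simp del: restrict_apply intro: xyc(1)[OF subsetD[OF TD[OF D0]]])
  qed (rule definable_cart)
  \<comment> \<open>Continuity is asked of the first component only; the partners \<open>yy\<close>
    are controlled by properness of \<open>R\<close>, applied to the compact set \<open>K\<close>
    below.\<close>
  then obtain D where D: "D \<in> \<DD>" "continuous_map (top_of_set D) (cart_top m) \<gamma>"
    using pf_continuous[OF D0] by blast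
  have t1T: "tuple1 t \<in> T" if "t \<in> D" for t using TD[OF D(1)] that by blast
  define K where "K = insert x0 (\<gamma> ` D)"
  have "definably_compact M m K"
    unfolding K_def
  proof (rule compact_curve[OF D(1) _ _ D(2) _ x0c])
    show "\<gamma> ` D \<subseteq> cart m" using xyc(1) t1T by (auto simp: \<gamma>_def)
    show "l1 m x0 (\<gamma> t) < t" if "t \<in> D" for t
      using xy(2)[OF t1T[OF that]] by (simp add: ok_def \<gamma>_def t1)
    have "(\<exists>\<tau>\<in>tuple1 ` D. \<exists>x\<in>cart m. \<exists>y\<in>cart m. \<tau> 0 = a \<and> (\<forall>i<m. b i = x i) \<and> G \<tau> x y) \<longleftrightarrow>
       a \<in> D \<and> (\<forall>i<m. b i = \<gamma> a i)" (is "?l \<longleftrightarrow> ?r") for a b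
    proof
      assume ?l
      then show ?r using G_iff[OF t1(1)] by (auto simp: t1 \<gamma>_def)
    next
      assume r: ?r
      then have "G (tuple1 a) (xx (tuple1 a)) (yy (tuple1 a))" "xx (tuple1 a) \<in> cart m" "yy (tuple1 a) \<in> cart m"
        using G_iff[OF t1(1)] xyc t1T by blast+
      then show ?l using r t1(2) unfolding \<gamma>_def by blast
    qed
    moreover have "dpred M (\<lambda>E. \<exists>\<tau>\<in>tuple1 ` D. \<exists>x\<in>cart m. \<exists>y\<in>cart m.
        \<tau> 0 = E 0 0 \<and> (\<forall>i<m. E 1 i = x i) \<and> G \<tau> x y)"
      by (rule dfb dT[OF D(1)] dG dpred_all_less | assumption)+
    ultimately show "dpred M (\<lambda>E. E 0 0 \<in> D \<and> (\<forall>i<m. E 1 i = \<gamma> (E 0 0) i))" by simp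
  qed
  moreover have "K \<subseteq> X"
    using xy(2)[OF t1T] R_X x0 by (auto simp: K_def \<gamma>_def ok_def)
  ultimately have L: "definably_compact M (m + m) {z \<in> pair_set m R. restrict z {..<m} \<in> K}" (is "definably_compact _ _ ?L")
    using proper unfolding equiv_definably_proper_over_def definably_proper_def by blast
  have jm: "restrict (join m x y) {..<m} = x" if "x \<in> cart m" for x y :: "nat \<Rightarrow> 'a"
    using that by (intro cart_eqI[of _ m]) (auto simp: join_def)
  have inL: "join m (xx (tuple1 t)) (yy (tuple1 t)) \<in> ?L" if "t \<in> D" for t
  proof -
    have "(xx (tuple1 t), yy (tuple1 t)) \<in> R" using xy(2)[OF t1T[OF that]] by (simp add: ok_def)
    then have "join m (xx (tuple1 t)) (yy (tuple1 t)) \<in> pair_set m R" unfolding pair_set_def by force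
    moreover have "xx (tuple1 t) \<in> K" using that by (auto simp: K_def \<gamma>_def)
    ultimately show ?thesis using jm xyc(1)[OF t1T[OF that]] by simp
  qed
  \<comment> \<open>The chosen pairs with parameter below \<open>s\<close>. They all lie in the
    definably compact set \<open>?L\<close>, which provides a cluster point and contains it.\<close>
  define U where "U s = {z \<in> cart (m + m). \<exists>\<tau>\<in>tuple1 ` D. \<exists>x\<in>cart m. \<exists>y\<in>cart m.
      \<tau> 0 < s \<and> (\<forall>i<m + m. z i = join m x y i) \<and> G \<tau> x y}" for s
  have Ud: "\<exists>t\<in>D. t < s \<and> z = join m (xx (tuple1 t)) (yy (tuple1 t))" if z: "z \<in> U s" for z s
  proof -
    obtain t x y where r: "t \<in> D" "x \<in> cart m" "y \<in> cart m" "t < s"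
      "\<forall>i<m + m. z i = join m x y i" "G (tuple1 t) x y" "z \<in> cart (m + m)"
      using z t1 unfolding U_def by auto
    have "z = join m x y"
      by (rule cart_eqI[OF r(7) join_in_cart[OF r(2,3)]]) (use r(5) in blast)
    then show ?thesis using G_iff[OF t1(1) r(2,3)] r(1,4,6) by auto
  qed
  have Ui: "join m (xx (tuple1 t)) (yy (tuple1 t)) \<in> U s" if "t \<in> D" "t < s" for t s
  proof -
    have "G (tuple1 t) (xx (tuple1 t)) (yy (tuple1 t))" "xx (tuple1 t) \<in> cart m" "yy (tuple1 t) \<in> cart m"
        using G_iff[OF t1(1)] xyc t1T that(1) by blast+
    note this [simp]
    show ?thesis unfolding U_def
      by (rule CollectI, rule conjI, rule join_in_cart, simp, simp, rule bexI[of _ "tuple1 t"],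
          rule bexI[of _ "xx (tuple1 t)"], rule bexI[of _ "yy (tuple1 t)"])
        (use that in \<open>auto simp: t1\<close>)
  qed
  have dU: "dfam M (m + m) (cart (m + m)) U"
  proof (rule dfamI)
    have dd: "dterm M (\<lambda>E. join m (restrict (E a) {..<m}) (restrict (E b) {..<m}) i)" if "i < m + m" for a b i
      by (rule dtupD[OF dtup_join[OF dtup_restrict dtup_restrict] that])
    have "dpred M (\<lambda>E. \<exists>\<tau>\<in>tuple1 ` D. \<exists>x\<in>cart m. \<exists>y\<in>cart m.
      \<tau> 0 < E 1 0 \<and> (\<forall>i<m + m. restrict (E 0) {..<m + m} i = join m x y i) \<and> G \<tau> x y)"
      by (rule dfb dT[OF D(1)] dG dpred_all_less dd | assumption)+
    then show "dpred M (\<lambda>E. restrict (E 0) {..<m + m} \<in> U (E 1 0))" 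
      unfolding U_def mem_Collect_eq using restrict_in_cart by (simp del: restrict_apply)
    show "U s \<subseteq> U t" if "s \<le> t" for s t
      unfolding U_def using that by (auto intro: less_le_trans)
  qed (auto simp: U_def)
  have "U s \<noteq> {}" if s: "0 < s" for s
  proof -
    have "0 \<in> closure D" using pf_pos D(1) by blast
    then obtain t where "t \<in> D" "\<bar>0 - t\<bar> < s" unfolding in_closure_iff using s by blast
    then have "t \<in> D" "t < s" by auto
    then show ?thesis using Ui by blast
  qed
  moreover obtain a b where ab: "\<And>z i. z \<in> ?L \<Longrightarrow> i < m + m \<Longrightarrow> a i \<le> z i \<and> z i \<le> b i"
    using L unfolding definably_compact_def bounded_cart_def by blast
  define B where "B = (\<Sum>i<m + m. \<bar>a i\<bar> + \<bar>b i\<bar>)"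
  have "\<bar>z i\<bar> \<le> B" if "z \<in> U 1" "i < m + m" for z i
  proof -
    have "z \<in> ?L" using Ud[OF that(1)] inL by blast
    then have "\<bar>z i\<bar> \<le> \<bar>a i\<bar> + \<bar>b i\<bar>" using ab[of z i] that(2) by linarith
    also have "\<dots> \<le> B" unfolding B_def using that(2) by (intro member_le_sum) auto
    finally show ?thesis .
  qed
  ultimately obtain p where p: "p \<in> cart (m + m)" "clus (m + m) U p" using ex_clus[OF dU] by blast
  have "p \<in> ?L"
  proof -
    have "\<exists>y\<in>?L. l1 (m + m) p y < \<epsilon>" if "0 < \<epsilon>" for \<epsilon>
      using clusD[OF p(2) that zero_less_one] Ud inL by blast
    then show ?thesis using L p(1) unfolding definably_compact_def closedin_cart_top by blast
  qed
  then obtain x y where xy0: "p = join m x y" "(x, y) \<in> R" by (auto elim: pair_set_memD)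
  have near_p: "\<exists>t\<in>D. t < s \<and> l1 m x (xx (tuple1 t)) < \<epsilon> \<and> l1 m y (yy (tuple1 t)) < \<epsilon>"
    if pos: "0 < \<epsilon>" "0 < s" for \<epsilon> s
  proof -
    obtain z where z: "z \<in> U s" "l1 (m + m) p z < \<epsilon>" using clusD[OF p(2) pos] by blast
    then obtain t where t: "t \<in> D" "t < s" "z = join m (xx (tuple1 t)) (yy (tuple1 t))" using Ud by blast
    have "l1 m x (xx (tuple1 t)) + l1 m y (yy (tuple1 t)) < \<epsilon>"
      using z(2) t(3) by (simp add: xy0(1) l1_join)
    then have "l1 m x (xx (tuple1 t)) < \<epsilon>" "l1 m y (yy (tuple1 t)) < \<epsilon>"
      using l1_nonneg[of m x "xx (tuple1 t)"] l1_nonneg[of m y "yy (tuple1 t)"] by linarith+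
    then show ?thesis using t by blast
  qed
  \<comment> \<open>Small parameters force the first components towards \<open>x0\<close>, so the
    cluster pair lies over \<open>x0\<close>; its second component then clusters in
    \<open>Z\<close>.\<close>
  have "l1 m x x0 < \<epsilon>" if \<epsilon>: "0 < \<epsilon>" for \<epsilon>
  proof -
    obtain t where t: "t \<in> D" "t < \<epsilon> / 2" "l1 m x (xx (tuple1 t)) < \<epsilon> / 2"
      using near_p[OF half_gt_zero[OF \<epsilon>] half_gt_zero[OF \<epsilon>]] by blast
    have "l1 m x0 (xx (tuple1 t)) < t" using xy(2)[OF t1T[OF t(1)]] by (simp add: ok_def t1)
    then show ?thesis
      using t l1_triangle[of m x x0 "xx (tuple1 t)"] l1_commute[of m x0 "xx (tuple1 t)"] by linarith
  qed
  then have "x = x0" using xy0(2) R_X X_cart x0c by (intro eq_if_l1_small[of x m x0]) auto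
  moreover have "clus m Z y"
    unfolding clus_def
  proof (intro allI impI)
    fix \<epsilon> s :: 'a assume "0 < \<epsilon>" "0 < s"
    then obtain t where t: "t \<in> D" "t < s" "l1 m y (yy (tuple1 t)) < \<epsilon>" using near_p by blast
    then have "yy (tuple1 t) \<in> Z t" "0 < t" using xy(2)[OF t1T[OF t(1)]] by (auto simp: ok_def t1)
    then show "\<exists>y'\<in>Z s. l1 m y y' < \<epsilon>" using dfam_mono[OF Z, of t s] t by auto
  qed
  ultimately show ?thesis using xy0(2) by blast
qed

end

section \<open>Quotient maps described by lifting of cluster points\<close>

text \<open>Only cluster points inside the image are lifted. This matches properness onto the image,
  which concerns compact sets contained in it.\<close>

definition lifts_clus ::
  "('a::linordered_field, 'f, 'r) fo_struct \<Rightarrow> nat \<Rightarrow> nat \<Rightarrow> (nat \<Rightarrow> 'a) set \<Rightarrow> ((nat \<Rightarrow> 'a) \<Rightarrow> nat \<Rightarrow> 'a) \<Rightarrow> bool"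
  where
  "lifts_clus M m n A f \<longleftrightarrow> (\<forall>Z b. dfam M m A Z \<longrightarrow> b \<in> f ` A \<longrightarrow> clus n (\<lambda>t. f ` Z t) b \<longrightarrow>
     (\<exists>a\<in>A. clus m Z a \<and> f a = b))"

text \<open>The condition \<open>lifts_clus\<close> stands in for definable properness: it implies it, and it is
  stable under the constructions below without any further use of the pseudo-filter.\<close>

definition dquot ::
  "('a::linordered_field, 'f, 'r) fo_struct \<Rightarrow> nat \<Rightarrow> nat \<Rightarrow> (nat \<Rightarrow> 'a) set \<Rightarrow>
   ((nat \<Rightarrow> 'a) \<times> (nat \<Rightarrow> 'a)) set \<Rightarrow> ((nat \<Rightarrow> 'a) \<Rightarrow> nat \<Rightarrow> 'a) \<Rightarrow> bool" where
  "dquot M m n A R f \<longleftrightarrow> dfun M m n f \<and> (\<forall>x. f x \<in> cart n) \<and> l1_cont m n A f \<and>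
     (\<forall>x\<in>A. \<forall>y\<in>A. f x = f y \<longleftrightarrow> (x, y) \<in> R) \<and> lifts_clus M m n A f"

definition rel_closed :: "nat \<Rightarrow> (nat \<Rightarrow> 'a::linordered_field) set \<Rightarrow> (nat \<Rightarrow> 'a) set \<Rightarrow> bool" where
  "rel_closed m X A \<longleftrightarrow> A \<subseteq> X \<and> (\<forall>x\<in>X. (\<forall>\<epsilon>>0. \<exists>a\<in>A. l1 m x a < \<epsilon>) \<longrightarrow> x \<in> A)"

lemma dquotD:
  assumes "dquot M m n A R f"
  shows "dfun M m n f" "\<And>x. f x \<in> cart n" "l1_cont m n A f"
    "\<And>x y. x \<in> A \<Longrightarrow> y \<in> A \<Longrightarrow> f x = f y \<longleftrightarrow> (x, y) \<in> R" "lifts_clus M m n A f"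
  using assms unfolding dquot_def by blast+

lemma lifts_clusD:
  assumes "lifts_clus M m n A f" "dfam M m A Z" "b \<in> f ` A" "clus n (\<lambda>t. f ` Z t) b"
  obtains a where "a \<in> A" "clus m Z a" "f a = b"
  using assms unfolding lifts_clus_def by meson

lemma clus_rel_closed:
  assumes "rel_closed m X A" "dfam M m A Z" "clus m Z x" "x \<in> X"
  shows "x \<in> A"
proof -
  have "\<exists>a\<in>A. l1 m x a < \<epsilon>" if "0 < \<epsilon>" for \<epsilon>
    using clusD[OF assms(3) that zero_less_one] dfam_subset[OF assms(2) zero_less_one] by blast
  then show ?thesis using assms(1,4) by (simp add: rel_closed_def)
qed

text \<open>The Tietze extension requires values between positive bounds; \<open>squash\<close> is a homeomorphism
  of the field onto the open interval from 1 to 2.\<close>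

definition squash :: "'a::linordered_field \<Rightarrow> 'a" where
  "squash u = 3 / 2 + u / (1 + \<bar>u\<bar>) / 2"

lemma squash_bounds: "1 \<le> squash u" "squash u \<le> 2"
proof -
  define w where "w = u / (1 + \<bar>u\<bar>)"
  have "0 < 1 + \<bar>u\<bar>" by (simp add: add_pos_nonneg)
  moreover have "-1 - \<bar>u\<bar> \<le> u" "u \<le> 1 + \<bar>u\<bar>" by linarith+
  ultimately have w: "- 1 \<le> w" "w \<le> 1" by (simp_all add: w_def field_simps)
  have "squash u = (3 + w) / 2" by (simp add: squash_def w_def add_divide_distrib)
  then show "1 \<le> squash u" "squash u \<le> 2" using w by simp_all
qed

lemma squash_lipschitz: "\<bar>squash u - squash v\<bar> \<le> \<bar>u - v\<bar>"
proof -
  define a b where "a = 1 + \<bar>u\<bar>" and "b = 1 + \<bar>v\<bar>"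
  have pos: "1 \<le> a" "1 \<le> b" by (auto simp: a_def b_def)
  then have pos': "0 < a" "0 < b" by linarith+
  \<comment> \<open>Every summand contains a difference of size at most
    \<open>\<bar>u - v\<bar>\<close>, and the coefficients add up to at most \<open>2 * a\<close>.
    Dividing by \<open>a * b\<close> and by the 2 in \<open>squash\<close> leaves the constant
    1.\<close>
  have "u * b - v * a = (u - v) + u * (\<bar>v\<bar> - \<bar>u\<bar>) + \<bar>u\<bar> * (u - v)"
    by (simp add: a_def b_def algebra_simps)
  then have "\<bar>u * b - v * a\<bar> \<le> \<bar>u - v\<bar> + \<bar>u * (\<bar>v\<bar> - \<bar>u\<bar>)\<bar> + \<bar>\<bar>u\<bar> * (u - v)\<bar>" by linarith
  also have "\<dots> \<le> \<bar>u - v\<bar> + \<bar>u\<bar> * \<bar>u - v\<bar> + \<bar>u\<bar> * \<bar>u - v\<bar>"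
    unfolding abs_mult abs_abs by (intro add_mono mult_left_mono) auto
  also have "\<dots> \<le> 2 * a * \<bar>u - v\<bar>"
    by (simp add: a_def algebra_simps)
  also have "\<dots> \<le> 2 * (a * b) * \<bar>u - v\<bar>"
    using pos pos' by (intro mult_right_mono mult_left_mono) auto
  finally have "\<bar>u * b - v * a\<bar> / (a * b) \<le> 2 * \<bar>u - v\<bar>"
    using pos' by (simp add: field_simps)
  moreover have "u / a - v / b = (u * b - v * a) / (a * b)"
    using pos' by (simp add: field_simps)
  ultimately have "\<bar>u / a - v / b\<bar> \<le> 2 * \<bar>u - v\<bar>"
    using pos' by (simp add: abs_mult)
  moreover have "squash u - squash v = (u / a - v / b) / 2"
    by (simp add: squash_def a_def b_def diff_divide_distrib)
  moreover from this have "\<bar>squash u - squash v\<bar> = \<bar>u / a - v / b\<bar> / 2"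
    by (simp only: abs_divide abs_numeral)
  ultimately show ?thesis by simp
qed

lemma squash_inverse_continuous:
  assumes "0 < \<epsilon>"
  shows "\<exists>\<delta>>0. \<forall>u. \<bar>squash v - squash u\<bar> < \<delta> \<longrightarrow> \<bar>v - u\<bar> < \<epsilon>"
proof -
  define W where "W x = x / (1 + \<bar>x\<bar>)" for x :: 'a
  have W1: "1 - \<bar>W x\<bar> = 1 / (1 + \<bar>x\<bar>)" and Wx: "x = W x / (1 - \<bar>W x\<bar>)" for x
  proof -
    have "0 < 1 + \<bar>x\<bar>" by (simp add: add_pos_nonneg)
    then show *: "1 - \<bar>W x\<bar> = 1 / (1 + \<bar>x\<bar>)" by (simp add: W_def abs_divide field_simps)
    show "x = W x / (1 - \<bar>W x\<bar>)" unfolding * using \<open>0 < 1 + \<bar>x\<bar>\<close> by (simp add: W_def)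
  qed
  define c where "c = 1 - \<bar>W v\<bar>"
  have c: "0 < c" unfolding c_def W1 by (simp add: add_pos_nonneg)
  \<comment> \<open>With \<open>W\<close> twice as steep as \<open>squash\<close>, the bound
    \<open>c / 4\<close> yields \<open>d > c / 2\<close>, and
    \<open>\<epsilon> * c\<^sup>2 / 12\<close> keeps \<open>3 * \<bar>W v - W u\<bar>\<close> below
    \<open>\<epsilon> * c * d\<close>, the size of the numerator that is allowed for
    \<open>v - u\<close>.\<close>
  define \<delta> where "\<delta> = min (c / 4) (\<epsilon> * c\<^sup>2 / 12)"
  have "0 < \<delta>" using c assms by (simp add: \<delta>_def)
  moreover have "\<bar>v - u\<bar> < \<epsilon>" if "\<bar>squash v - squash u\<bar> < \<delta>" for u
  proof -
    define d where "d = 1 - \<bar>W u\<bar>"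
    have "squash v - squash u = (W v - W u) / 2"
      by (simp add: squash_def W_def diff_divide_distrib)
    then have "\<bar>squash v - squash u\<bar> = \<bar>W v - W u\<bar> / 2" by (simp only: abs_divide abs_numeral)
    then have w: "\<bar>W v - W u\<bar> < c / 2" "\<bar>W v - W u\<bar> < \<epsilon> * c\<^sup>2 / 6"
      using that by (simp_all add: \<delta>_def)
    have "2 * \<bar>W v - W u\<bar> < c" using w(1) by simp
    have "2 * \<bar>W u\<bar> \<le> 2 * (\<bar>W v\<bar> + \<bar>W v - W u\<bar>)"
      using abs_triangle_ineq4[of "W v" "W v - W u"] by simp
    also have "\<dots> < 2 * \<bar>W v\<bar> + c" using \<open>2 * \<bar>W v - W u\<bar> < c\<close> by (simp add: distrib_left)
    finally have "c < 2 * d" unfolding c_def d_def by (simp add: algebra_simps)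
    then have d: "c / 2 < d" by simp
    then have d0: "0 < d" using c by linarith
    have "W v * d - W u * c = (W v - W u) + W v * (\<bar>W v\<bar> - \<bar>W u\<bar>) - \<bar>W v\<bar> * (W v - W u)"
      by (simp add: c_def d_def algebra_simps)
    then have "\<bar>W v * d - W u * c\<bar> \<le> \<bar>W v - W u\<bar> + \<bar>W v * (\<bar>W v\<bar> - \<bar>W u\<bar>)\<bar> + \<bar>\<bar>W v\<bar> * (W v - W u)\<bar>"
      by linarith
    also have "\<dots> \<le> \<bar>W v - W u\<bar> + 1 * \<bar>W v - W u\<bar> + 1 * \<bar>W v - W u\<bar>"
      unfolding abs_mult abs_abs using c by (intro add_mono mult_mono) (auto simp: c_def)
    finally have "\<bar>W v * d - W u * c\<bar> \<le> 3 * \<bar>W v - W u\<bar>" by simp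
    also have "\<dots> < \<epsilon> * c * (c / 2)" using w(2) by (simp add: power2_eq_square)
    also have "\<dots> < \<epsilon> * c * d" using d c assms by simp
    finally have "\<bar>W v * d - W u * c\<bar> / (c * d) < \<epsilon>" using c d0 by (simp add: field_simps)
    moreover have "v - u = (W v * d - W u * c) / (c * d)"
      using Wx[of v] Wx[of u] c d0 unfolding c_def[symmetric] d_def[symmetric] by (simp add: field_simps)
    ultimately show ?thesis using c d0 by (simp add: abs_divide abs_mult)
  qed
  ultimately show ?thesis by blast
qed

lemma squash_inj: "squash u = squash v \<Longrightarrow> u = v"
  using squash_inverse_continuous[of "\<bar>u - v\<bar>" u]
  by (metis abs_zero diff_self less_irrefl zero_less_abs_iff right_minus_eq)

lemma dtup_lambda: "(\<And>i. i < n \<Longrightarrow> dterm M (t i)) \<Longrightarrow> dtup M n (\<lambda>E. \<lambda>i\<in>{..<n}. t i E)"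
  by (simp add: dtup_def)

context definably_complete_field
begin

lemma dterm_squash: "dterm M t \<Longrightarrow> dterm M (\<lambda>E. squash (t E))"
  unfolding squash_def by (rule dfb | assumption)+

text \<open>Continuity passes forwards by the Lipschitz bound. Cluster points pass backwards because
  the inverse is continuous at each single point, which suffices since the target of a lift is
  fixed.\<close>

lemma dquot_squash:
  assumes f: "dquot M m n A R f"
  shows "dquot M m n A R (\<lambda>x. \<lambda>i\<in>{..<n}. squash (f x i))" (is "dquot M m n A R ?g")
proof -
  note fD = dquotD[OF f]
  have g: "?g x i = squash (f x i)" if "i < n" for x i using that by simp
  have inv: "\<exists>\<delta>>0. \<forall>y. l1 n (?g x) (?g y) < \<delta> \<longrightarrow> l1 n (f x) (f y) < \<epsilon>" if \<epsilon>: "0 < \<epsilon>" for x \<epsilon>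
  proof -
    have "0 < \<epsilon> / (of_nat n + 1)" using \<epsilon> by (simp add: add_nonneg_pos)
    then have "\<forall>i. \<exists>\<delta>>0. \<forall>u. \<bar>squash (f x i) - squash u\<bar> < \<delta> \<longrightarrow> \<bar>f x i - u\<bar> < \<epsilon> / (of_nat n + 1)"
      using squash_inverse_continuous by blast
    then obtain d where d: "\<And>i. 0 < d i"
      "\<And>i u. \<bar>squash (f x i) - squash u\<bar> < d i \<Longrightarrow> \<bar>f x i - u\<bar> < \<epsilon> / (of_nat n + 1)"
      by metis
    define \<delta> where "\<delta> = Min (insert 1 (d ` {..<n}))"
    have "0 < \<delta>" using d(1) by (auto simp: \<delta>_def)
    moreover have "l1 n (f x) (f y) < \<epsilon>" if y: "l1 n (?g x) (?g y) < \<delta>" for y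
    proof (rule l1_less[OF _ \<epsilon>])
      fix i assume i: "i < n"
      have "\<bar>squash (f x i) - squash (f y i)\<bar> < \<delta>"
        using abs_le_l1[OF i, of "?g x" "?g y"] y i by simp
      also have "\<delta> \<le> d i" using i by (simp add: \<delta>_def)
      finally show "\<bar>f x i - f y i\<bar> < \<epsilon> / (of_nat n + 1)" by (rule d(2))
    qed
    ultimately show ?thesis by blast
  qed
  have le: "l1 n (?g x) (?g y) \<le> l1 n (f x) (f y)" for x y
    unfolding l1_def by (intro sum_mono) (simp add: squash_lipschitz)
  have inj: "?g x = ?g y \<longleftrightarrow> f x = f y" for x y
  proof
    assume eq: "?g x = ?g y"
    have "f x i = f y i" if "i < n" for i
      using fun_cong[OF eq, of i] that by (auto dest: squash_inj)
    then show "f x = f y" by (rule cart_eqI[OF fD(2) fD(2)])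
  qed simp
  show ?thesis
    unfolding dquot_def
  proof (intro conjI allI)
    show "dfun M m n ?g"
      unfolding dfun_def by (intro dtup_lambda dterm_squash dterm_dfun[OF fD(1)])
    show "l1_cont m n A ?g"
      using fD(3) le unfolding l1_cont_def by (meson le_less_trans)
    show "\<forall>x\<in>A. \<forall>y\<in>A. ?g x = ?g y \<longleftrightarrow> (x, y) \<in> R"
      unfolding inj using fD(4) by blast
    show "lifts_clus M m n A ?g"
      unfolding lifts_clus_def
    proof (intro allI impI)
      fix Z b assume Z: "dfam M m A Z" and b: "b \<in> ?g ` A" and cl: "clus n (\<lambda>t. ?g ` Z t) b"
      obtain a where a: "a \<in> A" "b = ?g a" using b by blast
      have "clus n (\<lambda>t. f ` Z t) (f a)"
        unfolding clus_def
      proof (intro allI impI)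
        fix \<epsilon> t :: 'a assume pos: "0 < \<epsilon>" "0 < t"
        obtain \<delta> where \<delta>: "0 < \<delta>" "\<And>y. l1 n (?g a) (?g y) < \<delta> \<Longrightarrow> l1 n (f a) (f y) < \<epsilon>"
          using inv[OF pos(1), of a] by blast
        then show "\<exists>y\<in>f ` Z t. l1 n (f a) y < \<epsilon>"
          using clusD[OF cl \<delta>(1) pos(2)] a(2) by blast
      qed
      then obtain a' where "a' \<in> A" "clus m Z a'" "f a' = f a"
        using lifts_clusD[OF fD(5) Z imageI[OF a(1)]] by blast
      then show "\<exists>a\<in>A. clus m Z a \<and> ?g a = b" using a(2) by (intro bexI[of _ a']) auto
    qed
  qed simp
qed

subsection \<open>An explicit Tietze extension\<close>

lemma dterm_glb_Collect [dfb]: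
  "dpred M (\<lambda>E. Q (E 0 0) (\<lambda>b. E (Suc b))) \<Longrightarrow> dterm M (\<lambda>E. glb {r. Q r E})"
  using dterm_glb[of "\<lambda>E. {r. Q r E}"] by simp

abbreviation INFI :: "(nat \<Rightarrow> 'a) set \<Rightarrow> ((nat \<Rightarrow> 'a) \<Rightarrow> 'a) \<Rightarrow> 'a" where
  "INFI A \<phi> \<equiv> glb {r. \<exists>a\<in>A. r = \<phi> a}"

lemma INFI:
  assumes "definable M m A" "A \<noteq> {}" "dterm M (\<lambda>E. \<phi> (restrict (E 0) {..<m}))" "\<And>a. a \<in> A \<Longrightarrow> l \<le> \<phi> a"
  shows INFI_le: "\<And>a. a \<in> A \<Longrightarrow> INFI A \<phi> \<le> \<phi> a"
    and INFI_ge: "\<And>c. (\<And>a. a \<in> A \<Longrightarrow> c \<le> \<phi> a) \<Longrightarrow> c \<le> INFI A \<phi>"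
    and INFI_less: "\<And>v. INFI A \<phi> < v \<Longrightarrow> \<exists>a\<in>A. \<phi> a < v"
proof -
  have "dpred M (\<lambda>E. \<exists>a\<in>A. E 0 0 = \<phi> a)"
    by (rule dpred_bex[OF assms(1)] dpred_eq dterm_var assms(3))+
  moreover obtain a0 where "a0 \<in> A" using assms(2) by blast
  ultimately have "is_glb {r. \<exists>a\<in>A. r = \<phi> a} (INFI A \<phi>)"
    using assms(4) by (intro ex_glb[of _ "\<phi> a0" l]) auto
  then show le: "\<And>a. a \<in> A \<Longrightarrow> INFI A \<phi> \<le> \<phi> a"
    and ge: "\<And>c. (\<And>a. a \<in> A \<Longrightarrow> c \<le> \<phi> a) \<Longrightarrow> c \<le> INFI A \<phi>"
    unfolding is_glb_def by blast+
  show "\<exists>a\<in>A. \<phi> a < v" if "INFI A \<phi> < v" for v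
    using ge[of v] that by (meson not_le)
qed

text \<open>The classical metric extension formula for functions with positive bounds. It uses
  infima of definable sets only and hence stays definable. On \<open>A\<close> both infima vanish,
  which is why values there are prescribed.\<close>

definition tietze :: "nat \<Rightarrow> (nat \<Rightarrow> 'a) set \<Rightarrow> ((nat \<Rightarrow> 'a) \<Rightarrow> 'a) \<Rightarrow> (nat \<Rightarrow> 'a) \<Rightarrow> 'a" where
  "tietze m A \<phi> x = (if x \<in> A then \<phi> x
     else INFI A (\<lambda>a. \<phi> a * l1 m x a) / INFI A (\<lambda>a. l1 m x a))"

text \<open>Off \<open>A\<close> this is a quotient of Lipschitz functions with positive
  denominator. At a point of \<open>A\<close>, only nearby values of \<phi> influence the infimum in
  the numerator.\<close>

lemma tietze_continuous:
  assumes A: "definable M m A" "A \<noteq> {}" and Y: "rel_closed m Y A"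
    and \<phi>: "dterm M (\<lambda>E. \<phi> (restrict (E 0) {..<m}))" "\<And>a. a \<in> A \<Longrightarrow> 1 \<le> \<phi> a" "\<And>a. a \<in> A \<Longrightarrow> \<phi> a \<le> 2"
    and cont: "\<And>a \<epsilon>. a \<in> A \<Longrightarrow> 0 < \<epsilon> \<Longrightarrow> \<exists>\<delta>>0. \<forall>b\<in>A. l1 m a b < \<delta> \<longrightarrow> \<bar>\<phi> a - \<phi> b\<bar> < \<epsilon>"
    and x: "x \<in> Y" and \<epsilon>: "0 < \<epsilon>"
  shows "\<exists>\<delta>>0. \<forall>y\<in>Y. l1 m x y < \<delta> \<longrightarrow> \<bar>tietze m A \<phi> x - tietze m A \<phi> y\<bar> < \<epsilon>"
proof -
  define d where "d x = INFI A (\<lambda>a. l1 m x a)" for x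
  define p where "p x = INFI A (\<lambda>a. \<phi> a * l1 m x a)" for x
  have dt: "dterm M (\<lambda>E. l1 m x (restrict (E 0) {..<m}))" for x by (rule dfb)+
  have pt: "dterm M (\<lambda>E. \<phi> (restrict (E 0) {..<m}) * l1 m x (restrict (E 0) {..<m}))" for x
    by (rule dterm_mult \<phi>(1) dt)+
  have pnn: "0 \<le> \<phi> a * l1 m x a" if "a \<in> A" for a x
    using \<phi>(2)[OF that] by (intro mult_nonneg_nonneg) auto
  note d = INFI[OF A dt, of 0, folded d_def, OF l1_nonneg]
  have p1: "p x \<le> \<phi> a * l1 m x a" if "a \<in> A" for a x
    unfolding p_def by (rule INFI_le[OF A pt]) (use pnn that in auto)
  have p2: "c \<le> p x" if "\<And>a. a \<in> A \<Longrightarrow> c \<le> \<phi> a * l1 m x a" for c x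
    unfolding p_def by (rule INFI_ge[OF A pt]) (use pnn that in auto)
  note p = p1 p2
  have d0: "0 \<le> d x" for x by (rule d(2)) auto
  have dlip: "d x \<le> d y + l1 m x y" for x y
  proof -
    have "d x - l1 m x y \<le> d y"
    proof (rule d(2))
      fix a assume "a \<in> A"
      then show "d x - l1 m x y \<le> l1 m y a" using d(1)[of a x] l1_triangle[of m x a y] by linarith
    qed
    then show ?thesis by simp
  qed
  have plip: "p x \<le> p y + 2 * l1 m x y" for x y
  proof -
    have "p x - 2 * l1 m x y \<le> p y"
    proof (rule p(2))
      fix a assume a: "a \<in> A"
      have "p x \<le> \<phi> a * l1 m x a" by (rule p(1)[OF a])
      also have "\<dots> \<le> \<phi> a * (l1 m x y + l1 m y a)"
        using \<phi>(2)[OF a] l1_triangle[of m x a y] by (intro mult_left_mono) auto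
      also have "\<dots> \<le> 2 * l1 m x y + \<phi> a * l1 m y a"
        using mult_right_mono[OF \<phi>(3)[OF a] l1_nonneg[of m x y]] by (simp add: distrib_left)
      finally show "p x - 2 * l1 m x y \<le> \<phi> a * l1 m y a" by simp
    qed
    then show ?thesis by simp
  qed
  have p0: "0 \<le> p x" for x by (rule p(2)) (rule pnn)
  have p2d: "p x \<le> 2 * d x" for x
  proof -
    have "p x / 2 \<le> d x"
    proof (rule d(2))
      fix a assume a: "a \<in> A"
      have "p x \<le> \<phi> a * l1 m x a" by (rule p(1)[OF a])
      also have "\<dots> \<le> 2 * l1 m x a" using \<phi>(3)[OF a] by (intro mult_right_mono) auto
      finally show "p x / 2 \<le> l1 m x a" by simp
    qed
    then show ?thesis by simp
  qed
  have dpos: "0 < d y" if y: "y \<in> Y" "y \<notin> A" for y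
  proof -
    obtain e where "0 < e" "\<And>a. a \<in> A \<Longrightarrow> e \<le> l1 m y a"
      using Y y unfolding rel_closed_def by (meson not_le)
    then show ?thesis using d(2)[of e y] by force
  qed
  have t_in: "tietze m A \<phi> y = \<phi> y" if "y \<in> A" for y using that by (simp add: tietze_def)
  have t_out: "tietze m A \<phi> y = p y / d y" if "y \<notin> A" for y using that by (simp add: tietze_def p_def d_def)
  show ?thesis
  proof (cases "x \<in> A")
    case False
    have dx: "0 < d x" by (rule dpos[OF x False])
    \<comment> \<open>The first bound keeps \<open>d y\<close> above \<open>d x / 2\<close>; the
      second keeps the numerator, at most \<open>4 * \<eta> * d x\<close>, below
      \<open>\<epsilon> * d x * d y\<close>.\<close>
    define \<delta> where "\<delta> = min (d x / 2) (\<epsilon> * d x / 8)"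
    have "0 < \<delta>" using dx \<epsilon> by (simp add: \<delta>_def)
    moreover have "\<bar>tietze m A \<phi> x - tietze m A \<phi> y\<bar> < \<epsilon>" if "y \<in> Y" "l1 m x y < \<delta>" for y
    proof -
      define \<eta> where "\<eta> = l1 m x y"
      have \<eta>: "\<eta> < d x / 2" "8 * \<eta> < \<epsilon> * d x" "0 \<le> \<eta>"
        using that(2) by (simp_all add: \<eta>_def \<delta>_def)
      have "d x \<le> d y + \<eta>" "d y \<le> d x + \<eta>"
        using dlip[of x y] dlip[of y x] l1_commute[of m x y] by (simp_all add: \<eta>_def)
      then have dy: "d x / 2 < d y" "\<bar>d y - d x\<bar> \<le> \<eta>" using \<eta> by linarith+
      then have dy0: "0 < d y" using dx by linarith
      have py: "\<bar>p x - p y\<bar> \<le> 2 * \<eta>"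
        using plip[of x y] plip[of y x] l1_commute[of m x y] unfolding \<eta>_def by linarith
      have "y \<notin> A" using d(1)[of y y] dy0 by auto
      then have "tietze m A \<phi> x - tietze m A \<phi> y = (p x * (d y - d x) + d x * (p x - p y)) / (d x * d y)"
        using False dx dy0 by (simp add: t_out field_simps)
      moreover have "\<bar>p x * (d y - d x) + d x * (p x - p y)\<bar> < \<epsilon> * (d x * d y)"
      proof -
        have "\<bar>p x * (d y - d x) + d x * (p x - p y)\<bar> \<le> \<bar>p x\<bar> * \<bar>d y - d x\<bar> + \<bar>d x\<bar> * \<bar>p x - p y\<bar>"
          unfolding abs_mult[symmetric] by (rule abs_triangle_ineq)
        also have "\<dots> \<le> (2 * d x) * \<eta> + d x * (2 * \<eta>)"
          using p0[of x] p2d[of x] dx dy(2) py \<eta>(3) by (intro add_mono mult_mono) auto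
        also have "\<dots> = d x / 2 * (8 * \<eta>)" by simp
        also have "\<dots> < d x / 2 * (\<epsilon> * d x)" using \<eta>(2) dx by (intro mult_strict_left_mono) auto
        also have "\<dots> = \<epsilon> * d x * (d x / 2)" by simp
        also have "\<dots> < \<epsilon> * d x * d y" using dy(1) dx \<epsilon> by (intro mult_strict_left_mono) auto
        finally show ?thesis by (simp add: mult.assoc)
      qed
      ultimately show ?thesis using dx dy0 by (simp add: abs_divide abs_mult pos_divide_less_eq)
    qed
    ultimately show ?thesis by blast
  next
    case True
    obtain r where r: "0 < r" "\<And>a. a \<in> A \<Longrightarrow> l1 m x a < r \<Longrightarrow> \<bar>\<phi> x - \<phi> a\<bar> < \<epsilon> / 2"
      using cont[OF True half_gt_zero[OF \<epsilon>]] by blast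
    \<comment> \<open>If \<open>a\<close> is at least \<open>r\<close> away from \<open>x\<close>,
      then it is more than \<open>3 * r / 4\<close> away from \<open>y\<close>, whereas
      \<open>2 * d y < r / 2\<close>. As \<phi> lies between 1 and 2, such an \<open>a\<close> does
      not bring the numerator below \<open>c' * d y\<close>.\<close>
    have "\<bar>tietze m A \<phi> x - tietze m A \<phi> y\<bar> < \<epsilon>" if y: "y \<in> Y" "l1 m x y < r / 4" for y
    proof (cases "y \<in> A")
      case yA: True
      then show ?thesis using r(2)[of y] y(2) r(1) \<epsilon> True by (simp add: t_in)
    next
      case yA: False
      define \<eta> where "\<eta> = l1 m x y"
      have \<eta>: "\<eta> < r / 4" using y(2) by (simp add: \<eta>_def)
      have dy: "0 < d y" "d y \<le> \<eta>"
        using dpos[OF y(1) yA] d(1)[OF True, of y] l1_commute[of m x y] by (auto simp: \<eta>_def)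
      define c where "c = \<phi> x + \<epsilon> / 2"
      have c: "0 < c" using \<phi>(2)[OF True] \<epsilon> by (simp add: c_def add_pos_pos)
      \<comment> \<open>A point \<open>a\<close> that nearly realises the distance from
        \<open>y\<close> is close to \<open>x\<close>; hence \<open>\<phi> a \<le> c\<close>, and
        \<open>a\<close> already makes the infimum too small.\<close>
      have up: "p y \<le> c * d y"
      proof (rule ccontr)
        assume "\<not> p y \<le> c * d y"
        then have "d y < p y / c" using c by (simp add: field_simps)
        then have "d y < min (p y / c) (r / 2)" using dy \<eta> r(1) by simp
        then obtain a where a: "a \<in> A" "l1 m y a < p y / c" "l1 m y a < r / 2"
          using d(3)[of y "min (p y / c) (r / 2)"] by auto
        have "l1 m x a < r" using l1_triangle[of m x a y] a(3) \<eta> r(1) unfolding \<eta>_def by linarith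
        then have "\<phi> a \<le> c" using r(2)[OF a(1)] unfolding c_def by linarith
        then have "\<phi> a * l1 m y a \<le> c * l1 m y a" by (intro mult_right_mono) auto
        also have "\<dots> < p y" using a(2) c by (simp add: field_simps)
        finally show False using p(1)[OF a(1), of y] by simp
      qed
      define c' where "c' = \<phi> x - \<epsilon> / 2"
      have low: "c' * d y \<le> p y"
      proof (rule p(2))
        fix a assume a: "a \<in> A"
        show "c' * d y \<le> \<phi> a * l1 m y a"
        proof (cases "l1 m x a < r")
          case True
          then have "c' \<le> \<phi> a" using r(2)[OF a] unfolding c'_def by linarith
          then have "c' * d y \<le> \<phi> a * d y" using dy(1) by (intro mult_right_mono) auto
          also have "\<dots> \<le> \<phi> a * l1 m y a" using \<phi>(2)[OF a] d(1)[OF a, of y] by (intro mult_left_mono) auto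
          finally show ?thesis .
        next
          case False
          have "c' * d y \<le> 2 * d y" using \<phi>(3)[OF True] \<epsilon> dy(1) unfolding c'_def by (intro mult_right_mono) auto
          also have "\<dots> \<le> 1 * l1 m y a"
            using False l1_triangle[of m x a y] dy(2) \<eta> l1_nonneg[of m x y] unfolding \<eta>_def by linarith
          also have "\<dots> \<le> \<phi> a * l1 m y a" using \<phi>(2)[OF a] by (intro mult_right_mono) auto
          finally show ?thesis .
        qed
      qed
      have "c' \<le> p y / d y" "p y / d y \<le> c" using up low dy(1) by (simp_all add: field_simps)
      then show ?thesis using True yA \<epsilon> unfolding t_in[OF True] t_out[OF yA] c_def c'_def by linarith
    qed
    then show ?thesis using r(1) by (intro exI[of _ "r / 4"]) auto
  qed
qed

end

section \<open>Attaching points to a quotient\<close>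

lemma dtup_tuple1: "dterm M t \<Longrightarrow> dtup M 1 (\<lambda>E. tuple1 (t E))"
  by (simp add: dtup_def tuple1_def)

lemma tuple1_in_cart: "tuple1 t \<in> cart 1"
  by (auto simp: tuple1_def cart_def)

lemma l1_tuple1: "l1 1 (tuple1 s) (tuple1 t) = \<bar>s - t\<bar>"
  by (simp add: l1_def tuple1_def)

lemma l1_scale: "l1 m (\<lambda>i\<in>{..<m}. c * x i) (\<lambda>i\<in>{..<m}. c * y i) = \<bar>c\<bar> * l1 m x y"
  by (simp add: l1_def sum_distrib_left flip: abs_mult right_diff_distrib)

lemma l1_scale_diff: "l1 m (\<lambda>i\<in>{..<m}. c * x i) (\<lambda>i\<in>{..<m}. d * x i) = \<bar>c - d\<bar> * (\<Sum>i<m. \<bar>x i\<bar>)"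
  by (simp add: l1_def sum_distrib_left flip: abs_mult left_diff_distrib)

lemma l1_cont_common_delta:
  fixes n :: nat
  assumes "\<And>i. i < n \<Longrightarrow> \<exists>\<delta>>0. \<forall>y\<in>Y. l1 m x y < \<delta> \<longrightarrow> \<bar>f x i - f y i\<bar> < \<epsilon> / (of_nat n + 1)" "0 < \<epsilon>"
  shows "\<exists>\<delta>>0. \<forall>y\<in>Y. l1 m x y < \<delta> \<longrightarrow> l1 n (f x) (f y) < \<epsilon>"
proof -
  have "\<forall>i. \<exists>\<delta>>0. i < n \<longrightarrow> (\<forall>y\<in>Y. l1 m x y < \<delta> \<longrightarrow> \<bar>f x i - f y i\<bar> < \<epsilon> / (of_nat n + 1))"
    using assms(1) zero_less_one by blast
  then obtain d where d: "\<And>i. 0 < d i"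
    "\<And>i y. i < n \<Longrightarrow> y \<in> Y \<Longrightarrow> l1 m x y < d i \<Longrightarrow> \<bar>f x i - f y i\<bar> < \<epsilon> / (of_nat n + 1)"
    by metis
  define \<delta> where "\<delta> = Min (insert 1 (d ` {..<n}))"
  have "0 < \<delta>" using d(1) by (auto simp: \<delta>_def)
  moreover have "l1 n (f x) (f y) < \<epsilon>" if y: "y \<in> Y" "l1 m x y < \<delta>" for y
  proof (rule l1_less[OF _ assms(2)])
    fix i assume i: "i < n"
    have "\<delta> \<le> d i" using i by (simp add: \<delta>_def)
    then show "\<bar>f x i - f y i\<bar> < \<epsilon> / (of_nat n + 1)" using d(2)[OF i y(1)] y(2) by simp
  qed
  ultimately show ?thesis by blast
qed

lemma rel_closed_inter: "rel_closed m X A \<Longrightarrow> rel_closed m X Y \<Longrightarrow> rel_closed m Y (A \<inter> Y)"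
  unfolding rel_closed_def by (metis IntE IntI inf_le2 subsetD)

context proper_equiv
begin

text \<open>Attaching \<open>Y - A\<close> to the quotient of \<open>A\<close>: the coordinates of the new map are an extension \<open>F\<close>
  of \<open>f\<close>, the distance \<open>h x\<close> from \<open>(x, F x)\<close> to the graph of \<open>f\<close>, and \<open>h x * x\<close>, which
  recovers \<open>x\<close> off \<open>A\<close>. Using the graph of \<open>f\<close> rather than \<open>A\<close> ensures that points of
  \<open>Y\<close> whose images approach the image of \<open>A\<close> approach \<open>A\<close> itself.\<close>

lemma dquot_attach:
  assumes A: "definable M m A" "rel_closed m X A" and Y: "definable M m Y" "rel_closed m X Y"
    and f: "dquot M m n A R f" and f12: "\<And>x i. i < n \<Longrightarrow> 1 \<le> f x i" "\<And>x i. i < n \<Longrightarrow> f x i \<le> 2"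
    and sep: "\<And>y y'. y \<in> Y \<Longrightarrow> y' \<in> Y \<Longrightarrow> (y, y') \<in> R \<Longrightarrow> y \<notin> A \<Longrightarrow> y = y'"
    and ne: "A \<inter> Y \<noteq> {}"
  shows "\<exists>n' g. dquot M m n' Y R g"
proof -
  note fD = dquotD[OF f]
  have AX: "A \<subseteq> X" and YX: "Y \<subseteq> X" using A(2) Y(2) by (auto simp: rel_closed_def)
  \<comment> \<open>\<open>A\<close> may reach outside \<open>Y\<close>. The extension starts from
    the part inside \<open>Y\<close>, while cluster points are lifted along \<open>f\<close> in all
    of \<open>A\<close>.\<close>
  define B where "B = A \<inter> Y"
  have B: "definable M m B" "B \<noteq> {}" unfolding B_def using definable_inter[OF A(1) Y(1)] ne by auto
  have BY: "rel_closed m Y B" unfolding B_def by (rule rel_closed_inter[OF A(2) Y(2)])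
  define F where "F x = (\<lambda>i\<in>{..<n}. tietze m B (\<lambda>a. f a i) x)" for x
  define h where "h x = INFI B (\<lambda>a. l1 m x a + l1 n (F x) (f a))" for x
  define hx where "hx x = (\<lambda>i\<in>{..<m}. h x * x i)" for x
  define g where "g x = join n (F x) (join 1 (tuple1 (h x)) (hx x))" for x
  define N where "N = n + (1 + m)"
  have F_cart: "F x \<in> cart n" for x by (simp add: F_def)
  have g_cart: "g x \<in> cart N" for x
    unfolding g_def N_def hx_def by (intro join_in_cart F_cart tuple1_in_cart restrict_in_cart)
  have l1g: "l1 N (g x) (g y) = l1 n (F x) (F y) + (\<bar>h x - h y\<bar> + l1 m (hx x) (hx y))" for x y
    by (simp only: g_def N_def l1_join l1_tuple1)
  note [dfb] = B(1) dterm_dfun[OF fD(1)] dtup_dfun[OF fD(1)]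
  have F_tup: "dtup M n (\<lambda>E. F (restrict (E b) {..<m}))" for b
    unfolding F_def tietze_def by (rule dtup_lambda, (rule dfb | assumption)+)
  note [dfb] = F_tup
  have h_term: "dterm M (\<lambda>E. h (restrict (E b) {..<m}))" for b
    unfolding h_def by (rule dfb | assumption)+
  have g_dfun: "dfun M m N g"
    unfolding dfun_def g_def N_def hx_def
    by (intro dtup_join F_tup dtup_tuple1 h_term dtup_lambda dterm_mult dterm_restrict)
  have F_A: "F x = f x" if "x \<in> B" for x
    by (rule cart_eqI[OF F_cart fD(2)]) (use that in \<open>simp add: F_def tietze_def\<close>)
  have F_cont: "\<exists>\<delta>>0. \<forall>y\<in>Y. l1 m x y < \<delta> \<longrightarrow> l1 n (F x) (F y) < \<epsilon>" if x: "x \<in> Y" and \<epsilon>: "0 < \<epsilon>" for x \<epsilon>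
  proof (rule l1_cont_common_delta[OF _ \<epsilon>])
    fix i assume i: "i < n"
    have e: "0 < \<epsilon> / (of_nat n + 1)" using \<epsilon> by (simp add: add_nonneg_pos)
    have "\<exists>\<delta>>0. \<forall>y\<in>Y. l1 m x y < \<delta> \<longrightarrow>
        \<bar>tietze m B (\<lambda>a. f a i) x - tietze m B (\<lambda>a. f a i) y\<bar> < \<epsilon> / (of_nat n + 1)"
    proof (rule tietze_continuous[OF B BY dterm_dfun[OF fD(1) i] f12[OF i] _ x e])
      fix a \<epsilon>' assume a: "a \<in> B" and "(0::'a) < \<epsilon>'"
      then obtain \<delta> where \<delta>: "0 < \<delta>" "\<And>y. y \<in> A \<Longrightarrow> l1 m a y < \<delta> \<Longrightarrow> l1 n (f a) (f y) < \<epsilon>'"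
        using l1_contD[OF fD(3), of a \<epsilon>'] by (auto simp: B_def)
      have "\<bar>f a i - f b i\<bar> < \<epsilon>'" if "b \<in> B" "l1 m a b < \<delta>" for b
        using \<delta>(2)[of b] abs_le_l1[OF i, of "f a" "f b"] that by (auto simp: B_def)
      then show "\<exists>\<delta>>0. \<forall>b\<in>B. l1 m a b < \<delta> \<longrightarrow> \<bar>f a i - f b i\<bar> < \<epsilon>'" using \<delta>(1) by blast
    qed
    then show "\<exists>\<delta>>0. \<forall>y\<in>Y. l1 m x y < \<delta> \<longrightarrow> \<bar>F x i - F y i\<bar> < \<epsilon> / (of_nat n + 1)"
      using i by (simp add: F_def)
  qed
  have ht: "dterm M (\<lambda>E. l1 m x (restrict (E 0) {..<m}) + l1 n (F x) (f (restrict (E 0) {..<m})))" for x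
    by (rule dfb)+
  note hI = INFI[OF B ht, of 0, folded h_def, OF add_nonneg_nonneg[OF l1_nonneg l1_nonneg]]
  have h0: "0 \<le> h x" for x by (rule hI(2)) simp
  have h_B: "h x = 0" if "x \<in> B" for x
    using hI(1)[OF that, of x] h0[of x] by (simp add: F_A[OF that])
  have h_pos: "0 < h x" if x: "x \<in> Y" "x \<notin> A" for x
  proof -
    have "x \<notin> B" using x by (simp add: B_def)
    then obtain e where e: "0 < e" "\<And>a. a \<in> B \<Longrightarrow> e \<le> l1 m x a"
      using BY x unfolding rel_closed_def by (meson not_le)
    have "e \<le> h x"
    proof (rule hI(2))
      fix a assume "a \<in> B"
      then show "e \<le> l1 m x a + l1 n (F x) (f a)" using e(2)[of a] l1_nonneg[of n "F x" "f a"] by linarith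
    qed
    then show ?thesis using e(1) by simp
  qed
  have h_lip: "h x \<le> h y + (l1 m x y + l1 n (F x) (F y))" for x y
  proof -
    have "h x - (l1 m x y + l1 n (F x) (F y)) \<le> h y"
    proof (rule hI(2))
      fix a assume a: "a \<in> B"
      show "h x - (l1 m x y + l1 n (F x) (F y)) \<le> l1 m y a + l1 n (F y) (f a)"
        using hI(1)[OF a, of x] l1_triangle[of m x a y] l1_triangle[of n "F x" "f a" "F y"] by linarith
    qed
    then show ?thesis by simp
  qed
  have g_cont: "l1_cont m N Y g"
    unfolding l1_cont_def
  proof (intro ballI allI impI)
    fix x \<epsilon> assume x: "x \<in> Y" and \<epsilon>: "(0::'a) < \<epsilon>"
    define s where "s = (\<Sum>i<m. \<bar>x i\<bar>)"
    have s: "0 \<le> s" by (simp add: s_def sum_nonneg)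
    \<comment> \<open>\<open>C\<close> bounds the factors that arise from moving \<open>h\<close>
      and \<open>x\<close> in the product \<open>h x * x\<close>; the total change is at most
      \<open>\<eta> * (2 + h x / 2 + s)\<close>, which is less than
      \<open>2 * \<eta> * C\<close>.\<close>
    define C where "C = 3 + h x + 2 * s"
    have C: "0 < C" "1 \<le> C" using h0[of x] s by (auto simp: C_def)
    define \<eta> where "\<eta> = min 1 (\<epsilon> / C / 2)"
    have \<eta>: "0 < \<eta>" "\<eta> \<le> 1" "2 * \<eta> * C \<le> \<epsilon>"
      using \<epsilon> C by (auto simp: \<eta>_def min_def field_simps)
    obtain \<delta> where \<delta>: "0 < \<delta>" "\<And>y. y \<in> Y \<Longrightarrow> l1 m x y < \<delta> \<Longrightarrow> l1 n (F x) (F y) < \<eta> / 2"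
      using F_cont[OF x half_gt_zero[OF \<eta>(1)]] by blast
    have "l1 N (g x) (g y) < \<epsilon>" if y: "y \<in> Y" "l1 m x y < min \<delta> (\<eta> / 2)" for y
    proof -
      have Fy: "l1 n (F x) (F y) < \<eta> / 2" using \<delta>(2) y by simp
      have xy: "l1 m x y < \<eta> / 2" using y by simp
      have hh: "\<bar>h x - h y\<bar> \<le> \<eta>"
        using h_lip[of x y] h_lip[of y x] Fy xy l1_commute[of m x y] l1_commute[of n "F x" "F y"] by linarith
      have hy: "\<bar>h y\<bar> \<le> h x + 1" using hh \<eta>(2) h0[of x] h0[of y] by linarith
      have "l1 m (hx x) (hx y) \<le> \<bar>h x - h y\<bar> * s + \<bar>h y\<bar> * l1 m x y"
        using l1_triangle[of m "hx x" "hx y" "\<lambda>i\<in>{..<m}. h y * x i"]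
        unfolding hx_def l1_scale l1_scale_diff s_def .
      also have "\<dots> \<le> \<eta> * s + (h x + 1) * (\<eta> / 2)"
        using hh hy s xy h0[of x] by (intro add_mono mult_mono) auto
      finally have "l1 N (g x) (g y) \<le> \<eta> / 2 + (\<eta> + (\<eta> * s + (h x + 1) * (\<eta> / 2)))"
        unfolding l1g using Fy hh by (intro add_mono) auto
      also have "\<dots> = \<eta> * (2 + h x / 2 + s)" by (simp add: field_simps)
      also have "\<dots> < \<eta> * (2 * C)"
        using \<eta>(1) h0[of x] s unfolding C_def by (intro mult_strict_left_mono) auto
      also have "\<dots> \<le> \<epsilon>" using \<eta>(3) by (simp add: mult_ac)
      finally show ?thesis .
    qed
    then show "\<exists>\<delta>>0. \<forall>y\<in>Y. l1 m x y < \<delta> \<longrightarrow> l1 N (g x) (g y) < \<epsilon>"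
      using \<delta>(1) \<eta>(1) by (intro exI[of _ "min \<delta> (\<eta> / 2)"]) auto
  qed
  have g_B: "g x = g y" if "x \<in> B" "y \<in> B" "f x = f y" for x y
    using that by (simp add: g_def hx_def F_A h_B)
  have g_eq: "F x = F y" "h x = h y" "hx x = hx y" if "g x = g y" for x y
  proof -
    have "l1 n (F x) (F y) + (\<bar>h x - h y\<bar> + l1 m (hx x) (hx y)) = 0"
      using l1g[of x y] that by simp
    then have "l1 n (F x) (F y) = 0" "\<bar>h x - h y\<bar> = 0" "l1 m (hx x) (hx y) = 0"
      using l1_nonneg[of n "F x" "F y"] l1_nonneg[of m "hx x" "hx y"] abs_ge_zero[of "h x - h y"]
      by linarith+
    then show "F x = F y" "h x = h y" "hx x = hx y"
      using l1_eq_0_iff[OF F_cart F_cart] l1_eq_0_iff[of "hx x" m "hx y"] by (auto simp: hx_def)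
  qed
  have g_ker: "g x = g y \<longleftrightarrow> (x, y) \<in> R" if xy: "x \<in> Y" "y \<in> Y" for x y
  proof
    assume eq: "g x = g y"
    show "(x, y) \<in> R"
    proof (cases "h x = 0")
      case True
      then have "x \<in> A" "y \<in> A" using g_eq(2)[OF eq] h_pos xy by force+
      then have "x \<in> B" "y \<in> B" using xy by (auto simp: B_def)
      then show ?thesis using g_eq(1)[OF eq] F_A fD(4)[of x y] by (simp add: B_def)
    next
      case False
      have "x i = y i" if "i < m" for i
        using fun_cong[OF g_eq(3)[OF eq], of i] g_eq(2)[OF eq] False that by (simp add: hx_def)
      then have "x = y" using xy YX X_cart by (intro cart_eqI[of x m y]) auto
      then show ?thesis using R_refl xy YX by blast
    qed
  next
    assume r: "(x, y) \<in> R"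
    show "g x = g y"
    proof (cases "x \<in> A \<and> y \<in> A")
      case True
      then show ?thesis using g_B fD(4)[of x y] r xy by (simp add: B_def)
    next
      case False
      then show ?thesis using sep[OF xy r] sep[OF xy(2,1) R_sym[OF r]] by blast
    qed
  qed
  have "lifts_clus M m N Y g"
    unfolding lifts_clus_def
  proof (intro allI impI)
    fix Z b assume Z: "dfam M m Y Z" and b: "b \<in> g ` Y" and cl: "clus N (\<lambda>t. g ` Z t) b"
    obtain y0 where y0: "y0 \<in> Y" "b = g y0" using b by blast
    have cl': "\<exists>y\<in>Z t. l1 n (F y0) (F y) < \<epsilon> \<and> \<bar>h y0 - h y\<bar> < \<epsilon> \<and> l1 m (hx y0) (hx y) < \<epsilon>"
      if pos: "0 < \<epsilon>" "0 < t" for \<epsilon> t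
    proof -
      obtain y where y: "y \<in> Z t" "l1 N (g y0) (g y) < \<epsilon>" using clusD[OF cl pos] y0(2) by blast
      have "l1 n (F y0) (F y) < \<epsilon>" "\<bar>h y0 - h y\<bar> < \<epsilon>" "l1 m (hx y0) (hx y) < \<epsilon>"
        using y(2)[unfolded l1g] l1_nonneg[of n "F y0" "F y"] l1_nonneg[of m "hx y0" "hx y"]
          abs_ge_zero[of "h y0 - h y"] by linarith+
      then show ?thesis using y(1) by blast
    qed
    show "\<exists>a\<in>Y. clus m Z a \<and> g a = b"
    proof (cases "y0 \<in> A")
      case False
      have c: "0 < h y0" by (rule h_pos[OF y0(1) False])
      define s where "s = (\<Sum>i<m. \<bar>y0 i\<bar>)"
      have s: "0 \<le> s" by (simp add: s_def sum_nonneg)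
      have "clus m Z y0"
        unfolding clus_def
      proof (intro allI impI)
        fix \<epsilon> t :: 'a assume pos: "0 < \<epsilon>" "0 < t"
        \<comment> \<open>The first bound keeps \<open>h y\<close> above \<open>h y0 / 2\<close>, so
          that dividing by \<open>h y\<close> is harmless; the second absorbs the error
          \<open>\<eta> * (1 + s)\<close> of the scaled points.\<close>
        define \<eta> where "\<eta> = min (h y0 / 2) (\<epsilon> * h y0 / (2 * (1 + s)))"
        have \<eta>: "0 < \<eta>" using c pos s by (simp add: \<eta>_def add_pos_nonneg)
        have \<eta>1: "\<eta> \<le> h y0 / 2" unfolding \<eta>_def by (rule min.cobounded1)
        have "\<eta> \<le> \<epsilon> * h y0 / (2 * (1 + s))" unfolding \<eta>_def by (rule min.cobounded2)
        then have \<eta>2: "\<eta> * (1 + s) \<le> \<epsilon> * (h y0 / 2)" using s by (simp add: field_simps add_pos_nonneg)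
        obtain y where y: "y \<in> Z t" "\<bar>h y0 - h y\<bar> < \<eta>" "l1 m (hx y0) (hx y) < \<eta>"
          using cl'[OF \<eta> pos(2)] by blast
        have hy: "h y0 / 2 < h y" using y(2) \<eta>1 by (simp add: abs_less_iff field_simps)
        have "\<bar>h y\<bar> * l1 m y0 y \<le> \<bar>h y - h y0\<bar> * s + l1 m (hx y0) (hx y)"
          using l1_triangle[of m "\<lambda>i\<in>{..<m}. h y * y0 i" "hx y" "hx y0"]
          unfolding hx_def l1_scale l1_scale_diff s_def .
        also have "\<dots> < \<eta> * s + \<eta>"
          using y(2,3) s by (intro add_le_less_mono mult_right_mono) (auto simp: abs_minus_commute)
        also have "\<dots> \<le> \<epsilon> * (h y0 / 2)" using \<eta>2 by (simp add: algebra_simps)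
        also have "\<dots> < \<epsilon> * h y" using hy pos by (intro mult_strict_left_mono) auto
        finally have "h y * l1 m y0 y < h y * \<epsilon>" using hy c h0[of y] by (simp add: mult.commute)
        then have "l1 m y0 y < \<epsilon>" using hy c h0[of y] by (meson mult_less_cancel_left_pos mult_left_less_imp_less)
        then show "\<exists>y\<in>Z t. l1 m y0 y < \<epsilon>" using y(1) by blast
      qed
      then show ?thesis using y0 by blast
    next
      case True
      then have y0B: "y0 \<in> B" using y0 by (simp add: B_def)
      \<comment> \<open>Points of \<open>B\<close> that approach the family both in the domain and
        in the image. A small \<open>h y\<close> says precisely that such a point exists for
        \<open>y\<close>, so the problem moves into \<open>A\<close>, where \<open>f\<close> lifts
        cluster points.\<close>
      define Z' where "Z' t = {a\<in>B. \<exists>y\<in>cart m. y \<in> Z t \<and> l1 m y a + l1 n (F y) (f a) < t}" for t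
      have Z': "dfam M m A Z'"
      proof (rule dfamI)
        show "dpred M (\<lambda>E. restrict (E 0) {..<m} \<in> Z' (E 1 0))"
          unfolding Z'_def mem_Collect_eq by (rule dfb dfam_mem[OF Z])+
        show "Z' t \<subseteq> A" for t by (auto simp: Z'_def B_def)
        show "Z' s \<subseteq> Z' t" if "0 < s" "s \<le> t" for s t
          using dfam_mono[OF Z that] that(2) unfolding Z'_def by (blast intro: less_le_trans)
      qed
      have Z'I: "\<exists>a\<in>Z' t. \<exists>y\<in>Z t. l1 n (F y0) (F y) < \<epsilon> \<and> l1 n (F y) (f a) < \<epsilon>"
        if pos: "0 < \<epsilon>" "0 < t" for \<epsilon> t
      proof -
        obtain y where y: "y \<in> Z t" "l1 n (F y0) (F y) < min \<epsilon> t" "\<bar>h y0 - h y\<bar> < min \<epsilon> t"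
          using cl'[of "min \<epsilon> t" t] pos by auto
        then have "h y < min \<epsilon> t" using h_B[OF y0B] by (auto simp: abs_less_iff)
        then obtain a where a: "a \<in> B" "l1 m y a + l1 n (F y) (f a) < min \<epsilon> t" using hI(3) by blast
        have "y \<in> cart m" using y(1) dfam_subset[OF Z pos(2)] YX X_cart by blast
        then have "a \<in> Z' t" unfolding Z'_def using y(1) a by auto
        moreover have "l1 n (F y) (f a) < \<epsilon>" 
          using a(2) l1_nonneg[of m y a] unfolding min_less_iff_conj by linarith
        moreover have "l1 n (F y0) (F y) < \<epsilon>" using y(2) by simp
        ultimately show ?thesis using y(1) by blast
      qed
      have "clus n (\<lambda>t. f ` Z' t) (f y0)"
        unfolding clus_def
      proof (intro allI impI)
        fix \<epsilon> t :: 'a assume pos: "0 < \<epsilon>" "0 < t"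
        obtain a y where "a \<in> Z' t" "l1 n (F y0) (F y) < \<epsilon> / 2" "l1 n (F y) (f a) < \<epsilon> / 2"
          using Z'I[OF half_gt_zero[OF pos(1)] pos(2)] by blast
        moreover from this have "l1 n (F y0) (f a) < \<epsilon> / 2 + \<epsilon> / 2"
          using l1_triangle[of n "F y0" "f a" "F y"] by linarith
        ultimately show "\<exists>z\<in>f ` Z' t. l1 n (f y0) z < \<epsilon>" using F_A[OF y0B] by auto
      qed
      then obtain a0 where a0: "a0 \<in> A" "clus m Z' a0" "f a0 = f y0"
        using lifts_clusD[OF fD(5) Z' imageI[OF True]] by blast
      \<comment> \<open>Members of \<open>Z' s\<close> are within \<open>s\<close> of members of
        \<open>Z s\<close>, so a cluster point of the new family is one of the old; closedness of
        \<open>Y\<close> then puts it into \<open>Y\<close>.\<close>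
      have cl_a0: "clus m Z a0"
        unfolding clus_def
      proof (intro allI impI)
        fix \<epsilon> t :: 'a assume pos: "0 < \<epsilon>" "0 < t"
        define s where "s = min t (\<epsilon> / 2)"
        have s: "0 < s" "s \<le> t" "s \<le> \<epsilon> / 2" using pos by (auto simp: s_def)
        obtain a where a: "a \<in> Z' s" "l1 m a0 a < \<epsilon> / 2" using clusD[OF a0(2) half_gt_zero[OF pos(1)] s(1)] by blast
        then obtain y where y: "y \<in> Z s" "l1 m y a + l1 n (F y) (f a) < s" unfolding Z'_def by blast
        then have "l1 m y a < \<epsilon> / 2" using s(3) l1_nonneg[of n "F y" "f a"] by linarith
        then have "l1 m a0 y < \<epsilon> / 2 + \<epsilon> / 2"
          using a(2) l1_triangle[of m a0 y a] l1_commute[of m y a] by linarith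
        then show "\<exists>y\<in>Z t. l1 m a0 y < \<epsilon>" using y(1) dfam_mono[OF Z s(1,2)] by auto
      qed
      then have "a0 \<in> Y" using clus_rel_closed[OF Y(2) Z] a0(1) AX by blast
      then have "g a0 = g y0" using g_B[of a0 y0] y0B a0 by (simp add: B_def)
      then show ?thesis using \<open>a0 \<in> Y\<close> cl_a0 y0(2) by blast
    qed
  qed
  then have "dquot M m N Y R g"
    unfolding dquot_def using g_dfun g_cart g_cont g_ker by blast
  then show ?thesis by blast
qed

end

section \<open>Passage from a closed set to its saturation\<close>

context proper_equiv
begin

definition saturation :: "(nat \<Rightarrow> 'a) set \<Rightarrow> (nat \<Rightarrow> 'a) set" where
  "saturation C = {x \<in> X. \<exists>y\<in>C. (x, y) \<in> R}"

lemma definable_saturation: "definable M m C \<Longrightarrow> definable M m (saturation C)"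
  unfolding saturation_def by (rule definable_Collect_sub[OF X_def]) (rule dfb | assumption)+

text \<open>For the constant family \<open>C\<close>, \<open>clus_R\<close> turns points of the
  saturation near \<open>x\<close> into a single point of \<open>C\<close> equivalent to
  \<open>x\<close>.\<close>

lemma rel_closed_saturation:
  assumes "definable M m C" "rel_closed m X C"
  shows "rel_closed m X (saturation C)"
  unfolding rel_closed_def
proof (intro conjI ballI impI)
  fix x assume x: "x \<in> X" and near: "\<forall>\<epsilon>>0. \<exists>a\<in>saturation C. l1 m x a < \<epsilon>"
  have "C \<subseteq> X" using assms(2) by (simp add: rel_closed_def)
  then have C: "dfam M m X (\<lambda>t. C)" by (intro dfamI dpred_mem[OF assms(1)]) auto
  have "\<exists>y\<in>C. \<exists>a. (a, y) \<in> R \<and> l1 m x a < \<epsilon>" if "0 < \<epsilon>" for \<epsilon>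
    using near that by (auto simp: saturation_def) blast
  then obtain y where y: "clus m (\<lambda>t. C) y" "(x, y) \<in> R"
    using clus_R[OF C x] by blast
  then have "y \<in> C" using clus_rel_closed[OF assms(2) dfam_const[OF assms(1)]] R_X by blast
  then show "x \<in> saturation C" using x y(2) by (auto simp: saturation_def)
qed (auto simp: saturation_def)

text \<open>The map is extended constantly along classes. Continuity and lifting no longer take
  place within \<open>Y\<close>: each time, \<open>clus_R\<close> exchanges a nearby point for an
  equivalent one.\<close>

lemma dquot_saturation:
  assumes Y: "definable M m Y" "rel_closed m X Y" and g: "dquot M m n Y R g"
  shows "\<exists>p. dquot M m n (saturation Y) R p"
proof -
  note gD = dquotD[OF g]
  have YX: "Y \<subseteq> X" using Y(2) by (simp add: rel_closed_def)
  \<comment> \<open>On the saturation the set has exactly one element, the common value of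
    \<open>g\<close> on the class; the infimum serves as a definable description operator.\<close>
  define p where "p x = (\<lambda>i\<in>{..<n}. glb {r. \<exists>y\<in>Y. (x, y) \<in> R \<and> r = g y i})" for x
  have p: "p x = g y" if "(x, y) \<in> R" "y \<in> Y" for x y
  proof (rule cart_eqI[OF _ gD(2)])
    fix i assume i: "i < n"
    have eq: "g y' = g y" if "(x, y') \<in> R" "y' \<in> Y" for y'
      using gD(4)[OF \<open>y' \<in> Y\<close> \<open>y \<in> Y\<close>] R_trans[OF R_sym[OF that(1)] \<open>(x, y) \<in> R\<close>] by blast
    have "{r. \<exists>y\<in>Y. (x, y) \<in> R \<and> r = g y i} = {g y i}"
    proof (intro equalityI subsetI)
      fix r assume "r \<in> {r. \<exists>y\<in>Y. (x, y) \<in> R \<and> r = g y i}"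
      then obtain y' where "y' \<in> Y" "(x, y') \<in> R" "r = g y' i" by blast
      then show "r \<in> {g y i}" using eq by simp
    qed (use that in blast)
    moreover have "is_glb {g y i} (g y i)" by (simp add: is_glb_def)
    ultimately show "p x i = g y i" using i by (simp add: p_def glb_eq)
  qed (simp add: p_def)
  note [dfb] = Y(1) dterm_dfun[OF gD(1)] dtup_dfun[OF gD(1)]
  have "dfun M m n p"
    unfolding dfun_def p_def by (rule dtup_lambda, (rule dfb | assumption)+)
  moreover have "p x \<in> cart n" for x by (simp add: p_def)
  moreover have "l1_cont m n (saturation Y) p"
    unfolding l1_cont_def
  proof (intro ballI allI impI)
    fix x \<epsilon> assume x: "x \<in> saturation Y" and \<epsilon>: "(0::'a) < \<epsilon>"
    obtain y where y: "(x, y) \<in> R" "y \<in> Y" using x by (auto simp: saturation_def)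
    show "\<exists>\<delta>>0. \<forall>x'\<in>saturation Y. l1 m x x' < \<delta> \<longrightarrow> l1 n (p x) (p x') < \<epsilon>"
    proof (rule ccontr)
      assume far: "\<not> ?thesis"
      \<comment> \<open>Points of \<open>Y\<close> whose image stays away from \<open>g y\<close>.
        If continuity failed at \<open>x\<close>, then \<open>W\<close> would accumulate at a point
        equivalent to \<open>x\<close>, against continuity of \<open>g\<close> there.\<close>
      define W where "W = {z \<in> Y. \<epsilon> \<le> l1 n (g y) (g z)}"
      have "definable M m W"
        unfolding W_def by (rule definable_Collect_sub[OF Y(1)]) (rule dfb)+
      then have W: "dfam M m X (\<lambda>t. W)" using YX by (intro dfamI dpred_mem) (auto simp: W_def)
      have "\<exists>z\<in>W. \<exists>x'. (x', z) \<in> R \<and> l1 m x x' < \<delta>" if \<delta>: "0 < \<delta>" for \<delta>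
      proof -
        obtain x' where x': "x' \<in> saturation Y" "l1 m x x' < \<delta>" "\<not> l1 n (p x) (p x') < \<epsilon>"
          using far \<delta> by blast
        obtain z where z: "(x', z) \<in> R" "z \<in> Y" using x'(1) by (auto simp: saturation_def)
        then have "z \<in> W" using x'(3) p[OF y] p[OF z] by (simp add: W_def)
        then show ?thesis using z x'(2) by blast
      qed
      then obtain z where z: "clus m (\<lambda>t. W) z" "(x, z) \<in> R"
        using clus_R[OF W] R_X(1)[OF y(1)] by blast
      have "dfam M m Y (\<lambda>t. W)" using W by (auto simp: dfam_def W_def)
      then have zY: "z \<in> Y" using clus_rel_closed[OF Y(2) _ z(1)] R_X(2)[OF z(2)] by blast
      obtain \<delta> where \<delta>: "0 < \<delta>" "\<And>w. w \<in> Y \<Longrightarrow> l1 m z w < \<delta> \<Longrightarrow> l1 n (g z) (g w) < \<epsilon>"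
        using l1_contD[OF gD(3) zY \<epsilon>] by blast
      obtain w where w: "w \<in> W" "l1 m z w < \<delta>" using clusD[OF z(1) \<delta>(1) zero_less_one] by blast
      have "g z = g y" using p[OF y] p[OF z(2) zY] by simp
      then show False using \<delta>(2)[of w] w by (auto simp: W_def)
    qed
  qed
  moreover have "p x = p x' \<longleftrightarrow> (x, x') \<in> R" if xx': "x \<in> saturation Y" "x' \<in> saturation Y" for x x'
  proof -
    obtain y y' where y: "(x, y) \<in> R" "y \<in> Y" "(x', y') \<in> R" "y' \<in> Y"
      using xx' by (auto simp: saturation_def)
    have "p x = p x' \<longleftrightarrow> (y, y') \<in> R" using p[OF y(1,2)] p[OF y(3,4)] gD(4)[OF y(2,4)] by simp
    also have "\<dots> \<longleftrightarrow> (x, x') \<in> R" using y(1,3) R_sym R_trans by meson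
    finally show ?thesis .
  qed
  moreover have "lifts_clus M m n (saturation Y) p"
    unfolding lifts_clus_def
  proof (intro allI impI)
    fix Z b assume Z: "dfam M m (saturation Y) Z" and b: "b \<in> p ` saturation Y"
      and cl: "clus n (\<lambda>t. p ` Z t) b"
    obtain y0 where b0: "b = g y0" "y0 \<in> Y" using b p by (auto simp: saturation_def)
    \<comment> \<open>The family is moved into \<open>Y\<close> along the equivalence, lifted there
      by \<open>g\<close>, and the resulting cluster point is moved back by
      \<open>clus_R\<close>.\<close>
    define Z' where "Z' t = {y\<in>Y. \<exists>x\<in>cart m. x \<in> Z t \<and> (x, y) \<in> R}" for t
    have Z': "dfam M m Y Z'"
    proof (rule dfamI)
      show "dpred M (\<lambda>E. restrict (E 0) {..<m} \<in> Z' (E 1 0))"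
        unfolding Z'_def mem_Collect_eq by (rule dfb dfam_mem[OF Z])+
      show "Z' s \<subseteq> Z' t" if "0 < s" "s \<le> t" for s t
        using dfam_mono[OF Z that] unfolding Z'_def by blast
    qed (auto simp: Z'_def)
    have "clus n (\<lambda>t. g ` Z' t) b"
      unfolding clus_def
    proof (intro allI impI)
      fix \<epsilon> t :: 'a assume pos: "0 < \<epsilon>" "0 < t"
      obtain x where x: "x \<in> Z t" "l1 n b (p x) < \<epsilon>" using clusD[OF cl pos] by blast
      then have "x \<in> saturation Y" using dfam_subset[OF Z pos(2)] by blast
      then obtain y where y: "(x, y) \<in> R" "y \<in> Y" "x \<in> X" by (auto simp: saturation_def)
      then have "y \<in> Z' t" using x(1) X_cart by (auto simp: Z'_def)
      then show "\<exists>z\<in>g ` Z' t. l1 n b z < \<epsilon>" using x(2) p[OF y(1,2)] by auto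
    qed
    then obtain y1 where y1: "y1 \<in> Y" "clus m Z' y1" "g y1 = b"
      using lifts_clusD[OF gD(5) Z'] b0 by blast
    have ZX: "dfam M m X Z" using Z by (auto simp: dfam_def saturation_def)
    have "\<exists>x\<in>Z t. \<exists>y. (y, x) \<in> R \<and> l1 m y1 y < \<epsilon>" if "0 < \<epsilon>" "0 < t" for \<epsilon> t
      using clusD[OF y1(2) that] R_sym unfolding Z'_def by blast
    then obtain x1 where x1: "clus m Z x1" "(y1, x1) \<in> R"
      using clus_R[OF ZX] YX y1(1) by blast
    then have "x1 \<in> saturation Y" "p x1 = b"
      using y1 R_sym[OF x1(2)] R_X p[OF R_sym[OF x1(2)] y1(1)] by (auto simp: saturation_def)
    then show "\<exists>a\<in>saturation Y. clus m Z a \<and> p a = b" using x1(1) by blast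
  qed
  ultimately have "dquot M m n (saturation Y) R p"
    unfolding dquot_def by blast
  then show ?thesis by blast
qed

section \<open>Representatives and induction on the rank\<close>

lemma ex_representatives:
  assumes C: "definable M m C" "C \<subseteq> X"
  shows "\<exists>S. definable M m S \<and> S \<subseteq> C \<and> (\<forall>x\<in>C. \<exists>s\<in>S. (x, s) \<in> R) \<and>
     (\<forall>s\<in>S. \<forall>s'\<in>S. (s, s') \<in> R \<longrightarrow> s = s')"
proof -
  define Q where "Q = R \<inter> C \<times> C"
  have "equiv C Q"
    using R_refl R_sym R_trans C(2) unfolding Q_def
    by (intro equivI refl_onI symI transI) blast+
  moreover have "definable M (m + m) (pair_set m Q)"
    unfolding definable_iff_dpred
  proof
    have Cc: "C \<subseteq> cart m" using C(2) X_cart by blast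
    show "pair_set m Q \<subseteq> cart (m + m)"
      using Cc by (auto simp: pair_set_def Q_def intro!: join_in_cart)
    have "z \<in> pair_set m Q \<longleftrightarrow> (\<exists>x\<in>C. \<exists>y\<in>C. (x, y) \<in> R \<and> (\<forall>i<m + m. z i = join m x y i))"
      if z: "z \<in> cart (m + m)" for z
    proof -
      have "z = join m x y \<longleftrightarrow> (\<forall>i<m + m. z i = join m x y i)" if "x \<in> C" "y \<in> C" for x y
        using cart_eqI[OF z join_in_cart[of x m y m]] that Cc by blast
      moreover have "z \<in> pair_set m Q \<longleftrightarrow> (\<exists>x\<in>C. \<exists>y\<in>C. (x, y) \<in> R \<and> z = join m x y)"
        by (auto simp: pair_set_def Q_def)
      ultimately show ?thesis by blast
    qed
    moreover have "dterm M (\<lambda>E. join m (restrict (E a) {..<m}) (restrict (E b) {..<m}) i)" if "i < m + m" for a b i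
      by (rule dtupD[OF dtup_join[OF dtup_restrict dtup_restrict] that])
    then have "dpred M (\<lambda>E. \<exists>x\<in>C. \<exists>y\<in>C. (x, y) \<in> R \<and> (\<forall>i<m + m. restrict (E 0) {..<m + m} i = join m x y i))"
      by - (rule dfb C(1) dpred_all_less | assumption)+
    ultimately show "dpred M (\<lambda>E. restrict (E 0) {..<m + m} \<in> pair_set m Q)"
      using restrict_in_cart by (simp del: restrict_apply)
  qed
  ultimately have "definable_equiv M m C Q" using C(1) by (simp add: definable_equiv_def)
  moreover have "\<And>m X E. definable_equiv M m X E \<Longrightarrow>
        (\<exists>S. definable M m S \<and> S \<subseteq> X \<and> (\<forall>C\<in>X // E. \<exists>!s. s \<in> S \<inter> C))"
    using choice unfolding definable_choice_def by blast
  ultimately obtain S where S: "definable M m S" "S \<subseteq> C" "\<forall>K\<in>C // Q. \<exists>!s. s \<in> S \<inter> K"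
    by meson
  have rep: "\<exists>!s. s \<in> S \<inter> Q `` {x}" if "x \<in> C" for x
    by (rule bspec[OF S(3) quotientI[OF that]])
  have "\<exists>s\<in>S. (x, s) \<in> R" if "x \<in> C" for x
    using rep[OF that] by (auto simp: Q_def)
  moreover have "s = s'" if "s \<in> S" "s' \<in> S" "(s, s') \<in> R" for s s'
  proof -
    have "s \<in> C" "s' \<in> C" using that S(2) by auto
    then have "s \<in> S \<inter> Q `` {s}" "s' \<in> S \<inter> Q `` {s}" using that R_refl C(2) by (auto simp: Q_def)
    then show ?thesis using rep[OF \<open>s \<in> C\<close>] by blast
  qed
  ultimately show ?thesis using S(1,2) by blast
qed

text \<open>This serves the case in which there is nothing to attach to and a Tietze extension would
  start from the empty set. Restriction is the identity on tuples, but has values in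
  \<open>cart m\<close> for every argument.\<close>

lemma dquot_restrict:
  assumes "Y \<subseteq> X" "\<And>y y'. y \<in> Y \<Longrightarrow> y' \<in> Y \<Longrightarrow> (y, y') \<in> R \<Longrightarrow> y = y'"
  shows "dquot M m m Y R (\<lambda>x. restrict x {..<m})"
  unfolding dquot_def dfun_def
proof (intro conjI allI ballI)
  have id: "restrict y {..<m} = y" if "y \<in> Y" for y
    using that assms(1) X_cart by (intro restrict_cart) auto
  show "dtup M m (\<lambda>E. restrict (restrict (E 0) {..<m}) {..<m})"
    using dtup_restrict by simp
  show "l1_cont m m Y (\<lambda>x. restrict x {..<m})"
    unfolding l1_cont_def l1_restrict by blast
  show "restrict x {..<m} = restrict y {..<m} \<longleftrightarrow> (x, y) \<in> R" if "x \<in> Y" "y \<in> Y" for x y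
    unfolding id[OF that(1)] id[OF that(2)] using assms(2)[OF that] R_refl assms(1) that by blast
  show "lifts_clus M m m Y (\<lambda>x. restrict x {..<m})"
    unfolding lifts_clus_def
  proof (intro allI impI)
    fix Z b assume Z: "dfam M m Y Z" and b: "b \<in> (\<lambda>x. restrict x {..<m}) ` Y"
      and cl: "clus m (\<lambda>t. (\<lambda>x. restrict x {..<m}) ` Z t) b"
    have im: "(\<lambda>x. restrict x {..<m}) ` Z t = (\<lambda>x. x) ` Z t" if "0 < t" for t
      by (rule image_cong[OF refl], rule id) (use dfam_subset[OF Z that] in blast)
    have "clus m Z b"
      unfolding clus_def
    proof (intro allI impI)
      fix \<epsilon> t :: 'a assume pos: "0 < \<epsilon>" "0 < t"
      show "\<exists>y\<in>Z t. l1 m b y < \<epsilon>"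
        using clusD[OF cl pos] unfolding im[OF pos(2)] image_ident .
    qed
    moreover obtain a where "a \<in> Y" "b = a" using b id by blast
    ultimately show "\<exists>a\<in>Y. clus m Z a \<and> restrict a {..<m} = b" using id by blast
  qed
qed simp

text \<open>The rank drops because a set of representatives contains a relatively open subset of its
  closure with complement of smaller rank.\<close>

lemma ex_dquot_step:
  assumes er: "good_eRank M Ec eRank" and C: "definable M m C" "rel_closed m X C" "C \<noteq> {}"
    and IH: "\<And>C'. definable M m C' \<Longrightarrow> rel_closed m X C' \<Longrightarrow> eRank m C' < eRank m C \<Longrightarrow>
      \<exists>n f. dquot M m n (saturation C') R f"
  shows "\<exists>n f. dquot M m n (saturation C) R f"
proof -
  note er' = er[unfolded good_eRank_def, rule_format, of m]
  have er_empty: "\<forall>X. definable M m X \<longrightarrow> (eRank m X = None \<longleftrightarrow> X = {})"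
    using er' by (elim conjE) assumption
  have er_union: "\<forall>A B. definable M m A \<and> definable M m B \<longrightarrow> eRank m (A \<union> B) = max (eRank m A) (eRank m B)"
    using er' by (elim conjE) assumption
  have er_open: "\<forall>X Y. definable M m X \<and> definable M m Y \<and> X \<noteq> {} \<and> X \<subseteq> Y \<and> eRank m X = eRank m Y \<longrightarrow>
        (\<exists>U. definable M m U \<and> U \<subseteq> X \<and> openin (subtopology (cart_top m) Y) U \<and>
           eRank m (X - U) < eRank m Y)"
    using er' by (elim conjE) assumption
  have mono: "eRank m A \<le> eRank m B" if "A \<subseteq> B" "definable M m A" "definable M m B" for A B
  proof -
    have "A \<union> B = B" using that(1) by blast
    then show ?thesis using er_union that(2,3) by (metis max.cobounded1)
  qed
  have CX: "C \<subseteq> X" using C(2) by (simp add: rel_closed_def)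
  obtain S where S: "definable M m S" "S \<subseteq> C" "\<And>x. x \<in> C \<Longrightarrow> \<exists>s\<in>S. (x, s) \<in> R"
    "\<And>s s'. s \<in> S \<Longrightarrow> s' \<in> S \<Longrightarrow> (s, s') \<in> R \<Longrightarrow> s = s'"
    using ex_representatives[OF C(1) CX] by blast
  have Sne: "S \<noteq> {}" using S(3) C(3) by blast
  define Y where "Y = {x \<in> X. \<forall>\<epsilon>. 0 < \<epsilon> \<longrightarrow> (\<exists>s\<in>S. l1 m x s < \<epsilon>)}"
  have Yd: "definable M m Y"
    unfolding Y_def by (rule definable_Collect_sub[OF X_def]) (rule dfb S(1))+
  have YC: "Y \<subseteq> C"
    using C(2) S(2) unfolding rel_closed_def Y_def by blast
  have SY: "S \<subseteq> Y"
  proof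
    fix s assume "s \<in> S"
    moreover from this have "\<exists>s'\<in>S. l1 m s s' < \<epsilon>" if "0 < \<epsilon>" for \<epsilon>
      using that by (intro bexI[of _ s]) simp_all
    ultimately show "s \<in> Y" using S(2) CX by (auto simp: Y_def)
  qed
  have YX: "Y \<subseteq> X" by (auto simp: Y_def)
  have Yc: "rel_closed m X Y"
    unfolding rel_closed_def
  proof (intro conjI ballI impI)
    fix x assume x: "x \<in> X" and near: "\<forall>\<epsilon>>0. \<exists>a\<in>Y. l1 m x a < \<epsilon>"
    have "\<exists>s\<in>S. l1 m x s < \<epsilon>" if \<epsilon>: "0 < \<epsilon>" for \<epsilon>
    proof -
      obtain a where a: "a \<in> Y" "l1 m x a < \<epsilon> / 2" using near half_gt_zero[OF \<epsilon>] by blast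
      then obtain s where s: "s \<in> S" "l1 m a s < \<epsilon> / 2" using half_gt_zero[OF \<epsilon>] unfolding Y_def by blast
      have "l1 m x s < \<epsilon> / 2 + \<epsilon> / 2" using l1_triangle[of m x s a] a(2) s(2) by linarith
      then show ?thesis using s(1) by auto
    qed
    then show "x \<in> Y" using x by (simp add: Y_def)
  qed (rule YX)
  have nb: "\<exists>\<epsilon>>0. \<forall>y\<in>Y. l1 m x y < \<epsilon> \<longrightarrow> y \<in> U" if U: "openin (subtopology (cart_top m) Y) U" "x \<in> U" for U x
    using openin_subtopology_cart_top[OF U] YX X_cart by blast
  have YS: "definable M m (Y - S)" by (rule definable_diff[OF Yd S(1)])
  \<comment> \<open>If \<open>Y - S\<close> had the rank of \<open>Y\<close>, then the rank axiom
    would give a subset of it, open in \<open>Y\<close>, whose removal lowers the rank. That subset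
    would be nonempty, yet miss the dense set \<open>S\<close>.\<close>
  have small: "eRank m (Y - S) < eRank m Y"
  proof (cases "Y - S = {}")
    case True
    have "Y \<noteq> {}" using Sne SY by blast
    then have "eRank m Y \<noteq> None" "eRank m {} = None" using er_empty Yd definable_empty[of M m] by auto
    then show ?thesis unfolding True by (cases "eRank m Y") auto
  next
    case False
    show ?thesis
    proof (rule ccontr)
      assume "\<not> ?thesis"
      then have eq: "eRank m (Y - S) = eRank m Y" using mono[OF Diff_subset YS Yd] by simp
      then obtain U where U: "U \<subseteq> Y - S" "openin (subtopology (cart_top m) Y) U"
        "eRank m (Y - S - U) < eRank m Y"
        using er_open YS Yd False by (meson Diff_subset)
      have "U \<noteq> {}" using U(3) eq by auto
      then obtain u where u: "u \<in> U" by blast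
      obtain \<epsilon> where \<epsilon>: "0 < \<epsilon>" "\<forall>y\<in>Y. l1 m u y < \<epsilon> \<longrightarrow> y \<in> U" using nb[OF U(2) u] by blast
      have "u \<in> Y" using u U(1) by blast
      then obtain s where "s \<in> S" "l1 m u s < \<epsilon>" using \<epsilon>(1) unfolding Y_def by blast
      then show False using \<epsilon>(2) SY U(1) by blast
    qed
  qed
  have "S \<union> (Y - S) = Y" using SY by blast
  then have "eRank m Y = max (eRank m S) (eRank m (Y - S))" using er_union S(1) YS by metis
  then have "eRank m S = eRank m Y" using small by (auto simp: max_def split: if_splits)
  then obtain U where U: "definable M m U" "U \<subseteq> S" "openin (subtopology (cart_top m) Y) U"
    "eRank m (S - U) < eRank m Y"
    using er_open S(1) Yd Sne SY by meson
  \<comment> \<open>Closed because \<open>U\<close> is open in \<open>Y\<close>, and the union of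
    \<open>Y - S\<close> and \<open>S - U\<close>, both of smaller rank than
    \<open>Y\<close>.\<close>
  define A1 where "A1 = Y - U"
  have A1d: "definable M m A1" unfolding A1_def by (rule definable_diff[OF Yd U(1)])
  have "A1 = (Y - S) \<union> (S - U)" using SY U(2) by (auto simp: A1_def)
  then have "eRank m A1 = max (eRank m (Y - S)) (eRank m (S - U))"
    using er_union YS definable_diff[OF S(1) U(1)] by metis
  then have "eRank m A1 < eRank m Y" using small U(4) by simp
  then have less: "eRank m A1 < eRank m C" using mono[OF YC Yd C(1)] by simp
  have A1c: "rel_closed m X A1"
    unfolding rel_closed_def
  proof (intro conjI ballI impI)
    fix x assume x: "x \<in> X" and near: "\<forall>\<epsilon>>0. \<exists>a\<in>A1. l1 m x a < \<epsilon>"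
    then have "x \<in> Y" using Yc unfolding rel_closed_def A1_def by (meson DiffD1)
    moreover have "x \<notin> U"
    proof
      assume "x \<in> U"
      then obtain \<epsilon> where "0 < \<epsilon>" "\<forall>y\<in>Y. l1 m x y < \<epsilon> \<longrightarrow> y \<in> U" using nb[OF U(3)] by blast
      then show False using near unfolding A1_def by blast
    qed
    ultimately show "x \<in> A1" by (simp add: A1_def)
  qed (use YX in \<open>auto simp: A1_def\<close>)
  obtain n f where "dquot M m n (saturation A1) R f" using IH[OF A1d A1c less] by blast
  note f = dquot_squash[OF this]
  have A1sat: "A1 \<subseteq> saturation A1" using A1c R_refl by (auto simp: saturation_def rel_closed_def)
  \<comment> \<open>Outside the saturated set \<open>y\<close> and its equivalent \<open>y'\<close>
    both avoid \<open>A1\<close>, so they lie in \<open>U \<subseteq> S\<close>, where equivalent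
    points coincide.\<close>
  have sep: "y = y'" if "y \<in> Y" "y' \<in> Y" "(y, y') \<in> R" "y \<notin> saturation A1" for y y'
  proof -
    have "y \<in> U" using that A1sat by (auto simp: A1_def)
    moreover have "y' \<in> U" using that YX by (auto simp: A1_def saturation_def)
    ultimately show ?thesis using S(4) U(2) that(3) by blast
  qed
  have "\<exists>n g. dquot M m n Y R g"
  proof (cases "saturation A1 \<inter> Y = {}")
    case True
    then have "dquot M m m Y R (\<lambda>x. restrict x {..<m})" using sep by (intro dquot_restrict[OF YX]) blast
    then show ?thesis by blast
  next
    case False
    show ?thesis
      by (rule dquot_attach[OF definable_saturation[OF A1d] rel_closed_saturation[OF A1d A1c] Yd Yc f _ _ sep False])
        (simp_all add: squash_bounds)
  qed
  then obtain n' g where "dquot M m n' Y R g" by blast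
  from dquot_saturation[OF Yd Yc this] obtain p where "dquot M m n' (saturation Y) R p" by blast
  moreover have "saturation Y = saturation C"
  proof
    show "saturation Y \<subseteq> saturation C" using YC by (auto simp: saturation_def)
    show "saturation C \<subseteq> saturation Y"
      unfolding saturation_def using S(3) SY R_trans by blast
  qed
  ultimately show ?thesis by auto
qed

text \<open>The ranks form a linear order without infinite descent rather than the natural numbers,
  so the induction runs along the strict order of ranks pulled back to definable sets.\<close>

lemma ex_dquot:
  assumes er: "good_eRank M Ec eRank" and C: "definable M m C" "rel_closed m X C"
  shows "\<exists>n f. dquot M m n (saturation C) R f"
proof -
  define r where "r = {(C', C). definable M m C' \<and> definable M m C \<and> eRank m C' < eRank m C}"
  note er' = er[unfolded good_eRank_def, rule_format, of m]
  have er_val: "\<forall>X. definable M m X \<longrightarrow> eRank m X \<in> Some ` Ec m \<union> {None}"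
    using er' by (elim conjE) assumption
  have er_chain: "\<not> (\<exists>s::nat \<Rightarrow> _. \<forall>i. s i \<in> Ec m \<and> s (Suc i) < s i)"
    using er' by (elim conjE) assumption
  have "wf r"
    unfolding wf_iff_no_infinite_down_chain
  proof
    assume "\<exists>c. \<forall>i. (c (Suc i), c i) \<in> r"
    then obtain c where c: "\<And>i. definable M m (c i)" "\<And>i. eRank m (c (Suc i)) < eRank m (c i)"
      by (auto simp: r_def)
    \<comment> \<open>Every member of a descending chain has another below it, so none takes the
      least value \<open>None\<close>, and the chain lies in \<open>Ec m\<close>.\<close>
    have "\<exists>e. eRank m (c i) = Some e \<and> e \<in> Ec m" for i
      using er_val c(1)[of i] c(2)[of i] by (cases "eRank m (c i)") auto
    then obtain s where s: "\<And>i. eRank m (c i) = Some (s i)" "\<And>i. s i \<in> Ec m" by metis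
    then have "s (Suc i) < s i" for i using c(2)[of i] by simp
    then show False using er_chain s(2) by blast
  qed
  then show ?thesis using C
  proof (induction C rule: wf_induct_rule)
    case (less C)
    show ?case
    proof (cases "C = {}")
      case True
      have "dquot M m 0 {} R (\<lambda>x i. undefined)"
        by (simp add: dquot_def dfun_def dtup_def l1_cont_def lifts_clus_def cart_def)
      then show ?thesis using True by (auto simp: saturation_def)
    next
      case False
      show ?thesis
        by (rule ex_dquot_step[OF er less.prems False]) (use less in \<open>auto simp: r_def\<close>)
    qed
  qed
qed

end

section \<open>From lifted cluster points to definable properness\<close>

context definably_complete_field
begin

lemma definable_image:
  assumes "definable M m A" "dfun M m n f" "\<And>x. f x \<in> cart n"
  shows "definable M n (f ` A)"
  unfolding definable_iff_dpred
proof
  have "y \<in> f ` A \<longleftrightarrow> (\<exists>x\<in>A. \<forall>i<n. y i = f x i)" if "y \<in> cart n" for y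
    using cart_eqI[OF that assms(3)] by blast
  moreover have "dpred M (\<lambda>E. \<exists>x\<in>A. \<forall>i<n. restrict (E 0) {..<n} i = f x i)"
    by (rule dfb assms(1) dpred_all_less dterm_dfun[OF assms(2)] | assumption)+
  ultimately show "dpred M (\<lambda>E. restrict (E 0) {..<n} \<in> f ` A)"
    using restrict_in_cart by (simp del: restrict_apply)
qed (use assms(3) in auto)

lemma definable_map_if_dfun:
  assumes A: "definable M m A" and f: "dfun M m n f" "\<And>x. f x \<in> cart n"
  shows "definable_map M m A n (f ` A) f"
  unfolding definable_map_def
proof (intro conjI)
  have Ac: "A \<subseteq> cart m" by (rule definable_subset_cart[OF A])
  have "z \<in> (\<lambda>x. join m x (f x)) ` A \<longleftrightarrow> (\<exists>x\<in>A. \<forall>i<m + n. z i = join m x (f x) i)"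
    if z: "z \<in> cart (m + n)" for z
  proof -
    have "z = join m x (f x) \<longleftrightarrow> (\<forall>i<m + n. z i = join m x (f x) i)" if "x \<in> A" for x
      using cart_eqI[OF z join_in_cart[OF _ f(2)]] that Ac by blast
    then show ?thesis by auto
  qed
  moreover have "dterm M (\<lambda>E. join m (restrict (E a) {..<m}) (f (restrict (E a) {..<m})) i)" if "i < m + n" for a i
    by (rule dtupD[OF dtup_join[OF dtup_restrict dtup_dfun[OF f(1)]] that])
  then have "dpred M (\<lambda>E. \<exists>x\<in>A. \<forall>i<m + n. restrict (E 0) {..<m + n} i = join m x (f x) i)"
    by - (rule dfb A dpred_all_less | assumption)+
  ultimately show "definable M (m + n) ((\<lambda>x. join m x (f x)) ` A)"
    unfolding definable_iff_dpred using Ac f(2) restrict_in_cart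
    by (auto intro!: join_in_cart simp del: restrict_apply)
qed (use A definable_image[OF A f] in auto)

text \<open>The family is pushed forward into \<open>K\<close>, where boundedness gives a cluster
  point and closedness retains it; the lifting property then brings it back to
  \<open>A\<close>.\<close>

lemma dquot_compact_cluster:
  assumes A: "definable M m A" and f: "dquot M m n A R f"
    and K: "definably_compact M n K" "K \<subseteq> f ` A"
    and Z: "dfam M m A Z" "\<And>t. 0 < t \<Longrightarrow> Z t \<noteq> {}" "\<And>t. 0 < t \<Longrightarrow> f ` Z t \<subseteq> K"
  shows "\<exists>a\<in>A. clus m Z a \<and> f a \<in> K"
proof -
  note fD = dquotD[OF f]
  \<comment> \<open>A form of the image of \<open>Z t\<close> that the calculus can handle. It is
    compared with the image for positive \<open>t\<close> only, where \<open>Z t\<close> is known to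
    consist of tuples of length \<open>m\<close>.\<close>
  define V where "V t = {y \<in> cart n. \<exists>x\<in>cart m. x \<in> Z t \<and> (\<forall>i<n. y i = f x i)}" for t
  have Vi: "V t = f ` Z t" if "0 < t" for t
  proof -
    have "Z t \<subseteq> cart m" using dfam_subset[OF Z(1) that] definable_subset_cart[OF A] by blast
    then show ?thesis unfolding V_def using fD(2) cart_eqI[OF _ fD(2)] by blast
  qed
  have V: "dfam M n (cart n) V"
  proof (rule dfamI)
    show "dpred M (\<lambda>E. restrict (E 0) {..<n} \<in> V (E 1 0))"
      unfolding V_def mem_Collect_eq by (rule dfb dfam_mem[OF Z(1)] dpred_all_less dterm_dfun[OF fD(1)] | assumption | simp)+
    show "V s \<subseteq> V t" if "0 < s" "s \<le> t" for s t
      using dfam_mono[OF Z(1) that] unfolding V_def by blast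
  qed (auto simp: V_def)
  obtain a b where ab: "\<And>z i. z \<in> K \<Longrightarrow> i < n \<Longrightarrow> a i \<le> z i \<and> z i \<le> b i"
    using K(1) unfolding definably_compact_def bounded_cart_def by blast
  define B where "B = (\<Sum>i<n. \<bar>a i\<bar> + \<bar>b i\<bar>)"
  have "\<bar>z i\<bar> \<le> B" if "z \<in> V 1" "i < n" for z i
  proof -
    have "z \<in> K" using Vi[OF zero_less_one] Z(3)[OF zero_less_one] that(1) by blast
    then have "\<bar>z i\<bar> \<le> \<bar>a i\<bar> + \<bar>b i\<bar>" using ab[of z i] that(2) by linarith
    also have "\<dots> \<le> B" unfolding B_def using that(2) by (intro member_le_sum) auto
    finally show ?thesis .
  qed
  moreover have "V t \<noteq> {}" if "0 < t" for t using Vi[OF that] Z(2)[OF that] by simp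
  ultimately obtain c where c: "c \<in> cart n" "clus n V c" using ex_clus[OF V] by blast
  have "\<exists>y\<in>K. l1 n c y < \<epsilon>" if "0 < \<epsilon>" for \<epsilon>
    using clusD[OF c(2) that zero_less_one] Vi[OF zero_less_one] Z(3)[OF zero_less_one] by blast
  then have cK: "c \<in> K" using K(1) c(1) unfolding definably_compact_def closedin_cart_top by blast
  moreover have "clus n (\<lambda>t. f ` Z t) c" using c(2) Vi by (simp add: clus_def)
  ultimately show ?thesis using lifts_clusD[OF fD(5) Z(1)] K(2) by (metis subsetD)
qed

text \<open>Both parts of compactness of the preimage come from cluster points inside it: points
  approaching \<open>x\<close> show that \<open>x\<close> belongs to it, and points of growing norm
  cannot cluster at all.\<close>

lemma definably_proper_if_dquot:
  assumes A: "definable M m A" and f: "dquot M m n A R f"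
  shows "definably_proper M m A n (f ` A) f"
  unfolding definably_proper_def
proof (intro conjI allI impI)
  note fD = dquotD[OF f]
  have Ac: "A \<subseteq> cart m" by (rule definable_subset_cart[OF A])
  show "definable_map M m A n (f ` A) f" by (rule definable_map_if_dfun[OF A fD(1,2)])
  show "continuous_map (subtopology (cart_top m) A) (subtopology (cart_top n) (f ` A)) f"
    using fD(2) by (intro continuous_map_cart_top[OF fD(3) Ac]) auto
  fix K assume "K \<subseteq> f ` A \<and> definably_compact M n K"
  then have K: "K \<subseteq> f ` A" "definably_compact M n K" by auto
  then have Kd: "definable M n K" by (simp add: definably_compact_def)
  define L where "L = {x \<in> A. f x \<in> K}"
  have Kf: "dpred M (\<lambda>E. f (restrict (E b) {..<m}) \<in> K)" for b
    by (rule dpred_mem_dtup[OF Kd dtup_dfun[OF fD(1)] fD(2)])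
  have L: "definable M m L"
    unfolding L_def by (rule definable_Collect_sub[OF A Kf])
  \<comment> \<open>The common core: a condition that tightens as \<open>t\<close> decreases and
    stays satisfiable in \<open>L\<close> accumulates at a point of \<open>L\<close>.\<close>
  have cl: "\<exists>a\<in>L. \<forall>\<epsilon>>0. \<forall>t>0. \<exists>y\<in>L. P t y \<and> l1 m a y < \<epsilon>"
    if P: "dpred M (\<lambda>E. P (E 1 0) (restrict (E 0) {..<m}))" "\<And>t. 0 < t \<Longrightarrow> \<exists>x\<in>L. P t x"
      "\<And>s t x. 0 < s \<Longrightarrow> s \<le> t \<Longrightarrow> P s x \<Longrightarrow> P t x" for P
  proof -
    have "dfam M m A (\<lambda>t. {x \<in> L. P t x})"
    proof (rule dfamI)
      show "dpred M (\<lambda>E. restrict (E 0) {..<m} \<in> {x \<in> L. P (E 1 0) x})"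
        unfolding mem_Collect_eq by (rule dpred_conj[OF dpred_mem[OF L] P(1)])
      show "{x \<in> L. P s x} \<subseteq> {x \<in> L. P t x}" if "0 < s" "s \<le> t" for s t
        using P(3)[OF that] by blast
    qed (auto simp: L_def)
    then have "\<exists>a\<in>A. clus m (\<lambda>t. {x \<in> L. P t x}) a \<and> f a \<in> K"
      using P(2) by (intro dquot_compact_cluster[OF A f K(2,1)]) (auto simp: L_def)
    then show ?thesis unfolding clus_def L_def by blast
  qed
  have "closedin (cart_top m) L"
    unfolding closedin_cart_top
  proof (intro conjI ballI impI)
    fix x assume x: "x \<in> cart m" and near: "\<forall>\<epsilon>>0. \<exists>y\<in>L. l1 m x y < \<epsilon>"
    have "\<exists>a\<in>L. \<forall>\<epsilon>>0. \<forall>t>0. \<exists>y\<in>L. l1 m x y < t \<and> l1 m a y < \<epsilon>"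
    proof (rule cl)
      show "dpred M (\<lambda>E. l1 m x (restrict (E 0) {..<m}) < E 1 0)" by (rule dfb)+
    qed (use near in auto)
    then obtain a where a: "a \<in> L" "\<And>\<epsilon> t. 0 < \<epsilon> \<Longrightarrow> 0 < t \<Longrightarrow> \<exists>y\<in>L. l1 m x y < t \<and> l1 m a y < \<epsilon>"
      by blast
    have "l1 m x a < \<epsilon>" if \<epsilon>: "0 < \<epsilon>" for \<epsilon>
    proof -
      obtain y where "l1 m x y < \<epsilon> / 2" "l1 m a y < \<epsilon> / 2"
        using a(2)[OF half_gt_zero[OF \<epsilon>] half_gt_zero[OF \<epsilon>]] by blast
      then have "l1 m x a < \<epsilon> / 2 + \<epsilon> / 2"
        using l1_triangle[of m x a y] l1_commute[of m a y] by linarith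
      then show ?thesis by simp
    qed
    then have "x = a" using a(1) Ac by (intro eq_if_l1_small[OF x]) (auto simp: L_def)
    then show "x \<in> L" using a(1) by simp
  qed (use Ac in \<open>auto simp: L_def\<close>)
  moreover have "\<exists>c. \<forall>x\<in>L. l1 m (\<lambda>_. 0) x \<le> c"
  proof (rule ccontr)
    assume "\<not> ?thesis"
    then have unb: "\<exists>x\<in>L. inverse s < l1 m (\<lambda>_. 0) x" for s by (meson not_le)
    have "\<exists>a\<in>L. \<forall>\<epsilon>>0. \<forall>t>0. \<exists>y\<in>L. inverse t < l1 m (\<lambda>_. 0) y \<and> l1 m a y < \<epsilon>"
    proof (rule cl)
      show "dpred M (\<lambda>E. inverse (E 1 0) < l1 m (\<lambda>_. 0) (restrict (E 0) {..<m}))" by (rule dfb)+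
      show "inverse t < l1 m (\<lambda>_. 0) x" if "0 < s" "s \<le> t" "inverse s < l1 m (\<lambda>_. 0) x" for s t and x :: "nat \<Rightarrow> 'a"
        using that by (meson le_imp_inverse_le le_less_trans)
    qed (rule unb)
    then obtain a where a: "\<And>t. 0 < t \<Longrightarrow> \<exists>y\<in>L. inverse t < l1 m (\<lambda>_. 0) y \<and> l1 m a y < 1"
      using zero_less_one by blast
    define c where "c = l1 m (\<lambda>_. 0) a + 1"
    have "0 < inverse c" by (simp add: c_def add_nonneg_pos)
    then obtain y where "c < l1 m (\<lambda>_. 0) y" "l1 m a y < 1" using a[of "inverse c"] by auto
    then show False using l1_triangle[of m "\<lambda>_. 0" y a] by (simp add: c_def)
  qed
  then have "bounded_cart m L"
  proof
    fix c assume c: "\<forall>x\<in>L. l1 m (\<lambda>_. 0) x \<le> c"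
    have "- c \<le> x i \<and> x i \<le> c" if "x \<in> L" "i < m" for x i
      using c[rule_format, OF that(1)] abs_le_l1[OF that(2), of "\<lambda>_. 0" x] by auto
    then show ?thesis
      unfolding bounded_cart_def by (intro exI[of _ "\<lambda>_. - c"] exI[of _ "\<lambda>_. c"] ballI allI impI)
  qed
  ultimately show "definably_compact M m {x \<in> A. f x \<in> K}"
    using L by (simp add: definably_compact_def L_def)
qed

end

theorem theorem4p8:
  fixes M :: "('a::{linordered_field, linorder_topology}, 'f, 'r) fo_struct"
    and \<DD> :: "'a set set"
    and Ec :: "nat \<Rightarrow> 'e::linorder set"
    and eRank :: "nat \<Rightarrow> (nat \<Rightarrow> 'a) set \<Rightarrow> 'e option"
    and m :: nat
    and X :: "(nat \<Rightarrow> 'a) set"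
    and E :: "((nat \<Rightarrow> 'a) \<times> (nat \<Rightarrow> 'a)) set"
  assumes "expands_ordered_field M"
    and "definably_complete M"
    and "definable_choice M"
    and "good_pseudo_filter M \<DD>"
    and "good_eRank M Ec eRank"
    and "definable M m X" and "X \<noteq> {}"
    and "definable_equiv M m X E"
    and "equiv_definably_proper_over M m X E"
  shows "\<exists>n Y \<pi>. definable_proper_quotient M m X E n Y \<pi>"
proof -
  interpret proper_equiv M \<DD> m X E
    using assms by unfold_locales
  \<comment> \<open>\<open>X\<close> is relatively closed in itself and its own saturation, so the
    inductive result applies to it directly.\<close>
  have "rel_closed m X X" by (simp add: rel_closed_def)
  then obtain n \<pi> where "dquot M m n (saturation X) E \<pi>"
    using ex_dquot[OF assms(5,6)] by blast
  moreover have "saturation X = X" using R_refl by (auto simp: saturation_def)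
  ultimately have \<pi>: "dquot M m n X E \<pi>" by simp
  then have "definable_proper_quotient M m X E n (\<pi> ` X) \<pi>"
    using definably_proper_if_dquot[OF assms(6) \<pi>] dquotD(4)[OF \<pi>]
    unfolding definable_proper_quotient_def by blast
  then show ?thesis by blast
qed

end
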